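(* Let $\mathcal{B}_b(\mathbb{R}^d)$ be the space of bounded Borel measurable functions $\mathbb{R}^d\to\mathbb{R}$, and let $A:\mathcal{D}(A)\to\mathcal{B}_b(\mathbb{R}^d)$ be a sublinear operator with $\mathcal{D}(A)\subseteq\mathcal{B}_b(\mathbb{R}^d)$. Assume that $A$ satisfies the positive maximum principle: if $f\in\mathcal{D}(A)$ and $f(x_0)=\sup_{x\in\mathbb{R}^d}f(x)\ge0$, then $Af(x_0)\le0$. If $C_c^\infty(\mathbb{R}^d)\subseteq\mathcal{D}(A)$, then there exist an index set $I$ and a family $(c_\theta(x),b_\theta(x),Q_\theta(x),\nu_\theta(x,dy))$, $\theta\in I$, $x\in\mathbb{R}^d$, of characteristics such that $$Af(x)=\sup_{\theta\in I}A_\theta f(x),\qquad f\in C_c^\infty(\mathbb{R}^d),\ x\in\mathbb{R}^d,$$ where $$A_\theta f(x):=-c_\theta(x)f(x)+b_\theta(x)\cdot\nabla f(x)+\tfrac12\operatorname{tr}(Q_\theta(x)\cdot\nabla^2f(x))+\int_{y\ne0}\big(f(x+y)-f(x)-y\cdot\nabla f(x)\mathbf{1}_{(0,1)}(|y|)\big)\,\nu_\theta(x,dy).$$ The supremum is attained, i.e. for any $f\in C_c^\infty(\mathbb{R}^d)$ and $x\in\mathbb{R}^d$ there exists $\theta=\theta(f,x)\in I$ such that $Af(x)=A_\theta f(x)$. Moreover, for each $x\in\mathbb{R}^d$, $$\sup_{\theta\in I}\Big(|c_\theta(x)|+|b_\theta(x)|+|Q_\theta(x)|+\int_{y\ne0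}\min\{1,|y|^2\}\,\nu_\theta(x,dy)\Big)<\infty.$$
   Context: $C_c^\infty(\mathbb{R}^d)$ is the space of compactly supported smooth real-valued functions. An operator $A$ is sublinear if $A(f+g)\le Af+Ag$ and $A(\lambda f)=\lambda Af$ for all $f,g$ in its domain and $\lambda\in[0,\infty)$. "Characteristics" means: for each $\theta$ and each fixed $x$, $c_\theta(x)\ge0$, $b_\theta(x)\in\mathbb{R}^d$, $Q_\theta(x)\in\mathbb{R}^{d\times d}$ is positive semidefinite (symmetric), and $\nu_\theta(x,dy)$ is a measure on $\mathbb{R}^d\setminus\{0\}$ with $\int_{y\ne0}\min\{1,|y|^2\}\,\nu_\theta(x,dy)<\infty$. No measurability in $x$ is asserted. *)

theory Defs
  imports "HOL-Analysis.Analysis"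
begin

definition bounded_borel :: "(real^'n \<Rightarrow> real) set" where
  "bounded_borel = {f. f \<in> borel_measurable borel \<and> bounded (range f)}"

text \<open>Smoothness is \<open>C_k\<close> for all \<open>k\<close>; a map is \<open>C_(k+1)\<close> if it is differentiable and all its
  directional derivatives are \<open>C_k\<close>.\<close>

primrec C_k :: "nat \<Rightarrow> (real^'n \<Rightarrow> real) \<Rightarrow> bool" where
  "C_k 0 f \<longleftrightarrow> continuous_on UNIV f"
| "C_k (Suc k) f \<longleftrightarrow>
    (\<forall>x. f differentiable (at x)) \<and> (\<forall>v. C_k k (\<lambda>x. frechet_derivative f (at x) v))"

definition Cc_infinity :: "(real^'n \<Rightarrow> real) set" where
  "Cc_infinity = {f. (\<forall>k. C_k k f) \<and> compact (closure {x. f x \<noteq> 0})}"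

definition gradient :: "(real^'n \<Rightarrow> real) \<Rightarrow> real^'n \<Rightarrow> real^'n" where
  "gradient f x = (\<chi> i. frechet_derivative f (at x) (axis i 1))"

definition hessian :: "(real^'n \<Rightarrow> real) \<Rightarrow> real^'n \<Rightarrow> real^'n^'n" where
  "hessian f x = (\<chi> i j. frechet_derivative (\<lambda>y. gradient f y $ j) (at x) (axis i 1))"

text \<open>The domain is not required to be a convex cone: the two conditions are imposed
  whenever the functions involved belong to the domain.\<close>

definition sublinear_on ::
  "(real^'n \<Rightarrow> real) set \<Rightarrow> ((real^'n \<Rightarrow> real) \<Rightarrow> (real^'n \<Rightarrow> real)) \<Rightarrow> bool" where
  "sublinear_on D A \<longleftrightarrow>
    (\<forall>f\<in>D. \<forall>g\<in>D. (\<lambda>x. f x + g x) \<in> D \<longrightarrow> (\<forall>x. A (\<lambda>x. f x + g x) x \<le> A f x + A g x)) \<and>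
    (\<forall>f\<in>D. \<forall>r\<ge>0. (\<lambda>x. r * f x) \<in> D \<longrightarrow> (\<forall>x. A (\<lambda>x. r * f x) x = r * A f x))"

text \<open>The real-valued supremum is meaningful because this is only used for domains consisting
  of bounded functions.\<close>

definition positive_maximum_principle ::
  "(real^'n \<Rightarrow> real) set \<Rightarrow> ((real^'n \<Rightarrow> real) \<Rightarrow> (real^'n \<Rightarrow> real)) \<Rightarrow> bool" where
  "positive_maximum_principle D A \<longleftrightarrow>
    (\<forall>f\<in>D. \<forall>x0. f x0 = (SUP x. f x) \<and> (SUP x. f x) \<ge> 0 \<longrightarrow> A f x0 \<le> 0)"

definition positive_semidefinite :: "real^'n^'n \<Rightarrow> bool" where
  "positive_semidefinite Q \<longleftrightarrow> transpose Q = Q \<and> (\<forall>v. v \<bullet> (Q *v v) \<ge> 0)"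

text \<open>Characteristics at a single point; \<open>\<nu>\<close> is a Borel measure on the punctured space, so
  that integrals with respect to \<open>\<nu>\<close> are integrals over \<open>y \<noteq> 0\<close>.\<close>

definition characteristics ::
  "real \<Rightarrow> real^'n \<Rightarrow> real^'n^'n \<Rightarrow> (real^'n) measure \<Rightarrow> bool" where
  "characteristics c b Q \<nu> \<longleftrightarrow>
    c \<ge> 0 \<and> positive_semidefinite Q \<and>
    sets \<nu> = sets (restrict_space borel (- {0})) \<and>
    (\<integral>\<^sup>+ y. ennreal (min 1 ((norm y)\<^sup>2)) \<partial>\<nu>) < \<infinity>"

text \<open>For \<open>f\<close> in \<open>Cc_infinity\<close> and \<open>\<nu>\<close> belonging to characteristics, the integrand is bounded by a
  multiple of \<open>min 1 ((norm y)\<^sup>2)\<close>, so the Bochner integral is never the default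
  value for non-integrable functions.\<close>

definition levy_type_operator ::
  "real \<Rightarrow> real^'n \<Rightarrow> real^'n^'n \<Rightarrow> (real^'n) measure \<Rightarrow> (real^'n \<Rightarrow> real) \<Rightarrow> real^'n \<Rightarrow> real" where
  "levy_type_operator c b Q \<nu> f x =
    - c * f x + b \<bullet> gradient f x + 1/2 * trace (Q ** hessian f x) +
    (\<integral>y. (f (x + y) - f x - (y \<bullet> gradient f x) * indicator {0<..<1} (norm y)) \<partial>\<nu>)"

end

theory Submission
  imports Defs
begin

text \<open>
  Fix \<open>x\<close>. The functional \<open>p f = A f x\<close> on the test functions is sublinear, so by Hahn--Banach it is
  the pointwise maximum of the linear functionals \<open>L \<le> p\<close>, and each such \<open>L\<close> inherits the positive
  maximum principle at \<open>x\<close>. After translating \<open>x\<close> to the origin, Courrege's argument applies: \<open>L\<close> is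
  nonnegative on nonnegative test functions vanishing at \<open>0\<close>, hence extends to a positive functional
  on all boundedly supported functions that are \<open>O(|y|\<^sup>2)\<close>, and a Riesz type argument gives the
  Levy measure on the complement of \<open>0\<close>. Subtracting the second-order Taylor polynomial, cut off
  near \<open>0\<close>, from a test function leaves a remainder of order \<open>o(|y|\<^sup>2)\<close>, on which \<open>L\<close> is just the
  integral. All bounds depend only on the values of \<open>L\<close> at finitely many cut-off polynomials of
  degree at most two, which \<open>p\<close> controls uniformly in \<open>L\<close>.
\<close>

section \<open>Dominated linear functionals\<close>

text \<open>The obstacle is that neither the constant 1 nor any indicator is a test function, so
  \<open>L\<close> cannot be evaluated on sets directly. Indicators enter through a positive
  extension, which exists because \<open>|y|^2\<close> times a wide cutoff is itself a test function
  and majorises everything in \<open>quadratic_space\<close>. The extension comes from Zorn's lemma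
  and is only known to be finitely additive, so it is trusted only on sets squeezed between compact
  and open ones; superlevel sets of continuous functions supply enough of those. The measure does
  not see what \<open>L\<close> does at the origin. The excess of \<open>L\<close> over the integral
  on the functions \<open>y_i y_j cutoff\<close> becomes the diffusion matrix, and the missing value
  at 1 is replaced by \<open>L cutoff\<close> plus the integral of \<open>1 - cutoff\<close>, whose
  negative is the killing rate. The index set is the set of test functions itself: at each point the
  index \<open>\<theta>\<close> stands for a functional below \<open>p\<close> that touches
  \<open>p\<close> at \<open>\<theta>\<close>, so the supremum at \<open>f\<close> is attained by
  the index \<open>f\<close>. The choices at different points are independent of each other.\<close>

definition linear_functional_on :: "('a \<Rightarrow> real) set \<Rightarrow> (('a \<Rightarrow> real) \<Rightarrow> real) \<Rightarrow> bool" where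
  "linear_functional_on V L \<longleftrightarrow>
    (\<forall>f\<in>V. \<forall>g\<in>V. L (\<lambda>x. f x + g x) = L f + L g) \<and> (\<forall>f\<in>V. \<forall>r. L (\<lambda>x. r * f x) = r * L f)"

definition sublinear_functional_on :: "('a \<Rightarrow> real) set \<Rightarrow> (('a \<Rightarrow> real) \<Rightarrow> real) \<Rightarrow> bool" where
  "sublinear_functional_on V p \<longleftrightarrow>
    (\<forall>f\<in>V. \<forall>g\<in>V. p (\<lambda>x. f x + g x) \<le> p f + p g) \<and>
    (\<forall>f\<in>V. \<forall>r\<ge>0. p (\<lambda>x. r * f x) = r * p f)"

definition function_space :: "('a \<Rightarrow> real) set \<Rightarrow> bool" where
  "function_space V \<longleftrightarrow> (\<lambda>x. 0) \<in> V \<and>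
    (\<forall>f\<in>V. \<forall>g\<in>V. (\<lambda>x. f x + g x) \<in> V) \<and> (\<forall>f\<in>V. \<forall>r. (\<lambda>x. r * f x) \<in> V)"

lemma linear_functional_onD:
  assumes "linear_functional_on V L" "f \<in> V"
  shows "g \<in> V \<Longrightarrow> L (\<lambda>x. f x + g x) = L f + L g" and "L (\<lambda>x. r * f x) = r * L f"
  using assms unfolding linear_functional_on_def by simp_all

lemma sublinear_functional_onD:
  assumes "sublinear_functional_on V p" "f \<in> V"
  shows "g \<in> V \<Longrightarrow> p (\<lambda>x. f x + g x) \<le> p f + p g" and "r \<ge> 0 \<Longrightarrow> p (\<lambda>x. r * f x) = r * p f"
  using assms unfolding sublinear_functional_on_def by simp_all

lemma function_spaceD:
  assumes "function_space V"
  shows "(\<lambda>x. 0) \<in> V" and "f \<in> V \<Longrightarrow> g \<in> V \<Longrightarrow> (\<lambda>x. f x + g x) \<in> V"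
    and "f \<in> V \<Longrightarrow> (\<lambda>x. r * f x) \<in> V" and "f \<in> V \<Longrightarrow> (\<lambda>x. - f x) \<in> V"
proof -
  show s: "f \<in> V \<Longrightarrow> (\<lambda>x. r * f x) \<in> V" for r f using assms unfolding function_space_def by simp
  show "f \<in> V \<Longrightarrow> (\<lambda>x. - f x) \<in> V" using s[of f "-1"] by simp
qed (use assms in \<open>simp_all add: function_space_def\<close>)

lemma function_space_diff:
  assumes "function_space V" "f \<in> V" "g \<in> V"
  shows "(\<lambda>x. f x - g x) \<in> V"
proof -
  have "(\<lambda>x. - 1 * g x) \<in> V" using assms by (simp add: function_spaceD)
  from function_spaceD(2)[OF assms(1,2) this] show ?thesis by simp
qed

lemma function_space_sum:
  assumes "function_space V" "\<And>i. i \<in> S \<Longrightarrow> f i \<in> V"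
  shows "(\<lambda>x. \<Sum>i\<in>S. f i x) \<in> V"
  using assms(2)
proof (induction S rule: infinite_finite_induct)
  case (insert i S)
  then have "(\<lambda>x. f i x + (\<Sum>i\<in>S. f i x)) \<in> V"
    by (intro function_spaceD(2)[OF assms(1)]) auto
  then show ?case using insert by simp
qed (use assms(1) in \<open>auto simp: function_space_def\<close>)

lemma linear_functional_diff:
  assumes "function_space V" "linear_functional_on V L" "f \<in> V" "g \<in> V"
  shows "L (\<lambda>x. f x - g x) = L f - L g"
proof -
  have "(\<lambda>x. - 1 * g x) \<in> V" using assms by (simp add: function_spaceD)
  have "L (\<lambda>x. f x + - 1 * g x) = L f + L (\<lambda>x. - 1 * g x)"
    by (rule linear_functional_onD(1)[OF assms(2,3) \<open>(\<lambda>x. - 1 * g x) \<in> V\<close>])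
  also have "L (\<lambda>x. - 1 * g x) = - 1 * L g"
    by (rule linear_functional_onD(2)[OF assms(2,4)])
  finally show ?thesis by simp
qed

lemma linear_functional_sum:
  assumes "function_space V" "linear_functional_on V L" "\<And>i. i \<in> S \<Longrightarrow> f i \<in> V"
  shows "L (\<lambda>x. \<Sum>i\<in>S. f i x) = (\<Sum>i\<in>S. L (f i))"
  using assms(3)
proof (induction S rule: infinite_finite_induct)
  case (insert i S)
  have "L (\<lambda>x. f i x + (\<Sum>i\<in>S. f i x)) = L (f i) + L (\<lambda>x. \<Sum>i\<in>S. f i x)"
    by (rule linear_functional_onD(1)[OF assms(2)]) (use insert function_space_sum[OF assms(1), of S f] in auto)
  then show ?case using insert by simp
next
  case (infinite S)
  have "L (\<lambda>x. 0 * 0) = 0 * L (\<lambda>x. 0)"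
    by (rule linear_functional_onD(2)[OF assms(2) function_spaceD(1)[OF assms(1)]])
  with infinite show ?case by simp
next
  case empty
  have "L (\<lambda>x. 0 * 0) = 0 * L (\<lambda>x. 0)"
    by (rule linear_functional_onD(2)[OF assms(2) function_spaceD(1)[OF assms(1)]])
  then show ?case by simp
qed

lemma sublinear_functional_neg:
  assumes V: "function_space V" and p: "sublinear_functional_on V p" and f: "f \<in> V"
  shows "- p (\<lambda>x. - f x) \<le> p f"
proof -
  have n: "(\<lambda>x. - f x) \<in> V" using V f by (simp add: function_spaceD)
  have "p (\<lambda>x. 0 * f x) = 0" using sublinear_functional_onD(2)[OF p f, of 0] by simp
  moreover have "p (\<lambda>x. f x + - f x) \<le> p f + p (\<lambda>x. - f x)"
    by (rule sublinear_functional_onD(1)[OF p f n])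
  ultimately show ?thesis by simp
qed

text \<open>With \<open>h = 1/t\<close> the expression is \<open>(q (g + h f) - q g) / h\<close>, so
  \<open>q'\<close> is the one-sided directional derivative of \<open>q\<close> at \<open>g\<close>.
  It is sublinear, lies below \<open>q\<close> (take \<open>t = 0\<close>), and at \<open>-g\<close>
  it is at most \<open>- q g\<close> (take \<open>t = 1\<close>).\<close>

lemma sublinear_shift:
  assumes V: "function_space V" and q: "sublinear_functional_on V q" and g: "g \<in> V"
  defines "q' \<equiv> \<lambda>f. INF t\<in>{0..}. q (\<lambda>x. f x + t * g x) - t * q g"
  shows "sublinear_functional_on V q'"
    and "\<And>f t. f \<in> V \<Longrightarrow> 0 \<le> t \<Longrightarrow> q' f \<le> q (\<lambda>x. f x + t * g x) - t * q g"
proof -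
  have q'_eq: "q' f = (INF t\<in>{0..}. q (\<lambda>x. f x + t * g x) - t * q g)" for f
    by (simp add: q'_def)
  have tg: "(\<lambda>x. t * g x) \<in> V" for t using V g by (simp add: function_spaceD)
  have fg: "(\<lambda>x. f x + t * g x) \<in> V" if "f \<in> V" for f t
    by (rule function_spaceD(2)[OF V that tg])
  have sub: "q (\<lambda>x. f x + h x) \<le> q f + q h" if "f \<in> V" "h \<in> V" for f h
    using sublinear_functional_onD[OF q that(1)] that(2) by simp
  have hom: "q (\<lambda>x. r * f x) = r * q f" if "f \<in> V" "r \<ge> 0" for f r
    using sublinear_functional_onD[OF q that(1)] that(2) by simp
  \<comment> \<open>A lower bound independent of \<open>t\<close> is needed because a real infimum
    over an unbounded set carries no information.\<close>
  have lower: "- q (\<lambda>x. - f x) \<le> q (\<lambda>x. f x + t * g x) - t * q g" if "f \<in> V" "t \<ge> 0" for f t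
  proof -
    have n: "(\<lambda>x. - f x) \<in> V" using V that by (simp add: function_spaceD)
    have "t * q g = q (\<lambda>x. (f x + t * g x) + - f x)" using hom[OF g that(2)] by simp
    also have "\<dots> \<le> q (\<lambda>x. f x + t * g x) + q (\<lambda>x. - f x)" using sub[OF fg[OF that(1)] n] .
    finally show ?thesis by simp
  qed
  have bdd: "bdd_below ((\<lambda>t. q (\<lambda>x. f x + t * g x) - t * q g) ` {0..})" if "f \<in> V" for f
    using lower[OF that] by (intro bdd_belowI2[of _ "- q (\<lambda>x. - f x)"]) auto
  show le: "q' f \<le> q (\<lambda>x. f x + t * g x) - t * q g" if "f \<in> V" "0 \<le> t" for f t
    unfolding q'_eq using bdd[OF that(1)] that(2) by (intro cINF_lower) auto
  have add: "q' (\<lambda>x. f x + h x) \<le> q' f + q' h" if f: "f \<in> V" and h: "h \<in> V" for f h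
  proof -
    have fh: "(\<lambda>x. f x + h x) \<in> V" using V f h by (simp add: function_spaceD)
    \<comment> \<open>The two parameters are independent on the right and are merged into
      \<open>s + t\<close> on the left, so the infima over \<open>t\<close> and over
      \<open>s\<close> can be taken one after the other.\<close>
    have *: "q' (\<lambda>x. f x + h x) \<le> (q (\<lambda>x. f x + s * g x) - s * q g) + (q (\<lambda>x. h x + t * g x) - t * q g)"
      if "s \<ge> 0" "t \<ge> 0" for s t
    proof -
      have "q' (\<lambda>x. f x + h x) \<le> q (\<lambda>x. f x + h x + (s + t) * g x) - (s + t) * q g"
        using le[OF fh, of "s + t"] that by simp
      also have "(\<lambda>x. f x + h x + (s + t) * g x) = (\<lambda>x. (f x + s * g x) + (h x + t * g x))"
        by (auto simp: algebra_simps)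
      also have "q \<dots> \<le> q (\<lambda>x. f x + s * g x) + q (\<lambda>x. h x + t * g x)"
        using sub[OF fg[OF f] fg[OF h]] .
      finally show ?thesis by (simp add: ring_distribs)
    qed
    have "q' (\<lambda>x. f x + h x) - (q (\<lambda>x. f x + s * g x) - s * q g) \<le> q' h" if "s \<ge> 0" for s
      unfolding q'_eq[of h]
    proof (rule cINF_greatest)
      fix t :: real assume "t \<in> {0..}"
      then show "q' (\<lambda>x. f x + h x) - (q (\<lambda>x. f x + s * g x) - s * q g)
          \<le> q (\<lambda>x. h x + t * g x) - t * q g"
        using *[OF that, of t] by simp
    qed simp
    then have **: "q' (\<lambda>x. f x + h x) - q' h \<le> q (\<lambda>x. f x + s * g x) - s * q g" if "s \<ge> 0" for s
      using that by (metis diff_le_eq le_diff_eq add.commute)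
    have "q' (\<lambda>x. f x + h x) - q' h \<le> q' f"
      unfolding q'_eq[of f] by (rule cINF_greatest) (use ** in auto)
    then show ?thesis by simp
  qed
  have le_scale: "q' (\<lambda>x. r * f x) \<le> r * q' f" if f: "f \<in> V" and r: "r > 0" for f r
  proof -
    have rf: "(\<lambda>x. r * f x) \<in> V" using V f by (simp add: function_spaceD)
    have "q' (\<lambda>x. r * f x) / r \<le> q (\<lambda>x. f x + t * g x) - t * q g" if "t \<ge> 0" for t
    proof -
      have "q' (\<lambda>x. r * f x) \<le> q (\<lambda>x. r * f x + (r * t) * g x) - (r * t) * q g"
        using le[OF rf, of "r * t"] that r by simp
      also have "(\<lambda>x. r * f x + (r * t) * g x) = (\<lambda>x. r * (f x + t * g x))"
        by (auto simp: algebra_simps)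
      also have "q (\<lambda>x. r * (f x + t * g x)) - r * t * q g = (q (\<lambda>x. f x + t * g x) - t * q g) * r"
        unfolding hom[OF fg[OF f] less_imp_le[OF r]] by (simp add: algebra_simps)
      finally show ?thesis using r by (simp only: pos_divide_le_eq)
    qed
    then have "q' (\<lambda>x. r * f x) / r \<le> q' f" unfolding q'_eq[of f] by (intro cINF_greatest) auto
    then show ?thesis using r by (simp only: pos_divide_le_eq mult.commute)
  qed
  have scale: "q' (\<lambda>x. r * f x) = r * q' f" if f: "f \<in> V" and r: "r \<ge> 0" for f r
  proof (cases "r = 0")
    case True
    have "q (\<lambda>x. 0 * f x) = 0" using hom[OF f, of 0] by simp
    then have "q' (\<lambda>x. 0) = 0" unfolding q'_def using hom[OF g] by simp
    then show ?thesis using True by simp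
  next
    case False
    then have r: "r > 0" using r by simp
    have rf: "(\<lambda>x. r * f x) \<in> V" using V f by (simp add: function_spaceD)
    have "q' (\<lambda>x. inverse r * (r * f x)) \<le> inverse r * q' (\<lambda>x. r * f x)"
      using le_scale[OF rf, of "inverse r"] r by simp
    moreover have "(\<lambda>x. inverse r * (r * f x)) = f" using r by auto
    ultimately have "q' f \<le> q' (\<lambda>x. r * f x) / r" by (simp add: divide_inverse mult.commute)
    then have "r * q' f \<le> q' (\<lambda>x. r * f x)" using r by (simp only: pos_le_divide_eq mult.commute)
    with le_scale[OF f r] show ?thesis by simp
  qed
  show "sublinear_functional_on V q'"
    unfolding sublinear_functional_on_def by (intro conjI ballI allI impI add scale)
qed

text \<open>A minimal sublinear functional \<open>q\<close> is linear, because its shift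
  \<open>f \<mapsto> inf\<^sub>t q (f + t g) - t q g\<close> is again sublinear and lies below \<open>q\<close>.\<close>

lemma sublinear_dominates_linear:
  assumes V: "function_space V" and p: "sublinear_functional_on V p"
  obtains L where "linear_functional_on V L" "\<And>f. f \<in> V \<Longrightarrow> L f \<le> p f"
proof -
  \<comment> \<open>Values outside \<open>V\<close> are pinned to 0: the order \<open>P\<close>
    compares them too, and if left free they could always be lowered, so that no minimal element
    would exist.\<close>
  define S where "S = {q. sublinear_functional_on V q \<and> (\<forall>f\<in>V. q f \<le> p f) \<and> (\<forall>f. f \<notin> V \<longrightarrow> q f = 0)}"
  \<comment> \<open>The order is reversed, so that a maximal element in Zorn's sense is a minimal
    functional.\<close>
  define P where "P q r \<longleftrightarrow> (\<forall>f. r f \<le> q f)" for q r :: "('a \<Rightarrow> real) \<Rightarrow> real"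
  define cut where "cut q f = (if f \<in> V then q f else 0)" for q :: "('a \<Rightarrow> real) \<Rightarrow> real" and f
  have addV: "(\<lambda>x. f x + g x) \<in> V" if "f \<in> V" "g \<in> V" for f g
    using V that by (simp add: function_spaceD)
  have scaleV: "(\<lambda>x. r * f x) \<in> V" if "f \<in> V" for f r
    using V that by (simp add: function_spaceD)
  have cutS: "cut q \<in> S" if "sublinear_functional_on V q" "\<And>f. f \<in> V \<Longrightarrow> q f \<le> p f" for q
    using that by (simp add: addV scaleV S_def cut_def sublinear_functional_on_def)
  have lower: "- p (\<lambda>x. - f x) \<le> q f" if "q \<in> S" "f \<in> V" for q f
  proof -
    have n: "(\<lambda>x. - f x) \<in> V" using scaleV[OF that(2), of "-1"] by simp
    then have "- p (\<lambda>x. - f x) \<le> - q (\<lambda>x. - f x)" using that unfolding S_def by auto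
    also have "\<dots> \<le> q f" using sublinear_functional_neg[OF V _ that(2), of q] that unfolding S_def by auto
    finally show ?thesis .
  qed
  have "\<exists>m\<in>S. \<forall>a\<in>S. P m a \<longrightarrow> a = m"
  proof (rule predicate_Zorn)
    show "partial_order_on S (relation_of P S)"
      unfolding P_def
      by (rule partial_order_on_relation_ofI) (simp, meson order_trans, intro ext antisym, simp_all)
    fix C assume "C \<in> Chains (relation_of P S)"
    then have CS: "C \<subseteq> S" and ch: "\<And>q r. q \<in> C \<Longrightarrow> r \<in> C \<Longrightarrow> P q r \<or> P r q"
      unfolding Chains_def relation_of_def by auto
    show "\<exists>u\<in>S. \<forall>a\<in>C. P a u"
    proof (cases "C = {}")
      case True
      then show ?thesis using cutS[OF p] by auto
    next
      case False
      define u where "u f = (INF q\<in>C. q f)" for f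
      have bdd: "bdd_below ((\<lambda>q. q f) ` C)" if "f \<in> V" for f
        using lower[OF _ that] CS by (intro bdd_belowI2[of _ "- p (\<lambda>x. - f x)"]) auto
      have ule: "u f \<le> q f" if "q \<in> C" "f \<in> V" for q f
        unfolding u_def using bdd[OF that(2)] that(1) by (rule cINF_lower)
      have "u (\<lambda>x. f x + g x) \<le> u f + u g" if f: "f \<in> V" and g: "g \<in> V" for f g
      proof -
        have *: "u (\<lambda>x. f x + g x) \<le> q f + r g" if q: "q \<in> C" and r: "r \<in> C" for q r
        proof -
          obtain s where s: "s \<in> C" "s f \<le> q f" "s g \<le> r g"
            using ch[OF q r] q r unfolding P_def by (metis order_refl)
          have "u (\<lambda>x. f x + g x) \<le> s (\<lambda>x. f x + g x)" using ule[OF s(1) addV[OF f g]] .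
          also have "\<dots> \<le> s f + s g"
            using s(1) CS by (intro sublinear_functional_onD(1)[OF _ f g]) (auto simp: S_def)
          finally show ?thesis using s by linarith
        qed
        have "u (\<lambda>x. f x + g x) - q f \<le> u g" if "q \<in> C" for q
          unfolding u_def[of g] using *[OF that] False
          by (intro cINF_greatest) (auto simp: diff_le_eq add.commute)
        then have **: "u (\<lambda>x. f x + g x) - u g \<le> q f" if "q \<in> C" for q
          using that by (simp add: diff_le_eq add.commute)
        have "u (\<lambda>x. f x + g x) - u g \<le> u f"
          unfolding u_def[of f] using False ** by (intro cINF_greatest) auto
        then show ?thesis by simp
      qed
      moreover have "u (\<lambda>x. r * f x) = r * u f" if f: "f \<in> V" and r: "r \<ge> 0" for f r
      proof -
        have "u (\<lambda>x. r * f x) = (INF q\<in>C. r * q f)"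
          unfolding u_def
        proof (intro INF_cong refl)
          fix q assume "q \<in> C"
          then have "sublinear_functional_on V q" using CS unfolding S_def by auto
          then show "q (\<lambda>x. r * f x) = r * q f" using f r by (rule sublinear_functional_onD(2))
        qed
        also have "\<dots> = r * u f"
        proof (cases "r = 0")
          case True
          then show ?thesis using False by simp
        next
          case nz: False
          then have r: "r > 0" using r by simp
          have bdd': "bdd_below ((\<lambda>q. r * q f) ` C)"
            using lower[OF _ f] CS r by (intro bdd_belowI2[of _ "r * - p (\<lambda>x. - f x)"] mult_left_mono) auto
          have "r * u f \<le> (INF q\<in>C. r * q f)"
            using False ule f r by (intro cINF_greatest) auto
          moreover have "(INF q\<in>C. r * q f) / r \<le> u f"
            unfolding u_def[of f] using False r cINF_lower[OF bdd']
            by (intro cINF_greatest) (auto simp: field_simps)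
          ultimately show ?thesis using r by (simp add: field_simps)
        qed
        finally show ?thesis .
      qed
      ultimately have "sublinear_functional_on V u" unfolding sublinear_functional_on_def by simp
      moreover have "u f \<le> p f" if "f \<in> V" for f
      proof -
        obtain q where q: "q \<in> C" using False by blast
        then have "q f \<le> p f" using CS that unfolding S_def by blast
        then show ?thesis using ule[OF q that] by linarith
      qed
      ultimately have "cut u \<in> S" by (rule cutS)
      moreover have "P a (cut u)" if "a \<in> C" for a
        using ule[OF that] that CS unfolding P_def cut_def S_def by auto
      ultimately show ?thesis by blast
    qed
  qed
  then obtain q where qS: "q \<in> S" and min: "\<And>r. r \<in> S \<Longrightarrow> P q r \<Longrightarrow> r = q" by blast
  have q: "sublinear_functional_on V q" and qp: "\<And>f. f \<in> V \<Longrightarrow> q f \<le> p f"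
    using qS unfolding S_def by auto
  have add: "q (\<lambda>x. f x + g x) = q f + q g" if f: "f \<in> V" and g: "g \<in> V" for f g
  proof -
    define q' where "q' = (\<lambda>f. INF t\<in>{0..}. q (\<lambda>x. f x + t * g x) - t * q g)"
    have q': "sublinear_functional_on V q'"
      unfolding q'_def using sublinear_shift(1)[OF V q g] .
    have le: "q' f \<le> q (\<lambda>x. f x + t * g x) - t * q g" if "f \<in> V" "0 \<le> t" for f t
      using sublinear_shift(2)[OF V q g that] unfolding q'_def .
    have q'q: "q' f \<le> q f" if "f \<in> V" for f using le[OF that, of 0] by simp
    have "cut q' \<in> S" by (rule cutS[OF q' order_trans[OF q'q qp]])
    moreover have "P q (cut q')" using q'q qS unfolding P_def cut_def by (simp add: S_def)
    ultimately have "cut q' = q" by (rule min)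
    then have "q' f = q f" using f cut_def[of q' f] by simp
    then have "q f + q g \<le> q (\<lambda>x. f x + g x)" using le[OF f, of 1] by simp
    moreover have "q (\<lambda>x. f x + g x) \<le> q f + q g"
      by (rule sublinear_functional_onD(1)[OF q f g])
    ultimately show ?thesis by simp
  qed
  have pos: "q (\<lambda>x. r * f x) = r * q f" if "f \<in> V" "r \<ge> 0" for f r
    using sublinear_functional_onD[OF q that(1)] that(2) by simp
  have neg: "q (\<lambda>x. - f x) = - q f" if "f \<in> V" for f
    using add[OF that, of "\<lambda>x. - f x"] scaleV[OF that, of "-1"] pos[OF that, of 0] by simp
  have "q (\<lambda>x. r * f x) = r * q f" if f: "f \<in> V" for f r
  proof (cases "r \<ge> 0")
    case False
    then show ?thesis using neg[OF scaleV[OF f, of "- r"]] pos[OF f, of "- r"] by simp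
  qed (use pos f in auto)
  then have "linear_functional_on V q" unfolding linear_functional_on_def by (intro conjI ballI allI add)
  then show ?thesis using qp by (rule that)
qed

text \<open>A linear functional below the directional derivative of \<open>p\<close> at
  \<open>g\<close> is tangent to \<open>p\<close> there: its value at \<open>-g\<close> is at most
  \<open>- p g\<close>, which forces \<open>L g = p g\<close>. This is what makes the final supremum
  attained.\<close>

lemma sublinear_support_functional:
  assumes V: "function_space V" and p: "sublinear_functional_on V p" and g: "g \<in> V"
  obtains L where "linear_functional_on V L" "\<And>f. f \<in> V \<Longrightarrow> L f \<le> p f" "L g = p g"
proof -
  define q where "q = (\<lambda>f. INF t\<in>{0..}. p (\<lambda>x. f x + t * g x) - t * p g)"
  have q: "sublinear_functional_on V q"
    unfolding q_def using sublinear_shift(1)[OF V p g] .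
  have le: "q f \<le> p (\<lambda>x. f x + t * g x) - t * p g" if "f \<in> V" "0 \<le> t" for f t
    using sublinear_shift(2)[OF V p g that] unfolding q_def .
  obtain L where L: "linear_functional_on V L" "\<And>f. f \<in> V \<Longrightarrow> L f \<le> q f"
    using sublinear_dominates_linear[OF V q] by blast
  have n: "(\<lambda>x. - 1 * g x) \<in> V" using V g by (simp add: function_spaceD)
  have "p (\<lambda>x. 0 * g x) = 0" using sublinear_functional_onD(2)[OF p g, of 0] by simp
  then have "L (\<lambda>x. - 1 * g x) \<le> - p g" using L(2)[OF n] le[OF n, of 1] by simp
  moreover have "L (\<lambda>x. - 1 * g x) = - 1 * L g"
    by (rule linear_functional_onD(2)[OF L(1) g])
  moreover have Lp: "L f \<le> p f" if "f \<in> V" for f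
    using L(2)[OF that] le[OF that, of 0] by simp
  ultimately have "L g = p g" using Lp[OF g] by simp
  with L(1) Lp show ?thesis by (rule that)
qed

section \<open>Smooth functions and cutoffs\<close>

lemma C_k_Suc_differentiable: "C_k (Suc k) f \<Longrightarrow> f differentiable (at x)"
  by simp

lemma C_k_SucI:
  assumes "\<And>x. (f has_derivative f' x) (at x)" "\<And>v. C_k k (\<lambda>x. f' x v)"
  shows "C_k (Suc k) f"
proof -
  have "frechet_derivative f (at x) = f' x" for x
    using frechet_derivative_at[OF assms(1)[of x]] by simp
  then show ?thesis using assms by (auto simp: differentiable_def)
qed

lemma C_k_SucD:
  assumes "C_k (Suc k) f"
  shows "(f has_derivative frechet_derivative f (at x)) (at x)"
    and "C_k k (\<lambda>x. frechet_derivative f (at x) v)"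
  using assms frechet_derivative_works by auto

lemma C_k_mono: "C_k (Suc k) f \<Longrightarrow> C_k k f"
proof (induction k arbitrary: f)
  case 0
  then show ?case by (auto simp: continuous_on_eq_continuous_at intro: differentiable_imp_continuous_within)
next
  case (Suc k)
  then show ?case unfolding C_k.simps(2)[of "Suc k"] by (simp del: C_k.simps add: C_k.simps(2)[of k])
qed

lemma C_k_const: "C_k k (\<lambda>x. c)"
proof (induction k arbitrary: c)
  case (Suc k)
  show ?case by (rule C_k_SucI[OF has_derivative_const]) (rule Suc)
qed simp

lemma C_k_linear:
  assumes "bounded_linear f"
  shows "C_k k f"
proof (cases k)
  case 0
  then show ?thesis using assms by (simp add: linear_continuous_on)
next
  case (Suc n)
  show ?thesis unfolding Suc
    by (rule C_k_SucI[OF bounded_linear_imp_has_derivative[OF assms] C_k_const])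
qed

lemma C_k_add: "C_k k f \<Longrightarrow> C_k k g \<Longrightarrow> C_k k (\<lambda>x. f x + g x)"
proof (induction k arbitrary: f g)
  case 0
  then show ?case by (simp add: continuous_on_add)
next
  case (Suc k)
  show ?case
    by (rule C_k_SucI[OF has_derivative_add[OF C_k_SucD(1)[OF Suc.prems(1)] C_k_SucD(1)[OF Suc.prems(2)]]])
       (intro Suc.IH C_k_SucD(2)[OF Suc.prems(1)] C_k_SucD(2)[OF Suc.prems(2)])
qed

lemma C_k_mult: "C_k k f \<Longrightarrow> C_k k g \<Longrightarrow> C_k k (\<lambda>x. f x * g x)"
proof (induction k arbitrary: f g)
  case 0
  then show ?case by (simp add: continuous_on_mult)
next
  case (Suc k)
  show ?case
    by (rule C_k_SucI[OF has_derivative_mult[OF C_k_SucD(1)[OF Suc.prems(1)] C_k_SucD(1)[OF Suc.prems(2)]]])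
       (intro C_k_add Suc.IH C_k_mono[OF Suc.prems(1)] C_k_mono[OF Suc.prems(2)]
          C_k_SucD(2)[OF Suc.prems(1)] C_k_SucD(2)[OF Suc.prems(2)])
qed

lemma C_k_diff: "C_k k f \<Longrightarrow> C_k k g \<Longrightarrow> C_k k (\<lambda>x. f x - g x)"
  using C_k_add[OF _ C_k_mult[OF C_k_const[of k "-1"]], of f g] by simp

lemma C_k_sum: "(\<And>i. i \<in> S \<Longrightarrow> C_k k (f i)) \<Longrightarrow> C_k k (\<lambda>x. \<Sum>i\<in>S. f i x)"
proof (induction S rule: infinite_finite_induct)
  case (insert i S)
  have "C_k k (\<lambda>x. f i x + (\<Sum>i\<in>S. f i x))"
    by (rule C_k_add) (use insert in auto)
  then show ?case using insert(1,2) by simp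
qed (simp_all add: C_k_const)

lemma C_k_nth: "C_k k (\<lambda>y. y $ i)"
  by (rule C_k_linear[OF bounded_linear_vec_nth])

text \<open>The outer function is given together with its whole sequence of derivatives. One
  differentiation then turns \<open>g n\<close> into \<open>g (Suc n)\<close> times a derivative of
  \<open>u\<close>, so an induction on \<open>k\<close> with arbitrary \<open>n\<close> replaces any
  formula for higher chain rules.\<close>

lemma C_k_compose:
  assumes g: "\<And>n t. ((g n :: real \<Rightarrow> real) has_real_derivative g (Suc n) t) (at t)"
    and u: "\<And>k. C_k k u"
  shows "C_k k (\<lambda>x. g n (u x))"
proof (induction k arbitrary: n)
  case 0
  have "continuous_on UNIV (g n)"
    by (rule DERIV_continuous_on) (rule has_field_derivative_at_within[OF g])
  moreover have "continuous_on UNIV u" using u[of 0] by simp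
  ultimately show ?case using continuous_on_compose2 by (metis C_k.simps(1) subset_UNIV)
next
  case (Suc k)
  have "((\<lambda>x. g n (u x)) has_derivative (\<lambda>v. g (Suc n) (u x) * frechet_derivative u (at x) v)) (at x)" for x
    using has_derivative_compose[OF C_k_SucD(1)[OF u], of "g n" "(*) (g (Suc n) (u x))" x] g[of n "u x"]
    by (simp add: has_field_derivative_def)
  then show ?case
    by (rule C_k_SucI) (intro C_k_mult Suc.IH C_k_SucD(2)[OF u])
qed

lemma frechet_derivative_shift:
  assumes "f differentiable (at (x + z))"
  shows "((\<lambda>y. f (x + y)) has_derivative frechet_derivative f (at (x + z))) (at z)"
    and "frechet_derivative (\<lambda>y. f (x + y)) (at z) = frechet_derivative f (at (x + z))"
proof -
  have "((\<lambda>y. x + y) has_derivative (\<lambda>v. v)) (at z)"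
    by (auto intro!: derivative_eq_intros)
  from has_derivative_compose[OF this assms[unfolded frechet_derivative_works]]
  show *: "((\<lambda>y. f (x + y)) has_derivative frechet_derivative f (at (x + z))) (at z)" .
  show "frechet_derivative (\<lambda>y. f (x + y)) (at z) = frechet_derivative f (at (x + z))"
    using frechet_derivative_at[OF *] by simp
qed

lemma C_k_shift: "C_k k f \<Longrightarrow> C_k k (\<lambda>y. f (x + y))"
proof (induction k arbitrary: f)
  case 0
  then show ?case by (auto intro!: continuous_on_compose2[of UNIV f] continuous_intros)
next
  case (Suc k)
  show ?case
    by (rule C_k_SucI[OF frechet_derivative_shift(1)])
       (use Suc in \<open>auto intro!: Suc.IH\<close>)
qed

section \<open>A smooth function flat at zero, and radial cutoffs built from it\<close>

definition flat_exp :: "real poly \<Rightarrow> real \<Rightarrow> real" where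
  "flat_exp p t = (if t > 0 then poly p (1 / t) * exp (- (1 / t)) else 0)"

lemma poly_exp_neg_tendsto_0: "((\<lambda>s::real. poly p s * exp (- s)) \<longlongrightarrow> 0) at_top"
proof -
  have "((\<lambda>s::real. \<Sum>i\<le>degree p. coeff p i * (s ^ i / exp s)) \<longlongrightarrow> (\<Sum>i\<le>degree p. coeff p i * 0)) at_top"
    by (intro tendsto_sum tendsto_mult tendsto_const tendsto_power_div_exp_0)
  moreover have "(\<lambda>s::real. \<Sum>i\<le>degree p. coeff p i * (s ^ i / exp s)) = (\<lambda>s. poly p s * exp (- s))"
    by (auto simp: poly_altdef sum_distrib_right exp_minus divide_inverse mult.assoc)
  ultimately show ?thesis by simp
qed

text \<open>The polynomial factor in \<open>1/t\<close> closes the family under differentiation: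
  since \<open>1/t\<close> has derivative \<open>- 1/t^2\<close>, the new polynomial is
  \<open>X^2 (p - p')\<close>. Hence smoothness of \<open>exp (-1/t)\<close> follows from a single
  first-order computation.\<close>

lemma has_real_derivative_flat_exp:
  "(flat_exp p has_real_derivative flat_exp ([:0, 0, 1:] * (p - pderiv p)) t) (at t)"
proof -
  consider "t > 0" | "t < 0" | "t = 0" by linarith
  then show ?thesis
  proof cases
    case 1
    have "((\<lambda>t. poly p (1 / t) * exp (- (1 / t))) has_real_derivative
        flat_exp ([:0, 0, 1:] * (p - pderiv p)) t) (at t)"
      using 1 by (auto intro!: derivative_eq_intros DERIV_chain2[OF poly_DERIV]
        simp: flat_exp_def field_simps power2_eq_square)
    moreover have "eventually (\<lambda>t. flat_exp p t = poly p (1 / t) * exp (- (1 / t))) (nhds t)"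
      using eventually_nhds_in_open[of "{0<..}" t] 1
      by (auto elim!: eventually_mono simp: flat_exp_def)
    ultimately show ?thesis by (subst DERIV_cong_ev[OF refl _ refl])
  next
    case 2
    have "((\<lambda>t. 0) has_real_derivative flat_exp ([:0, 0, 1:] * (p - pderiv p)) t) (at t)"
      using 2 by (auto simp: flat_exp_def)
    moreover have "eventually (\<lambda>t. flat_exp p t = 0) (nhds t)"
      using eventually_nhds_in_open[of "{..<0}" t] 2
      by (auto elim!: eventually_mono simp: flat_exp_def)
    ultimately show ?thesis by (subst DERIV_cong_ev[OF refl _ refl])
  next
    case 3
    \<comment> \<open>Under \<open>s = 1/h\<close> the right difference quotient at 0 becomes
      \<open>s p(s) exp(-s)\<close> for large \<open>s\<close>.\<close>
    have r: "((\<lambda>h. flat_exp p h / h) \<longlongrightarrow> 0) (at_right 0)"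
    proof -
      have "((\<lambda>s. poly ([:0, 1:] * p) s * exp (- s)) \<longlongrightarrow> 0) at_top"
        by (rule poly_exp_neg_tendsto_0)
      then have "((\<lambda>h::real. poly ([:0, 1:] * p) (inverse h) * exp (- inverse h)) \<longlongrightarrow> 0) (at_right 0)"
        by (rule filterlim_compose[OF _ filterlim_inverse_at_top_right])
      moreover have "eventually (\<lambda>h::real. poly ([:0, 1:] * p) (inverse h) * exp (- inverse h) = flat_exp p h / h) (at_right 0)"
        using eventually_at_right_less[of "0::real"]
        by eventually_elim (auto simp: flat_exp_def field_simps)
      ultimately show ?thesis by (rule Lim_transform_eventually)
    qed
    have l: "((\<lambda>h. flat_exp p h / h) \<longlongrightarrow> 0) (at_left 0)"
      by (rule tendsto_eventually) (auto simp: eventually_at_filter flat_exp_def)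
    have "((\<lambda>h. flat_exp p h / h) \<longlongrightarrow> 0) (at 0)" using l r by (simp add: filterlim_split_at)
    then show ?thesis using 3 by (simp add: DERIV_def flat_exp_def)
  qed
qed

text \<open>With \<open>h = flat_exp 1\<close>, the map \<open>s \<mapsto> h (h 1 - h s)\<close> is a positive constant for \<open>s \<le> 0\<close> and vanishes
  for \<open>s \<ge> 1\<close>; this avoids dividing smooth functions by each other.\<close>

definition bump :: "real \<Rightarrow> real^'n \<Rightarrow> real" where
  "bump r y = flat_exp 1 (exp (- 1) - flat_exp 1 (((norm y)\<^sup>2 - (r / 2)\<^sup>2) / (r\<^sup>2 - (r / 2)\<^sup>2))) / flat_exp 1 (exp (- 1))"

lemma flat_exp_1_mono: "s \<le> t \<Longrightarrow> flat_exp 1 s \<le> flat_exp 1 t"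
  by (auto simp: flat_exp_def field_simps)

lemma flat_exp_1_nonneg: "flat_exp 1 t \<ge> 0"
  by (auto simp: flat_exp_def)

lemma C_k_flat_exp:
  assumes "\<And>k. C_k k u"
  shows "C_k k (\<lambda>x. flat_exp 1 (u x))"
  \<comment> \<open>The \<open>n\<close>-th derivative is the member of the family obtained by
    iterating the map on polynomials \<open>n\<close> times from 1.\<close>
  using C_k_compose[of "\<lambda>n. flat_exp (((\<lambda>p. [:0, 0, 1:] * (p - pderiv p)) ^^ n) 1)" u k 0]
    has_real_derivative_flat_exp assms by simp

lemma C_k_bump: "C_k k (bump r :: real^'n \<Rightarrow> real)"
proof -
  have n: "C_k k (\<lambda>y::real^'n. (norm y)\<^sup>2)" for k
  proof -
    have "(\<lambda>y::real^'n. (norm y)\<^sup>2) = (\<lambda>y. \<Sum>i\<in>UNIV. y $ i * y $ i)"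
      by (auto simp: power2_norm_eq_inner inner_vec_def)
    then show ?thesis by (auto intro!: C_k_sum C_k_mult C_k_nth)
  qed
  have c: "C_k k (\<lambda>x. u x / c)" if "C_k k u" for k c and u :: "real^'n \<Rightarrow> real"
    using C_k_mult[OF that C_k_const[of k "1 / c"]] by simp
  show ?thesis unfolding bump_def[abs_def]
    by (intro c C_k_flat_exp C_k_diff C_k_const n)
qed

lemma bump_bounds: "0 \<le> bump r y" "bump r y \<le> 1"
proof -
  have "flat_exp 1 (exp (-1)) > 0" by (simp add: flat_exp_def)
  then show "0 \<le> bump r y" "bump r y \<le> 1"
    unfolding bump_def using flat_exp_1_nonneg by (auto intro!: flat_exp_1_mono)
qed

lemma bump_eq_1:
  assumes "r > 0" "norm y \<le> r / 2"
  shows "bump r y = 1"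
proof -
  have "(norm y)\<^sup>2 \<le> (r / 2)\<^sup>2" using assms by (intro power_mono) auto
  moreover have "r\<^sup>2 - (r / 2)\<^sup>2 > 0" using assms by (simp add: power2_eq_square)
  ultimately have "((norm y)\<^sup>2 - (r / 2)\<^sup>2) / (r\<^sup>2 - (r / 2)\<^sup>2) \<le> 0"
    by (simp add: divide_nonpos_pos)
  then show ?thesis unfolding bump_def by (simp add: flat_exp_def)
qed

lemma bump_eq_0:
  assumes "r > 0" "norm y \<ge> r"
  shows "bump r y = 0"
proof -
  have "r\<^sup>2 \<le> (norm y)\<^sup>2" using assms by (intro power_mono) auto
  moreover have "r\<^sup>2 - (r / 2)\<^sup>2 > 0" using assms by (simp add: power2_eq_square)
  ultimately have "1 \<le> ((norm y)\<^sup>2 - (r / 2)\<^sup>2) / (r\<^sup>2 - (r / 2)\<^sup>2)" by simp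
  from flat_exp_1_mono[OF this]
  \<comment> \<open>Here \<open>exp (-1)\<close> is \<open>flat_exp 1 1\<close>; the outer argument
    in \<open>bump\<close> is therefore nonpositive, where \<open>flat_exp\<close> vanishes.\<close>
  have "exp (-1) \<le> flat_exp 1 (((norm y)\<^sup>2 - (r / 2)\<^sup>2) / (r\<^sup>2 - (r / 2)\<^sup>2))"
    by (simp add: flat_exp_def)
  then show ?thesis unfolding bump_def by (simp add: flat_exp_def[of _ "exp (-1) - _"])
qed

section \<open>Closure properties of the space of test functions\<close>

lemma Cc_infinityI:
  assumes "\<And>k. C_k k f" "\<And>y. norm y > R \<Longrightarrow> f y = 0"
  shows "f \<in> Cc_infinity"
proof -
  have "{x. f x \<noteq> 0} \<subseteq> cball 0 R" using assms(2) by (force simp: not_less)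
  then have "bounded (closure {x. f x \<noteq> 0})" using bounded_cball bounded_subset bounded_closure by blast
  then show ?thesis using assms(1) by (simp add: Cc_infinity_def compact_eq_bounded_closed)
qed

lemma Cc_infinityD:
  assumes "f \<in> Cc_infinity"
  shows "C_k k f" and "\<exists>R>0. \<forall>y. norm y > R \<longrightarrow> f y = 0"
proof -
  show "C_k k f" using assms by (simp add: Cc_infinity_def)
  have "bounded (closure {x. f x \<noteq> 0})" using assms by (simp add: Cc_infinity_def compact_imp_bounded)
  then obtain R where "R > 0" "\<And>y. y \<in> closure {x. f x \<noteq> 0} \<Longrightarrow> norm y \<le> R"
    unfolding bounded_pos by blast
  then show "\<exists>R>0. \<forall>y. norm y > R \<longrightarrow> f y = 0"
    using closure_subset[of "{x. f x \<noteq> 0}"] by (metis (mono_tags, lifting) linorder_not_less mem_Collect_eq subsetD)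
qed

lemma Cc_infinity_mult:
  assumes "f \<in> Cc_infinity" "\<And>k. C_k k g"
  shows "(\<lambda>y. g y * f y) \<in> Cc_infinity"
proof -
  obtain R where "\<forall>y. norm y > R \<longrightarrow> f y = 0" using Cc_infinityD(2)[OF assms(1)] by blast
  then show ?thesis
    by (intro Cc_infinityI[of _ R] C_k_mult assms(2) Cc_infinityD(1)[OF assms(1)]) simp
qed

lemma function_space_Cc_infinity: "function_space (Cc_infinity :: (real^'n \<Rightarrow> real) set)"
  unfolding function_space_def
proof (intro conjI ballI allI)
  show "(\<lambda>x. 0) \<in> (Cc_infinity :: (real^'n \<Rightarrow> real) set)"
    by (rule Cc_infinityI[of _ 0]) (simp_all add: C_k_const)
next
  fix f g :: "real^'n \<Rightarrow> real" assume f: "f \<in> Cc_infinity" and g: "g \<in> Cc_infinity"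
  obtain R S where "\<forall>y. norm y > R \<longrightarrow> f y = 0" "\<forall>y. norm y > S \<longrightarrow> g y = 0"
    using Cc_infinityD(2)[OF f] Cc_infinityD(2)[OF g] by blast
  then show "(\<lambda>x. f x + g x) \<in> Cc_infinity"
    by (intro Cc_infinityI[of _ "max R S"] C_k_add Cc_infinityD(1)[OF f] Cc_infinityD(1)[OF g]) simp
next
  fix f :: "real^'n \<Rightarrow> real" and r assume f: "f \<in> Cc_infinity"
  show "(\<lambda>x. r * f x) \<in> Cc_infinity" by (rule Cc_infinity_mult[OF f C_k_const])
qed

lemma bump_Cc_infinity: "r > 0 \<Longrightarrow> bump r \<in> Cc_infinity"
  by (rule Cc_infinityI[of _ r]) (simp_all add: C_k_bump bump_eq_0)

lemma Cc_infinity_shift: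
  assumes "f \<in> Cc_infinity"
  shows "(\<lambda>y. f (x + y)) \<in> Cc_infinity"
proof -
  obtain R where R: "\<forall>y. norm y > R \<longrightarrow> f y = 0" using Cc_infinityD(2)[OF assms] by blast
  have "f (x + y) = 0" if "norm y > R + norm x" for y
    using R norm_triangle_ineq2[of y "- x"] that by (simp add: add.commute)
  then show ?thesis by (rule Cc_infinityI[OF C_k_shift[OF Cc_infinityD(1)[OF assms]]])
qed

lemma Cc_infinity_continuous: "f \<in> Cc_infinity \<Longrightarrow> continuous_on UNIV f"
  using Cc_infinityD(1)[of f 0] by simp

lemma Cc_infinity_bounded:
  assumes "f \<in> Cc_infinity"
  obtains M where "M > 0" "\<And>y. \<bar>f y\<bar> \<le> M"
proof -
  obtain R where R: "\<forall>y. norm y > R \<longrightarrow> f y = 0" using Cc_infinityD(2)[OF assms] by blast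
  have "compact (f ` cball 0 R)"
    by (intro compact_continuous_image continuous_on_subset[OF Cc_infinity_continuous[OF assms]]) auto
  then obtain M where M: "M > 0" "\<And>y. y \<in> cball 0 R \<Longrightarrow> \<bar>f y\<bar> \<le> M"
    using compact_imp_bounded[of "f ` cball 0 R"] unfolding bounded_pos by auto
  have "\<bar>f y\<bar> \<le> M" for y
    using M R by (cases "norm y > R") (auto simp: not_less)
  with M(1) show ?thesis by (rule that)
qed

section \<open>Representation of positive functionals away from the origin\<close>

text \<open>In finite dimension these are the relatively compact subsets of the punctured space, the
  natural supports for a Radon measure on it.\<close>

definition annular :: "'a::real_normed_vector set \<Rightarrow> bool" where
  "annular E \<longleftrightarrow> (\<exists>r>0. \<exists>R. \<forall>y\<in>E. r \<le> norm y \<and> norm y \<le> R)"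

text \<open>No continuity or measurability is asked for, so that indicators of arbitrary annular
  sets belong to the space. The quadratic bound at 0 is the order of vanishing on which the maximum
  principle gives control.\<close>

definition quadratic_space :: "('a::real_normed_vector \<Rightarrow> real) set" where
  "quadratic_space = {h. \<exists>C R. (\<forall>y. \<bar>h y\<bar> \<le> C * (norm y)\<^sup>2) \<and> (\<forall>y. norm y > R \<longrightarrow> h y = 0)}"

lemma quadratic_spaceI:
  assumes "\<And>y. \<bar>h y\<bar> \<le> C * (norm y)\<^sup>2" "\<And>y. norm y > R \<Longrightarrow> h y = 0"
  shows "h \<in> quadratic_space"
  using assms unfolding quadratic_space_def by auto

lemma function_space_quadratic_space: "function_space quadratic_space"
  unfolding function_space_def
proof (intro conjI ballI allI)
  show "(\<lambda>x. 0) \<in> quadratic_space" by (rule quadratic_spaceI[of _ 0]) simp_all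
next
  fix f g :: "'a \<Rightarrow> real" assume "f \<in> quadratic_space" "g \<in> quadratic_space"
  then obtain C R C' R' where
    1: "\<And>y. \<bar>f y\<bar> \<le> C * (norm y)\<^sup>2" "\<And>y. norm y > R \<Longrightarrow> f y = 0" and
    2: "\<And>y. \<bar>g y\<bar> \<le> C' * (norm y)\<^sup>2" "\<And>y. norm y > R' \<Longrightarrow> g y = 0"
    unfolding quadratic_space_def by auto
  show "(\<lambda>x. f x + g x) \<in> quadratic_space"
  proof (rule quadratic_spaceI[of _ "C + C'" "max R R'"])
    fix y show "\<bar>f y + g y\<bar> \<le> (C + C') * (norm y)\<^sup>2"
      using 1(1)[of y] 2(1)[of y] by (simp add: ring_distribs)
  qed (use 1(2) 2(2) in auto)
next
  fix f :: "'a \<Rightarrow> real" and r assume "f \<in> quadratic_space"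
  then obtain C R where
    1: "\<And>y. \<bar>f y\<bar> \<le> C * (norm y)\<^sup>2" "\<And>y. norm y > R \<Longrightarrow> f y = 0"
    unfolding quadratic_space_def by auto
  show "(\<lambda>x. r * f x) \<in> quadratic_space"
  proof (rule quadratic_spaceI[of _ "\<bar>r\<bar> * C" R])
    fix y show "\<bar>r * f y\<bar> \<le> \<bar>r\<bar> * C * (norm y)\<^sup>2"
      using mult_left_mono[OF 1(1)[of y], of "\<bar>r\<bar>"] by (simp add: abs_mult mult.assoc)
  qed (use 1(2) in auto)
qed

lemma annularI:
  assumes "r > 0" "\<And>y. y \<in> E \<Longrightarrow> r \<le> norm y" "\<And>y. y \<in> E \<Longrightarrow> norm y \<le> R"
  shows "annular E"
  using assms unfolding annular_def by blast

lemma annular_subset: "annular F \<Longrightarrow> E \<subseteq> F \<Longrightarrow> annular E"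
  unfolding annular_def by (meson subsetD)

lemma annular_Un:
  assumes "annular E" "annular F"
  shows "annular (E \<union> F)"
proof -
  obtain r R s S where "r > 0" "s > 0" "\<forall>y\<in>E. r \<le> norm y \<and> norm y \<le> R" "\<forall>y\<in>F. s \<le> norm y \<and> norm y \<le> S"
    using assms unfolding annular_def by auto
  then show ?thesis unfolding annular_def
    by (intro exI[of _ "min r s"] conjI exI[of _ "max R S"]) auto
qed

lemma annular_supported_quadratic:
  fixes h :: "'a::real_normed_vector \<Rightarrow> real"
  assumes E: "annular E" and "\<And>y. y \<notin> E \<Longrightarrow> h y = 0" and "\<And>y. \<bar>h y\<bar> \<le> C"
  shows "h \<in> quadratic_space"
proof -
  obtain r R where r: "r > 0" "\<forall>y\<in>E. r \<le> norm y \<and> norm y \<le> R"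
    using E unfolding annular_def by auto
  have C: "C \<ge> 0" using assms(3)[of undefined] by linarith
  show ?thesis
  proof (rule quadratic_spaceI[of _ "C / r\<^sup>2" R])
    fix y :: 'a
    show "\<bar>h y\<bar> \<le> C / r\<^sup>2 * (norm y)\<^sup>2"
    proof (cases "y \<in> E")
      case True
      then have "r\<^sup>2 \<le> (norm y)\<^sup>2" using r by (intro power_mono) auto
      then have "C * 1 \<le> C * ((norm y)\<^sup>2 / r\<^sup>2)" using r C by (intro mult_left_mono) auto
      then show ?thesis using assms(3)[of y] by simp
    next
      case False
      then show ?thesis using assms(2) C by simp
    qed
  next
    fix y :: 'a assume "norm y > R"
    then have "y \<notin> E" using r(2) by force
    then show "h y = 0" by (rule assms(2))
  qed
qed

lemma annular_indicator: "annular E \<Longrightarrow> indicat_real E \<in> quadratic_space"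
  by (rule annular_supported_quadratic[of E _ 1]) (auto simp: indicator_def)

text \<open>A layer-cake sum: for \<open>h > 0\<close> it is the largest multiple of
  \<open>\<delta>\<close> strictly below \<open>h\<close>, capped at \<open>n \<delta>\<close>.
  Carrying the cap in both bounds lets the induction on \<open>n\<close> close.\<close>

lemma level_sum_bounds:
  fixes h \<delta> :: real
  assumes "\<delta> > 0" "h \<ge> 0"
  shows "(\<Sum>i=1..n. \<delta> * of_bool (real i * \<delta> < h)) \<le> min h (real n * \<delta>)"
    and "min h (real n * \<delta> + \<delta>) - \<delta> \<le> (\<Sum>i=1..n. \<delta> * of_bool (real i * \<delta> < h))"
proof (induction n)
  case (Suc n)
  define S where "S = (\<Sum>i=1..n. \<delta> * of_bool (real i * \<delta> < h))"
  have S: "S \<le> min h (real n * \<delta>)" "min h (real n * \<delta> + \<delta>) - \<delta> \<le> S"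
    unfolding S_def by (fact Suc.IH)+
  have *: "(\<Sum>i=1..Suc n. \<delta> * of_bool (real i * \<delta> < h)) = S + \<delta> * of_bool (real (Suc n) * \<delta> < h)"
    unfolding S_def by (subst sum.cl_ivl_Suc) simp
  { case 1 show ?case using S assms unfolding *
      by (simp add: algebra_simps min_def split: if_splits) }
  { case 2 show ?case using S assms unfolding *
      by (simp add: algebra_simps min_def split: if_splits) }
qed (use assms in auto)

section \<open>The finitely additive content and its regular sets\<close>

locale positive_functional =
  fixes \<Lambda> :: "('a::euclidean_space \<Rightarrow> real) \<Rightarrow> real"
  assumes linear: "linear_functional_on quadratic_space \<Lambda>"
    and nonneg: "\<And>h. h \<in> quadratic_space \<Longrightarrow> (\<And>y. h y \<ge> 0) \<Longrightarrow> \<Lambda> h \<ge> 0"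
begin

definition content :: "'a set \<Rightarrow> real" where "content E = \<Lambda> (indicat_real E)"

text \<open>Approximation by compact sets from inside makes the finitely additive \<open>content\<close> continuous at
  \<open>{}\<close>; approximation by open sets from outside is needed only to close the family under
  differences.\<close>

definition jordan :: "'a set set" where
  "jordan = {E. E \<in> sets borel \<and> annular E \<and>
    (\<forall>e>0. \<exists>K U. compact K \<and> open U \<and> annular U \<and> K \<subseteq> E \<and> E \<subseteq> U \<and> content (U - K) < e)}"

lemma monotone:
  assumes "f \<in> quadratic_space" "g \<in> quadratic_space" "\<And>y. f y \<le> g y"
  shows "\<Lambda> f \<le> \<Lambda> g"
proof -
  have "0 \<le> \<Lambda> (\<lambda>y. g y - f y)"
    using assms by (intro nonneg function_space_diff[OF function_space_quadratic_space]) auto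
  then show ?thesis
    using linear_functional_diff[OF function_space_quadratic_space linear assms(2,1)] by simp
qed

lemma content_mono: "E \<subseteq> F \<Longrightarrow> annular F \<Longrightarrow> content E \<le> content F"
  unfolding content_def
  by (intro monotone annular_indicator) (auto intro: annular_subset simp: indicator_def)

lemma content_nonneg: "annular E \<Longrightarrow> 0 \<le> content E"
  unfolding content_def by (intro nonneg annular_indicator) auto

lemma content_Un_disjoint:
  assumes "annular E" "annular F" "E \<inter> F = {}"
  shows "content (E \<union> F) = content E + content F"
proof -
  have "\<Lambda> (\<lambda>y. indicat_real E y + indicat_real F y) = content E + content F"
    unfolding content_def
    by (rule linear_functional_onD(1)[OF linear annular_indicator[OF assms(1)] annular_indicator[OF assms(2)]])
  moreover have "(\<lambda>y. indicat_real E y + indicat_real F y) = indicat_real (E \<union> F)"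
    using assms(3) by (intro ext) (auto simp: indicator_def)
  ultimately show ?thesis by (simp add: content_def)
qed

lemma content_Diff:
  assumes "annular E" "F \<subseteq> E"
  shows "content (E - F) = content E - content F"
proof -
  have "content ((E - F) \<union> F) = content (E - F) + content F"
    using assms by (intro content_Un_disjoint) (auto intro: annular_subset)
  moreover have "(E - F) \<union> F = E" using assms by auto
  ultimately show ?thesis by simp
qed

lemma content_Un_le:
  assumes "annular E" "annular F"
  shows "content (E \<union> F) \<le> content E + content F"
proof -
  have "content ((E - F) \<union> F) = content (E - F) + content F"
    using assms by (intro content_Un_disjoint) (auto intro: annular_subset)
  moreover have "(E - F) \<union> F = E \<union> F" by auto
  moreover have "content (E - F) \<le> content E" using assms by (intro content_mono) auto
  ultimately show ?thesis by simp
qed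

lemma content_UN_le:
  assumes "\<And>i. i < (n::nat) \<Longrightarrow> annular (E i)"
  shows "annular (\<Union>i<n. E i)" "content (\<Union>i<n. E i) \<le> (\<Sum>i<n. content (E i))"
  using assms
proof (induction n)
  case 0
  { case 1 show ?case by (auto simp: annular_def intro: exI[of _ 1]) }
  { case 2
    have a: "annular ({} :: 'a set)" by (auto simp: annular_def intro: exI[of _ 1])
    have "content ({} - {}) = content {} - content {}" using a by (intro content_Diff) auto
    then show ?case by simp }
next
  case (Suc n)
  have *: "(\<Union>i<Suc n. E i) = E n \<union> (\<Union>i<n. E i)" by (auto simp: less_Suc_eq)
  { case 1 show ?case unfolding * using Suc.IH(1) 1 by (intro annular_Un) auto }
  { case 2
    have "content (\<Union>i<Suc n. E i) \<le> content (E n) + content (\<Union>i<n. E i)"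
      unfolding * using Suc.IH(1) 2 by (intro content_Un_le) auto
    also have "content (\<Union>i<n. E i) \<le> (\<Sum>i<n. content (E i))" using Suc.IH(2) 2 by auto
    finally show ?case by simp }
qed

lemma jordanE:
  assumes "E \<in> jordan" "e > 0"
  obtains K U where "compact K" "open U" "annular U" "K \<subseteq> E" "E \<subseteq> U" "content (U - K) < e"
  using assms unfolding jordan_def by blast

lemma jordan_Un:
  assumes E: "E \<in> jordan" and F: "F \<in> jordan"
  shows "E \<union> F \<in> jordan"
proof -
  have "\<exists>K U. compact K \<and> open U \<and> annular U \<and> K \<subseteq> E \<union> F \<and> E \<union> F \<subseteq> U \<and> content (U - K) < e"
    if "e > 0" for e
  proof -
    have e2: "e / 2 > 0" using that by simp
    obtain K U where K: "compact K" "open U" "annular U" "K \<subseteq> E" "E \<subseteq> U" "content (U - K) < e / 2"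
      using jordanE[OF E e2] by blast
    obtain L W where L: "compact L" "open W" "annular W" "L \<subseteq> F" "F \<subseteq> W" "content (W - L) < e / 2"
      using jordanE[OF F e2] by blast
    have a: "annular (U - K)" "annular (W - L)" using K L by (auto intro: annular_subset)
    have "content (U \<union> W - (K \<union> L)) \<le> content ((U - K) \<union> (W - L))"
      using a by (intro content_mono annular_Un) auto
    also have "\<dots> \<le> content (U - K) + content (W - L)" using a by (rule content_Un_le)
    also have "\<dots> < e" using K(6) L(6) by simp
    finally have "content (U \<union> W - (K \<union> L)) < e" .
    then show ?thesis using K L
      by (intro exI[of _ "K \<union> L"] exI[of _ "U \<union> W"] conjI compact_Un open_Un annular_Un) auto
  qed
  then show ?thesis using E F annular_Un unfolding jordan_def by auto
qed

text \<open>The inner set for \<open>E - F\<close> removes the open hull \<open>W\<close> of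
  \<open>F\<close> from \<open>K\<close>, the outer one removes the compact core \<open>L\<close>
  from \<open>U\<close>. The gap between them is covered by the gaps for \<open>E\<close> and for
  \<open>F\<close>.\<close>

lemma jordan_Diff:
  assumes E: "E \<in> jordan" and F: "F \<in> jordan"
  shows "E - F \<in> jordan"
proof -
  have "\<exists>K U. compact K \<and> open U \<and> annular U \<and> K \<subseteq> E - F \<and> E - F \<subseteq> U \<and> content (U - K) < e"
    if "e > 0" for e
  proof -
    have e2: "e / 2 > 0" using that by simp
    obtain K U where K: "compact K" "open U" "annular U" "K \<subseteq> E" "E \<subseteq> U" "content (U - K) < e / 2"
      using jordanE[OF E e2] by blast
    obtain L W where L: "compact L" "open W" "annular W" "L \<subseteq> F" "F \<subseteq> W" "content (W - L) < e / 2"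
      using jordanE[OF F e2] by blast
    have a: "annular (U - K)" "annular (W - L)" "annular (U - L)" using K L by (auto intro: annular_subset)
    have "content ((U - L) - (K - W)) \<le> content ((U - K) \<union> (W - L))"
      using a by (intro content_mono annular_Un) auto
    also have "\<dots> \<le> content (U - K) + content (W - L)" using a(1,2) by (rule content_Un_le)
    also have "\<dots> < e" using K(6) L(6) by simp
    finally have "content ((U - L) - (K - W)) < e" .
    moreover have "open (U - L)" using K L by (intro open_Diff compact_imp_closed)
    moreover have "compact (K - W)" using K L by (intro compact_diff)
    ultimately show ?thesis using K L a
      by (intro exI[of _ "K - W"] exI[of _ "U - L"] conjI) auto
  qed
  moreover have "annular (E - F)" using E by (auto simp: jordan_def intro: annular_subset)
  ultimately show ?thesis using E F unfolding jordan_def by auto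
qed

lemma jordan_subset: "jordan \<subseteq> Pow (- {0})"
  unfolding jordan_def annular_def by fastforce

lemma empty_jordan: "{} \<in> jordan"
proof -
  have a: "annular ({} :: 'a set)" by (auto simp: annular_def intro: exI[of _ 1])
  have "content ({} - {}) = content {} - content {}" using a by (intro content_Diff) auto
  then have "\<exists>K U. compact K \<and> open U \<and> annular U \<and> K \<subseteq> {} \<and> {} \<subseteq> U \<and> content (U - K) < e"
    if "e > 0" for e
    using that a by (intro exI[of _ "{}"]) simp
  then show ?thesis unfolding jordan_def using a by simp
qed

text \<open>Each \<open>A i\<close> is approximated from inside by a compact \<open>K i\<close> with
  error \<open>e / 2^(i+1)\<close>. Since the \<open>A i\<close> have empty intersection,
  compactness makes finitely many \<open>K i\<close> already have empty intersection, and from then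
  on the content is at most the sum of the errors, which stays below \<open>e\<close>.\<close>

lemma content_tendsto_0:
  assumes A: "range A \<subseteq> jordan" and dec: "decseq A" and emp: "(\<Inter>i. A i) = {}"
  shows "(\<lambda>i. content (A i)) \<longlonglongrightarrow> 0"
proof (rule LIMSEQ_I)
  fix e :: real assume e: "e > 0"
  have ann: "annular (A i)" for i using A by (auto simp: jordan_def)
  have "\<exists>K. compact K \<and> K \<subseteq> A i \<and> content (A i - K) < e * (1/2) ^ Suc i" for i
  proof -
    have "e * (1/2) ^ Suc i > 0" using e by simp
    then obtain K U where K: "compact K" "open U" "annular U" "K \<subseteq> A i" "A i \<subseteq> U"
      "content (U - K) < e * (1/2) ^ Suc i"
      using jordanE[of "A i"] A by (metis range_subsetD)
    have "content (A i - K) \<le> content (U - K)"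
      using K by (intro content_mono) (auto intro: annular_subset)
    then show ?thesis using K by (intro exI[of _ K]) auto
  qed
  then obtain K where K: "\<And>i. compact (K i)" "\<And>i. K i \<subseteq> A i"
      "\<And>i. content (A i - K i) < e * (1/2) ^ Suc i"
    by metis
  define C where "C n = (\<Inter>i\<le>n. K i)" for n
  have "\<exists>n. C n = {}"
  proof (rule ccontr)
    assume "\<nexists>n. C n = {}"
    moreover have "compact (C n)" for n
    proof -
      have "compact (K 0 \<inter> C n)"
        unfolding C_def by (intro compact_Int_closed K(1) closed_INT ballI compact_imp_closed)
      moreover have "K 0 \<inter> C n = C n" by (auto simp: C_def)
      ultimately show ?thesis by simp
    qed
    ultimately have "(\<Inter>n. C n) \<noteq> {}"
      by (intro compact_nest) (auto simp: C_def)
    moreover have "(\<Inter>n. C n) \<subseteq> (\<Inter>i. A i)" unfolding C_def using K(2) by fastforce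
    ultimately show False using emp by auto
  qed
  then obtain n where n: "C n = {}" by blast
  have "norm (content (A m) - 0) < e" if "m \<ge> n" for m
  proof -
    have a: "annular (A i - K i)" for i using ann by (rule annular_subset) auto
    \<comment> \<open>A point of \<open>A m\<close> lies in every earlier \<open>A i\<close> because
      \<open>A\<close> decreases, and it is missed by some \<open>K i\<close> with
      \<open>i \<le> n\<close>.\<close>
    have "A m \<subseteq> (\<Union>i<Suc n. A i - K i)"
    proof
      fix x assume "x \<in> A m"
      then have "x \<in> A i" if "i \<le> n" for i
        using decseqD[OF dec, of i m] \<open>m \<ge> n\<close> that by auto
      moreover obtain i where "i \<le> n" "x \<notin> K i" using n unfolding C_def by auto
      ultimately show "x \<in> (\<Union>i<Suc n. A i - K i)" by (auto simp: less_Suc_eq_le)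
    qed
    then have "content (A m) \<le> content (\<Union>i<Suc n. A i - K i)"
      using a by (intro content_mono content_UN_le(1))
    also have "\<dots> \<le> (\<Sum>i<Suc n. content (A i - K i))" using a by (intro content_UN_le(2))
    also have "\<dots> < (\<Sum>i<Suc n. e * (1/2) ^ Suc i)" using K(3) by (intro sum_strict_mono) auto
    also have "\<dots> = e * ((\<Sum>i<Suc n. (1/2) ^ i) / 2)"
      unfolding sum_divide_distrib sum_distrib_left by (intro sum.cong) auto
    also have "\<dots> = e * (1 - (1/2) ^ Suc n)"
      by (subst geometric_sum) auto
    also have "\<dots> \<le> e" using e by (simp add: mult_le_cancel_left1 mult_left_le)
    finally show ?thesis using content_nonneg[OF ann[of m]] by simp
  qed
  then show "\<exists>no. \<forall>n\<ge>no. norm (content (A n) - 0) < e" by blast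
qed

text \<open>The content of the superlevel set is monotone in \<open>t\<close>, hence continuous
  outside a countable set. At a continuity point the open set \<open>{h > t}\<close> serves as its
  own outer approximation, and the compact sets \<open>{h \<ge> s}\<close> with \<open>s\<close>
  slightly above \<open>t\<close> exhaust it in content.\<close>

lemma countable_non_jordan_levels:
  fixes h :: "'a \<Rightarrow> real"
  assumes h: "continuous_on UNIV h" and ann: "annular {y. h y \<noteq> 0}"
  shows "countable {t\<in>{0<..}. {y. t < h y} \<notin> jordan}"
proof -
  define G where "G t = - content {y. t < h y}" for t
  have a: "annular {y. t < h y}" if "t > 0" for t
    using ann by (rule annular_subset) (use that in auto)
  have "mono_on {0<..} G"
    unfolding G_def by (intro mono_onI) (auto intro!: content_mono a)
  then have c: "countable {t\<in>{0<..}. \<not> isCont G t}"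
    by (intro mono_on_ctble_discont_open) auto
  have "{y. t < h y} \<in> jordan" if t: "t > 0" and cont: "isCont G t" for t
  proof -
    have op: "open {y. s < h y}" for s
      using h by (intro open_Collect_less continuous_on_const)
    have "\<exists>K U. compact K \<and> open U \<and> annular U \<and> K \<subseteq> {y. t < h y} \<and> {y. t < h y} \<subseteq> U \<and> content (U - K) < e"
      if e: "e > 0" for e
    proof -
      obtain d where d: "d > 0" "\<And>s. dist s t < d \<Longrightarrow> dist (G s) (G t) < e"
        using cont e unfolding continuous_at_eps_delta by (metis dist_commute)
      define s where "s = t + d / 2"
      have s: "s > t" "dist s t < d" using d by (auto simp: s_def dist_real_def)
      define K where "K = {y. s \<le> h y}"
      have "closed K" unfolding K_def using h by (intro closed_Collect_le continuous_on_const)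
      moreover have "bounded K"
      proof -
        have "annular K" using ann by (rule annular_subset) (use s t in \<open>auto simp: K_def\<close>)
        then show ?thesis unfolding annular_def bounded_iff by auto
      qed
      ultimately have "compact K" by (simp add: compact_eq_bounded_closed)
      moreover have "content ({y. t < h y} - K) < e"
      proof -
        have "content ({y. t < h y} - K) \<le> content ({y. t < h y} - {y. s < h y})"
          using a[OF t] by (intro content_mono) (auto intro: annular_subset simp: K_def)
        also have "\<dots> = content {y. t < h y} - content {y. s < h y}"
          using s by (intro content_Diff a[OF t]) auto
        also have "\<dots> < e" using d(2)[OF s(2)] by (auto simp: G_def dist_real_def)
        finally show ?thesis .
      qed
      ultimately show ?thesis using a[OF t] op s
        by (intro exI[of _ K] exI[of _ "{y. t < h y}"] conjI) (auto simp: K_def)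
    qed
    then show ?thesis using a[OF t] op borel_open unfolding jordan_def by auto
  qed
  then have "{t\<in>{0<..}. {y. t < h y} \<notin> jordan} \<subseteq> {t\<in>{0<..}. \<not> isCont G t}" by auto
  then show ?thesis using c countable_subset by blast
qed

text \<open>Layer-cake sums need one step \<open>t\<close> whose multiples are all good levels at
  once. The bad steps form the countable union of the sets \<open>B / i\<close>, which cannot fill
  an interval.\<close>

lemma jordan_level:
  assumes h: "continuous_on UNIV h" and ann: "annular {y. h y \<noteq> 0}" and "a > 0"
  obtains t where "0 < t" "t < a" "\<And>i. i \<ge> 1 \<Longrightarrow> {y. real i * t < h y} \<in> jordan"
proof -
  define B where "B = {t\<in>{0<..}. {y. t < h y} \<notin> jordan}"
  have "countable (\<Union>i\<in>{1..}. (\<lambda>t. t / real i) ` B)"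
    using countable_non_jordan_levels[OF h ann] unfolding B_def by (intro countable_UN) auto
  moreover have "uncountable {0<..<a}" using \<open>a > 0\<close> by (simp add: uncountable_open_interval)
  ultimately obtain t where t: "t \<in> {0<..<a}" "t \<notin> (\<Union>i\<in>{1..}. (\<lambda>t. t / real i) ` B)"
    by (meson countable_subset subsetI)
  have "{y. real i * t < h y} \<in> jordan" if "i \<ge> 1" for i
  proof (rule ccontr)
    assume "{y. real i * t < h y} \<notin> jordan"
    then have "real i * t \<in> B" using t that by (auto simp: B_def)
    then have "t \<in> (\<lambda>t. t / real i) ` B" using that by (intro image_eqI[of _ _ "real i * t"]) auto
    then show False using t(2) that by auto
  qed
  then show ?thesis using t(1) that by auto
qed

lemma jordan_cover:
  assumes "annular E"
  obtains F where "F \<in> jordan" "E \<subseteq> F"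
proof -
  obtain r R where r: "r > 0" "\<forall>y\<in>E. r \<le> norm y \<and> norm y \<le> R"
    using assms unfolding annular_def by auto
  \<comment> \<open>A trapezoidal profile in the norm: on \<open>E\<close> it is at least
    \<open>min (r/2) 1\<close>, so any level below that number gives a superset of
    \<open>E\<close>.\<close>
  define h where "h y = max 0 (min (norm y - r / 2) (R + 1 - norm y))" for y :: 'a
  have "continuous_on UNIV h" unfolding h_def by (intro continuous_intros)
  moreover have "annular {y. h y \<noteq> 0}"
    unfolding annular_def using r(1)
    by (intro exI[of _ "r / 2"] conjI exI[of _ "R + 1"]) (auto simp: h_def max_def min_def split: if_splits)
  ultimately obtain t where t: "0 < t" "t < min (r / 2) 1" "\<And>i. i \<ge> 1 \<Longrightarrow> {y. real i * t < h y} \<in> jordan"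
    using jordan_level[of h "min (r / 2) 1"] r(1) by (metis half_gt_zero min_less_iff_conj zero_less_one)
  have "E \<subseteq> {y. t < h y}"
  proof
    fix y assume "y \<in> E"
    then have "r \<le> norm y" "norm y \<le> R" using r by auto
    moreover have "t < r / 2" "t < 1" using t(2) by auto
    ultimately show "y \<in> {y. t < h y}" by (simp add: h_def less_max_iff_disj)
  qed
  then show ?thesis using t(3)[of 1] by (intro that) auto
qed

text \<open>Every point of an open set avoiding 0 lies in a superlevel set of a small cone centred
  there. These are open sets in \<open>jordan\<close>, and by Lindelof countably many of them
  exhaust the given open set.\<close>

lemma sigma_sets_jordan: "sigma_sets (- {0}) jordan = sets (restrict_space borel (- {0}))"
proof
  have "jordan \<subseteq> sets (restrict_space borel (- {0}))"
    using jordan_subset by (auto simp: sets_restrict_space_iff jordan_def)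
  then show "sigma_sets (- {0}) jordan \<subseteq> sets (restrict_space borel (- {0}))"
    using sets.sigma_sets_subset[of jordan "restrict_space borel (- {0})"] by (simp add: space_restrict_space)
next
  interpret S: sigma_algebra "- {0}" "sigma_sets (- {0}) jordan"
    by (intro sigma_algebra_sigma_sets jordan_subset)
  have op: "U \<in> sigma_sets (- {0}) jordan" if U: "open U" "0 \<notin> U" for U
  proof -
    define \<F> where "\<F> = {E \<in> jordan. open E \<and> E \<subseteq> U}"
    obtain \<G> where G: "\<G> \<subseteq> \<F>" "countable \<G>" "\<Union>\<G> = \<Union>\<F>"
      using Lindelof[of \<F>] unfolding \<F>_def by auto
    have "U \<subseteq> \<Union>\<F>"
    proof
      fix x assume x: "x \<in> U"
      then obtain d where d: "d > 0" "ball x d \<subseteq> U" using U(1) open_contains_ball by blast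
      \<comment> \<open>The cone lives on the ball of radius \<open>d / 2\<close>. The ball of
        radius \<open>d\<close> misses 0 because \<open>U\<close> does, so the support keeps
        distance \<open>d / 2\<close> from 0.\<close>
      define h where "h y = max 0 (d / 2 - dist x y)" for y
      have cont: "continuous_on UNIV h" unfolding h_def by (intro continuous_intros)
      have sub: "{y. h y \<noteq> 0} \<subseteq> ball x (d / 2)" by (auto simp: h_def)
      have "d / 2 \<le> norm y \<and> norm y \<le> norm x + d / 2" if "h y \<noteq> 0" for y
      proof -
        have "y \<in> {y. h y \<noteq> 0}" using that by simp
        then have y: "dist x y < d / 2" using sub by auto
        have "d \<le> norm x" using d(2) U(2) by (force simp: dist_norm not_le[symmetric])
        moreover have "norm x \<le> norm y + dist x y" "norm y \<le> norm x + dist x y"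
          using norm_triangle_sub[of x y] norm_triangle_sub[of y x] by (auto simp: dist_norm norm_minus_commute)
        ultimately show "d / 2 \<le> norm y \<and> norm y \<le> norm x + d / 2" using y by auto
      qed
      then have "annular {y. h y \<noteq> 0}"
        unfolding annular_def using d
        by (intro exI[of _ "d / 2"] conjI[of "0 < _"] exI[of _ "norm x + d / 2"]) auto
      with cont d obtain t where t: "0 < t" "t < d / 2" "\<And>i. i \<ge> 1 \<Longrightarrow> {y. real i * t < h y} \<in> jordan"
        using jordan_level[of h "d / 2"] by (metis half_gt_zero)
      have "{y. t < h y} \<in> \<F>"
        unfolding \<F>_def using t(3)[of 1] cont t(1) sub d
        by (auto intro!: open_Collect_less continuous_on_const) (auto simp: h_def subset_iff)
      moreover have "x \<in> {y. t < h y}" using t by (simp add: h_def)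
      ultimately show "x \<in> \<Union>\<F>" by blast
    qed
    then have "U = \<Union>\<G>" using G unfolding \<F>_def by auto
    moreover have "\<Union>\<G> \<in> sigma_sets (- {0}) jordan"
      using G by (intro S.countable_Union) (auto simp: \<F>_def)
    ultimately show ?thesis by simp
  qed
  have sets_borel_eq: "sets (borel :: 'a measure) = sigma_sets UNIV {S. open S}"
    unfolding borel_def by (rule sets_measure_of) simp
  have "S \<inter> - {0} \<in> sigma_sets (- {0}) jordan" if "S \<in> sigma_sets UNIV {S. open S}" for S
    using that
  proof induction
    case (Basic a)
    then show ?case by (intro op open_Int) auto
  next
    case (Compl a)
    have "(UNIV - a) \<inter> - {0} = - {0} - (a \<inter> - {0})" by auto
    then show ?case using S.compl_sets[OF Compl.IH] by simp
  next
    case (Union a)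
    have "(\<Union>i. a i \<inter> - {0}) \<in> sigma_sets (- {0}) jordan" by (rule sigma_sets.Union[OF Union.IH])
    then show ?case by (simp add: Int_commute)
  qed (simp add: sigma_sets.Empty)
  then show "sets (restrict_space borel (- {0})) \<subseteq> sigma_sets (- {0}) jordan"
    unfolding sets_restrict_space sets_borel_eq by (auto simp: Int_commute)
qed

section \<open>The measure generated by the content, and the integral representation\<close>

lemma measure_exists:
  obtains N where "sets N = sets (restrict_space borel (- {0}))"
    "\<And>E. E \<in> jordan \<Longrightarrow> emeasure N E = ennreal (content E)"
proof -
  interpret ring_of_sets "- {0}" jordan
    by (rule ring_of_setsI) (use jordan_subset empty_jordan jordan_Un jordan_Diff in auto)
  have ann: "annular E" if "E \<in> jordan" for E using that by (simp add: jordan_def)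
  have "content {} = 0"
    using content_Diff[OF ann[OF empty_jordan], of "{}"] by simp
  then have p: "positive jordan (\<lambda>E. ennreal (content E))" by (simp add: positive_def)
  have a: "additive jordan (\<lambda>E. ennreal (content E))"
    unfolding additive_def using content_Un_disjoint content_nonneg ann by (auto simp: ennreal_plus)
  have c: "(\<lambda>i. ennreal (content (A i))) \<longlonglongrightarrow> 0"
    if "range A \<subseteq> jordan" "decseq A" "(\<Inter>i. A i) = {}" for A
    using tendsto_ennrealI[OF content_tendsto_0[OF that]] by simp
  \<comment> \<open>Caratheodory's extension from a ring, in the version where countable additivity
    is replaced by continuity at \<open>{}\<close> of a finite additive set function.\<close>
  obtain \<mu> :: "'a set \<Rightarrow> ennreal" where \<mu>: "\<And>E. E \<in> jordan \<Longrightarrow> \<mu> E = ennreal (content E)"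
      "measure_space (- {0}) (sigma_sets (- {0}) jordan) \<mu>"
    using caratheodory_empty_continuous[OF p a ennreal_neq_top[folded infinity_ennreal_def] c] by blast
  define N where "N = measure_of (- {0}) (sigma_sets (- {0}) jordan) \<mu>"
  have "sets N = sigma_sets (- {0}) jordan"
    unfolding N_def by (rule sigma_algebra.sets_measure_of_eq[OF sigma_algebra_sigma_sets[OF jordan_subset]])
  moreover have "emeasure N E = ennreal (content E)" if "E \<in> jordan" for E
  proof -
    have "emeasure N E = \<mu> E"
      unfolding N_def using \<mu>(2) that
      by (intro emeasure_measure_of_sigma) (auto simp: measure_space_def)
    then show ?thesis using \<mu>(1)[OF that] by simp
  qed
  ultimately show ?thesis by (intro that[of N]) (simp_all add: sigma_sets_jordan)
qed

text \<open>A layer-cake function \<open>s\<close> built from \<open>jordan\<close> sets satisfies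
  \<open>s \<le> h \<le> s + e 1_F\<close>, where \<open>F\<close> contains the support of
  \<open>h\<close>. The functional and the integral agree on both bounds, which differ by
  \<open>e\<close> times the content of \<open>F\<close>.\<close>

lemma nn_integral_representation:
  assumes N: "sets N = sets (restrict_space borel (- {0}))"
      "\<And>E. E \<in> jordan \<Longrightarrow> emeasure N E = ennreal (content E)"
    and h: "continuous_on UNIV h" "annular {y. h y \<noteq> 0}" "\<And>y. h y \<ge> 0" "\<And>y. h y \<le> M"
  shows "(\<integral>\<^sup>+ y. ennreal (h y) \<partial>N) = ennreal (\<Lambda> h)"
proof -
  have hV: "h \<in> quadratic_space"
    by (rule annular_supported_quadratic[OF h(2), of _ M]) (use h in auto)
  define E where "E = {y. h y \<noteq> 0}"
  obtain F where F: "F \<in> jordan" "E \<subseteq> F" using jordan_cover[OF h(2)] unfolding E_def by blast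
  have Fann: "annular F" using F by (simp add: jordan_def)
  have Js: "G \<in> sets N" if "G \<in> jordan" for G
    unfolding N(1) sigma_sets_jordan[symmetric] using that by (rule sigma_sets.Basic)
  have main: "\<exists>a. 0 \<le> a \<and> a \<le> \<Lambda> h \<and> \<Lambda> h \<le> a + e * content F \<and>
      ennreal a \<le> (\<integral>\<^sup>+ y. ennreal (h y) \<partial>N) \<and> (\<integral>\<^sup>+ y. ennreal (h y) \<partial>N) \<le> ennreal (a + e * content F)"
    if e: "e > 0" for e
  proof -
    obtain t where t: "0 < t" "t < e" "\<And>i. i \<ge> 1 \<Longrightarrow> {y. real i * t < h y} \<in> jordan"
      using jordan_level[OF h(1,2) e] by blast
    \<comment> \<open>Enough levels for \<open>n t\<close> to exceed the bound \<open>M\<close>, so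
      the cap in the layer-cake sum is never reached.\<close>
    define n where "n = nat \<lceil>M / t\<rceil>"
    have n: "h y \<le> real n * t" for y
    proof -
      have "M / t \<le> real n" unfolding n_def by linarith
      then show ?thesis using h(4)[of y] t(1) by (simp add: field_simps)
    qed
    define L where "L i = {y. real i * t < h y}" for i :: nat
    define s where "s y = (\<Sum>i=1..n. t * indicat_real (L i) y)" for y
    have Lj: "L i \<in> jordan" if "i \<in> {1..n}" for i using t(3)[of i] that by (simp add: L_def)
    then have La: "annular (L i)" if "i \<in> {1..n}" for i using that by (auto simp: jordan_def)
    have s_eq: "s y = (\<Sum>i=1..n. t * of_bool (real i * t < h y))" for y
      unfolding s_def L_def by (intro sum.cong) (auto simp: indicator_def)
    have s_le: "s y \<le> h y" for y
      using level_sum_bounds(1)[OF t(1) h(3)[of y], of n] by (simp add: s_eq)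
    have le_s: "h y \<le> s y + e * indicat_real F y" for y
    proof (cases "h y = 0")
      case True
      then show ?thesis using s_eq[of y] t e by (simp add: sum_nonneg)
    next
      case False
      then have "y \<in> F" using F(2) by (auto simp: E_def)
      moreover have "h y - t \<le> s y"
        using level_sum_bounds(2)[OF t(1) h(3)[of y], of n] n[of y] t(1) by (simp add: s_eq)
      ultimately show ?thesis using t(2) by simp
    qed
    have LV: "(\<lambda>y. t * indicat_real (L i) y) \<in> quadratic_space" if "i \<in> {1..n}" for i
      by (rule function_spaceD(3)[OF function_space_quadratic_space annular_indicator[OF La[OF that]]])
    have sV: "s \<in> quadratic_space"
      unfolding s_def by (rule function_space_sum[OF function_space_quadratic_space LV])
    have FV: "(\<lambda>y. e * indicat_real F y) \<in> quadratic_space"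
      by (rule function_spaceD(3)[OF function_space_quadratic_space annular_indicator[OF Fann]])
    have \<Lambda>s: "\<Lambda> s = (\<Sum>i=1..n. t * content (L i))"
    proof -
      have "\<Lambda> s = (\<Sum>i=1..n. \<Lambda> (\<lambda>y. t * indicat_real (L i) y))"
        unfolding s_def by (rule linear_functional_sum[OF function_space_quadratic_space linear LV])
      also have "\<dots> = (\<Sum>i=1..n. t * content (L i))"
        unfolding content_def
        by (intro sum.cong refl linear_functional_onD(2)[OF linear annular_indicator[OF La]])
      finally show ?thesis .
    qed
    have "\<Lambda> (\<lambda>y. s y + e * indicat_real F y) = \<Lambda> s + e * content F"
      unfolding linear_functional_onD(1)[OF linear sV FV]
      by (simp add: linear_functional_onD(2)[OF linear annular_indicator[OF Fann]] content_def)
    moreover have "\<Lambda> h \<le> \<Lambda> (\<lambda>y. s y + e * indicat_real F y)"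
      by (rule monotone[OF hV function_spaceD(2)[OF function_space_quadratic_space sV FV] le_s])
    moreover have "\<Lambda> s \<le> \<Lambda> h" by (rule monotone[OF sV hV s_le])
    moreover have cn: "content (L i) \<ge> 0" if "i \<in> {1..n}" for i using content_nonneg[OF La[OF that]] .
    then have "\<Lambda> s \<ge> 0" unfolding \<Lambda>s using t by (intro sum_nonneg mult_nonneg_nonneg) auto
    moreover have ints: "(\<integral>\<^sup>+ y. ennreal (s y) \<partial>N) = ennreal (\<Lambda> s)"
    proof -
      have "(\<integral>\<^sup>+ y. ennreal (s y) \<partial>N) = (\<integral>\<^sup>+ y. (\<Sum>i=1..n. ennreal t * indicator (L i) y) \<partial>N)"
      proof (intro nn_integral_cong)
        fix y
        have "ennreal (s y) = (\<Sum>i=1..n. ennreal (t * indicat_real (L i) y))"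
          unfolding s_def using t by (intro sum_ennreal[symmetric]) auto
        also have "\<dots> = (\<Sum>i=1..n. ennreal t * indicator (L i) y)"
          using t by (intro sum.cong refl) (auto simp: indicator_def)
        finally show "ennreal (s y) = (\<Sum>i=1..n. ennreal t * indicator (L i) y)" .
      qed
      also have "\<dots> = (\<Sum>i=1..n. ennreal t * emeasure N (L i))"
        using Js[OF Lj] by (subst nn_integral_sum) (auto intro!: sum.cong nn_integral_cmult_indicator borel_measurable_times_ennreal)
      also have "\<dots> = (\<Sum>i=1..n. ennreal (t * content (L i)))"
        using t cn by (intro sum.cong refl) (simp add: N(2)[OF Lj] ennreal_mult)
      also have "\<dots> = ennreal (\<Lambda> s)" unfolding \<Lambda>s using t cn by (intro sum_ennreal) auto
      finally show ?thesis .
    qed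
    moreover have "(\<integral>\<^sup>+ y. ennreal (s y) \<partial>N) \<le> (\<integral>\<^sup>+ y. ennreal (h y) \<partial>N)"
      using s_le by (intro nn_integral_mono ennreal_leI)
    moreover have "(\<integral>\<^sup>+ y. ennreal (h y) \<partial>N) \<le> ennreal (\<Lambda> s + e * content F)"
    proof -
      have s0: "s y \<ge> 0" for y unfolding s_eq using t by (intro sum_nonneg) auto
      have sm: "(\<lambda>y. ennreal (s y)) \<in> borel_measurable N"
        unfolding s_def using Js[OF Lj]
        by (intro measurable_compose[OF _ measurable_ennreal] borel_measurable_sum borel_measurable_times borel_measurable_const borel_measurable_indicator) auto
      have "(\<integral>\<^sup>+ y. ennreal (h y) \<partial>N) \<le> (\<integral>\<^sup>+ y. ennreal (s y) + ennreal e * indicator F y \<partial>N)"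
      proof (intro nn_integral_mono)
        fix y
        have "ennreal (h y) \<le> ennreal (s y + e * indicat_real F y)" using le_s by (intro ennreal_leI)
        also have "\<dots> = ennreal (s y) + ennreal e * indicator F y"
          using s0 e by (simp add: ennreal_plus ennreal_mult ennreal_indicator)
        finally show "ennreal (h y) \<le> ennreal (s y) + ennreal e * indicator F y" .
      qed
      also have "\<dots> = ennreal (\<Lambda> s) + ennreal e * emeasure N F"
        using Js[OF F(1)] sm by (subst nn_integral_add) (auto simp: ints nn_integral_cmult_indicator)
      also have "\<dots> = ennreal (\<Lambda> s + e * content F)"
        using e content_nonneg[OF Fann] \<open>\<Lambda> s \<ge> 0\<close> by (simp add: N(2)[OF F(1)] ennreal_mult ennreal_plus)
      finally show ?thesis .
    qed
    ultimately show ?thesis by (intro exI[of _ "\<Lambda> s"]) auto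
  qed
  have "\<Lambda> h \<ge> 0" using hV h(3) by (rule nonneg)
  \<comment> \<open>Adding 1 makes \<open>e / c\<close> a legitimate mesh even when \<open>F\<close>
    has content 0.\<close>
  define c where "c = content F + 1"
  have c: "c > 0" "content F \<le> c" using content_nonneg[OF Fann] by (auto simp: c_def)
  show ?thesis
  proof (rule antisym)
    show "(\<integral>\<^sup>+ y. ennreal (h y) \<partial>N) \<le> ennreal (\<Lambda> h)"
    proof (rule ennreal_le_epsilon)
      fix e :: real assume "e > 0"
      then have e: "e / c > 0" using c by simp
      obtain a where a: "0 \<le> a" "a \<le> \<Lambda> h" "(\<integral>\<^sup>+ y. ennreal (h y) \<partial>N) \<le> ennreal (a + e / c * content F)"
        using main[OF e] by blast
      have "e / c * content F \<le> e / c * c" using e c by (intro mult_left_mono) auto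
      then have "ennreal (a + e / c * content F) \<le> ennreal (\<Lambda> h + e)" using a c by (intro ennreal_leI) auto
      then show "(\<integral>\<^sup>+ y. ennreal (h y) \<partial>N) \<le> ennreal (\<Lambda> h) + ennreal e"
        using a(3) \<open>e > 0\<close> \<open>\<Lambda> h \<ge> 0\<close> by (simp add: ennreal_plus)
    qed
    show "ennreal (\<Lambda> h) \<le> (\<integral>\<^sup>+ y. ennreal (h y) \<partial>N)"
    proof (rule ennreal_le_epsilon)
      fix e :: real assume "e > 0"
      then have e: "e / c > 0" using c by simp
      obtain a where a: "0 \<le> a" "\<Lambda> h \<le> a + e / c * content F" "ennreal a \<le> (\<integral>\<^sup>+ y. ennreal (h y) \<partial>N)"
        using main[OF e] by blast
      have "e / c * content F \<le> e / c * c" using e c by (intro mult_left_mono) auto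
      then have "ennreal (\<Lambda> h) \<le> ennreal (a + e)" using a c by (intro ennreal_leI) auto
      also have "\<dots> = ennreal a + ennreal e" using a \<open>e > 0\<close> by (simp add: ennreal_plus)
      also have "\<dots> \<le> (\<integral>\<^sup>+ y. ennreal (h y) \<partial>N) + ennreal e" using a(3) by (intro add_right_mono)
      finally show "ennreal (\<Lambda> h) \<le> (\<integral>\<^sup>+ y. ennreal (h y) \<partial>N) + ennreal e" .
    qed
  qed
qed

text \<open>Positive and negative parts of \<open>h\<close> stay continuous with annular support but
  lose smoothness, so the representation is proved for continuous functions and not only for test
  functions.\<close>

theorem representing_measure:
  obtains N where "sets N = sets (restrict_space borel (- {0}))"
    "\<And>h :: 'a \<Rightarrow> real. continuous_on UNIV h \<Longrightarrow> annular {y. h y \<noteq> 0} \<Longrightarrow> integrable N h"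
    "\<And>h. continuous_on UNIV h \<Longrightarrow> annular {y. h y \<noteq> 0} \<Longrightarrow> integral\<^sup>L N h = \<Lambda> h"
proof -
  obtain N where N: "sets N = sets (restrict_space borel (- {0}))"
    "\<And>E. E \<in> jordan \<Longrightarrow> emeasure N E = ennreal (content E)"
    using measure_exists by blast
  have *: "integrable N h \<and> integral\<^sup>L N h = \<Lambda> h"
    if h: "continuous_on UNIV h" "annular {y. h y \<noteq> 0}" for h :: "'a \<Rightarrow> real"
  proof -
    define p where "p y = max 0 (h y)" for y
    define q where "q y = max 0 (- h y)" for y
    have cont: "continuous_on UNIV p" "continuous_on UNIV q"
      unfolding p_def q_def using h by (intro continuous_intros; simp)+
    have ann: "annular {y. p y \<noteq> 0}" "annular {y. q y \<noteq> 0}"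
      using h(2) by (rule annular_subset; auto simp: p_def q_def)+
    obtain r R where R: "\<And>y. h y \<noteq> 0 \<Longrightarrow> norm y \<le> R" using h(2) unfolding annular_def by blast
    have "bounded (h ` cball 0 R)"
      by (intro compact_imp_bounded compact_continuous_image continuous_on_subset[OF h(1)]) auto
    then have "\<exists>M. \<forall>y\<in>cball 0 R. \<bar>h y\<bar> \<le> M" unfolding bounded_iff by auto
    then obtain M where M0: "\<And>y. y \<in> cball 0 R \<Longrightarrow> \<bar>h y\<bar> \<le> M" by blast
    have M: "\<bar>h y\<bar> \<le> max 0 M" for y
      using M0[of y] R[of y] by (cases "h y = 0") auto
    have pq: "0 \<le> p y" "0 \<le> q y" "p y \<le> max 0 M" "q y \<le> max 0 M" for y
      using M[of y] by (auto simp: p_def q_def)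
    have meas: "p \<in> borel_measurable N" "q \<in> borel_measurable N"
      using cont by (auto simp: measurable_cong_sets[OF N(1) refl] intro: measurable_restrict_space1 borel_measurable_continuous_onI)
    have \<Lambda>pq: "(\<integral>\<^sup>+ y. ennreal (p y) \<partial>N) = ennreal (\<Lambda> p)" "(\<integral>\<^sup>+ y. ennreal (q y) \<partial>N) = ennreal (\<Lambda> q)"
      by (rule nn_integral_representation[OF N _ _ _ pq(3)] nn_integral_representation[OF N _ _ _ pq(4)];
          use cont ann pq in auto)+
    have V: "p \<in> quadratic_space" "q \<in> quadratic_space"
      by (rule annular_supported_quadratic[OF ann(1), of _ "max 0 M"] annular_supported_quadratic[OF ann(2), of _ "max 0 M"];
          use pq in auto)+
    have nn: "\<Lambda> p \<ge> 0" "\<Lambda> q \<ge> 0" using V pq by (auto intro: nonneg)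
    have int: "integrable N p" "integrable N q"
      using meas \<Lambda>pq pq by (auto intro!: integrableI_nonneg)
    have "integral\<^sup>L N p = \<Lambda> p" "integral\<^sup>L N q = \<Lambda> q"
      using meas \<Lambda>pq pq nn by (auto simp: integral_eq_nn_integral)
    moreover have h_eq: "h = (\<lambda>y. p y - q y)" by (auto simp: p_def q_def)
    moreover have "\<Lambda> h = \<Lambda> p - \<Lambda> q"
      unfolding h_eq by (rule linear_functional_diff[OF function_space_quadratic_space linear V])
    ultimately show ?thesis using int by (auto simp: Bochner_Integration.integral_diff)
  qed
  show ?thesis by (rule that[OF N(1) conjunct1[OF *] conjunct2[OF *]])
qed

end

section \<open>Positive extensions and the second-order Taylor expansion\<close>

text \<open>The extension theorem of M. Riesz: the infimum of \<open>L\<close> over majorants from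
  \<open>W\<close> is sublinear on \<open>V\<close>. A linear functional below it is positive, since
  0 majorises \<open>- h\<close> for \<open>h \<ge> 0\<close>; on \<open>W\<close> it lies below
  \<open>L\<close>, and applying this to \<open>- g\<close> as well gives equality.\<close>

lemma positive_extension:
  assumes V: "function_space V" and W: "function_space W" and WV: "W \<subseteq> V"
    and L: "linear_functional_on W L"
    and pos: "\<And>g. g \<in> W \<Longrightarrow> (\<And>y. 0 \<le> g y) \<Longrightarrow> 0 \<le> L g"
    and major: "\<And>h. h \<in> V \<Longrightarrow> \<exists>g\<in>W. \<forall>y. h y \<le> g y"
  obtains \<Lambda> where "linear_functional_on V \<Lambda>"
    "\<And>h. h \<in> V \<Longrightarrow> (\<And>y. 0 \<le> h y) \<Longrightarrow> 0 \<le> \<Lambda> h" "\<And>g. g \<in> W \<Longrightarrow> \<Lambda> g = L g"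
proof -
  define M where "M h = {g\<in>W. \<forall>y. h y \<le> g y}" for h
  define p where "p h = (INF g\<in>M h. L g)" for h
  note Ladd = linear_functional_onD(1)[OF L] and Lscale = linear_functional_onD(2)[OF L]
  have ne: "M h \<noteq> {}" if "h \<in> V" for h using major[OF that] by (auto simp: M_def)
  have bdd: "bdd_below (L ` M h)" if h: "h \<in> V" for h
  proof -
    \<comment> \<open>A majorant of \<open>- h\<close> bounds the infimum from below, because any
      majorant of \<open>h\<close> plus \<open>g0\<close> is nonnegative.\<close>
    obtain g0 where g0: "g0 \<in> W" "\<And>y. - h y \<le> g0 y"
      using major[OF function_spaceD(4)[OF V h]] by auto
    show ?thesis
    proof (rule bdd_belowI2)
      fix g assume g: "g \<in> M h"
      then have gW: "g \<in> W" by (simp add: M_def)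
      have "0 \<le> L (\<lambda>y. g y + g0 y)"
      proof (rule pos[OF function_spaceD(2)[OF W gW g0(1)]])
        fix y show "0 \<le> g y + g0 y"
          using g g0(2)[of y] by (simp add: M_def) (smt (verit))
      qed
      then show "- L g0 \<le> L g" using Ladd[OF gW g0(1)] by simp
    qed
  qed
  have ple: "p h \<le> L g" if "h \<in> V" "g \<in> W" "\<And>y. h y \<le> g y" for h g
    unfolding p_def using bdd[OF that(1)] by (rule cINF_lower) (use that in \<open>simp add: M_def\<close>)
  have pge: "c \<le> p h" if "h \<in> V" "\<And>g. g \<in> W \<Longrightarrow> (\<And>y. h y \<le> g y) \<Longrightarrow> c \<le> L g" for h c
    unfolding p_def using ne[OF that(1)] by (rule cINF_greatest) (use that in \<open>simp add: M_def\<close>)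
  have add: "p (\<lambda>y. f y + h y) \<le> p f + p h" if f: "f \<in> V" and h: "h \<in> V" for f h
  proof -
    have *: "p (\<lambda>y. f y + h y) \<le> L a + L b"
      if "a \<in> W" "\<And>y. f y \<le> a y" "b \<in> W" "\<And>y. h y \<le> b y" for a b
      using ple[OF function_spaceD(2)[OF V f h] function_spaceD(2)[OF W that(1,3)]]
        Ladd[OF that(1,3)] that(2,4) by (simp add: add_mono)
    have "p (\<lambda>y. f y + h y) - L a \<le> p h" if "a \<in> W" "\<And>y. f y \<le> a y" for a
      by (rule pge[OF h]) (use *[OF that] in \<open>simp add: diff_le_eq add.commute\<close>)
    then have "p (\<lambda>y. f y + h y) - p h \<le> p f"
      by (intro pge[OF f]) (simp add: diff_le_eq add.commute)
    then show ?thesis by simp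
  qed
  have le_scale: "p (\<lambda>y. r * f y) \<le> r * p f" if f: "f \<in> V" and r: "r > 0" for f r
  proof -
    have "p (\<lambda>y. r * f y) / r \<le> p f"
    proof (rule pge[OF f])
      fix g assume g: "g \<in> W" "\<And>y. f y \<le> g y"
      have "p (\<lambda>y. r * f y) \<le> L (\<lambda>y. r * g y)"
        by (rule ple[OF function_spaceD(3)[OF V f] function_spaceD(3)[OF W g(1)]]) (use g r in simp)
      then show "p (\<lambda>y. r * f y) / r \<le> L g" using Lscale[OF g(1), of r] r by (simp add: pos_divide_le_eq mult.commute)
    qed
    then show ?thesis using r by (simp add: pos_divide_le_eq mult.commute)
  qed
  have L0: "L (\<lambda>y. 0) = 0" using Lscale[OF function_spaceD(1)[OF W], of 0] by simp
  have p0: "p (\<lambda>y. 0) = 0"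
  proof (rule antisym)
    show "p (\<lambda>y. 0) \<le> 0" using ple[OF function_spaceD(1)[OF V] function_spaceD(1)[OF W]] L0 by simp
    show "0 \<le> p (\<lambda>y. 0)" by (rule pge[OF function_spaceD(1)[OF V] pos])
  qed
  have scale: "p (\<lambda>y. r * f y) = r * p f" if f: "f \<in> V" and r: "r \<ge> 0" for f r
  proof (cases "r = 0")
    case True
    then show ?thesis using p0 by simp
  next
    case False
    then have r: "r > 0" using r by simp
    have "p (\<lambda>y. inverse r * (r * f y)) \<le> inverse r * p (\<lambda>y. r * f y)"
      using le_scale[OF function_spaceD(3)[OF V f], of "inverse r" r] r by simp
    moreover have "(\<lambda>y. inverse r * (r * f y)) = f" using r by auto
    ultimately have "p f \<le> p (\<lambda>y. r * f y) / r" by (simp add: divide_inverse mult.commute)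
    then have "r * p f \<le> p (\<lambda>y. r * f y)" using r by (simp only: pos_le_divide_eq mult.commute)
    with le_scale[OF f r] show ?thesis by simp
  qed
  have "sublinear_functional_on V p"
    unfolding sublinear_functional_on_def by (intro conjI ballI allI impI add scale)
  then obtain \<Lambda> where \<Lambda>: "linear_functional_on V \<Lambda>" "\<And>f. f \<in> V \<Longrightarrow> \<Lambda> f \<le> p f"
    using sublinear_dominates_linear[OF V] by blast
  have neg: "\<Lambda> (\<lambda>y. - h y) = - \<Lambda> h" if "h \<in> V" for h
    using linear_functional_onD(2)[OF \<Lambda>(1) that, of "-1"] by simp
  have "0 \<le> \<Lambda> h" if h: "h \<in> V" "\<And>y. 0 \<le> h y" for h
  proof -
    have "\<Lambda> (\<lambda>y. - h y) \<le> p (\<lambda>y. - h y)" by (rule \<Lambda>(2)[OF function_spaceD(4)[OF V h(1)]])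
    also have "\<dots> \<le> L (\<lambda>y. 0)"
      by (rule ple[OF function_spaceD(4)[OF V h(1)] function_spaceD(1)[OF W]]) (use h in simp)
    finally show ?thesis using neg[OF h(1)] L0 by simp
  qed
  moreover have "\<Lambda> g = L g" if g: "g \<in> W" for g
  proof (rule antisym)
    have gV: "g \<in> V" using g WV by auto
    have *: "\<Lambda> f \<le> L f" if "f \<in> W" for f
      using \<Lambda>(2)[of f] ple[of f f] that WV by fastforce
    show "\<Lambda> g \<le> L g" using *[OF g] .
    have "\<Lambda> (\<lambda>y. - g y) \<le> L (\<lambda>y. - g y)" by (rule *[OF function_spaceD(4)[OF W g]])
    then show "L g \<le> \<Lambda> g" using neg[OF gV] Lscale[OF g, of "-1"] by simp
  qed
  ultimately show ?thesis by (rule that[OF \<Lambda>(1)])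
qed

section \<open>Gradient, Hessian and the Taylor expansion at the origin\<close>

lemma frechet_derivative_eq_inner_gradient:
  assumes "f differentiable (at x)"
  shows "frechet_derivative f (at x) v = v \<bullet> gradient f x"
proof -
  interpret D: bounded_linear "frechet_derivative f (at x)"
    using assms frechet_derivative_works has_derivative_bounded_linear by blast
  have "frechet_derivative f (at x) (\<Sum>i\<in>UNIV. (v $ i) *s axis i 1) =
      (\<Sum>i\<in>UNIV. v $ i * frechet_derivative f (at x) (axis i 1))"
    by (simp add: D.sum scalar_mult_eq_scaleR D.scaleR)
  then show ?thesis by (simp add: basis_expansion inner_vec_def gradient_def)
qed

lemma C_k_gradient: "C_k (Suc k) f \<Longrightarrow> C_k k (\<lambda>x. gradient f x $ j)"
  unfolding gradient_def using C_k_SucD(2) by simp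

lemma C_k_hessian: "C_k (Suc (Suc k)) f \<Longrightarrow> C_k k (\<lambda>x. hessian f x $ i $ j)"
  unfolding hessian_def using C_k_SucD(2)[OF C_k_gradient] by simp

text \<open>Apply the one-variable formula with Lagrange remainder to
  \<open>t \<mapsto> f (t y)\<close>. The error compares the Hessian at an intermediate point of the
  segment with the Hessian at 0; \<open>G\<close> measures this entrywise and is continuous with
  \<open>G 0 = 0\<close>.\<close>

lemma taylor_second_order:
  fixes f :: "real^'n \<Rightarrow> real"
  assumes f: "\<And>k. C_k k f" and e: "e > 0"
  obtains d where "d > 0"
    "\<And>y. norm y < d \<Longrightarrow> \<bar>f y - f 0 - y \<bullet> gradient f 0 -
       1/2 * (\<Sum>i\<in>UNIV. \<Sum>j\<in>UNIV. hessian f 0 $ i $ j * (y $ i * y $ j))\<bar> \<le> e * (norm y)\<^sup>2"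
proof -
  define G where "G y = (\<Sum>i\<in>UNIV. \<Sum>j\<in>UNIV. \<bar>hessian f y $ i $ j - hessian f 0 $ i $ j\<bar>)" for y
  have "continuous_on UNIV (\<lambda>y. hessian f y $ i $ j)" for i j
    using C_k_hessian[of 0 f i j] f by simp
  then have "continuous_on UNIV G" unfolding G_def
    by (intro continuous_on_sum continuous_on_rabs continuous_on_diff continuous_on_const)
  then have "isCont G 0" by (simp add: continuous_on_eq_continuous_at)
  moreover have "G 0 = 0" by (simp add: G_def)
  ultimately obtain d where d: "d > 0" "\<And>y. norm y < d \<Longrightarrow> \<bar>G y\<bar> < e"
    using e unfolding continuous_at_eps_delta by (fastforce simp: dist_norm)
  show ?thesis
  proof (rule that[OF d(1)])
    fix y :: "real^'n" assume y: "norm y < d"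
    define D1 where "D1 t = y \<bullet> gradient f (t *\<^sub>R y)" for t
    define D2 where "D2 t = (\<Sum>i\<in>UNIV. \<Sum>j\<in>UNIV. hessian f (t *\<^sub>R y) $ i $ j * (y $ i * y $ j))" for t
    have line: "((\<lambda>t. t *\<^sub>R y) has_derivative (\<lambda>s. s *\<^sub>R y)) (at t)" for t :: real
      by (auto intro!: derivative_eq_intros)
    have along: "((\<lambda>t. g (t *\<^sub>R y)) has_real_derivative y \<bullet> gradient g (t *\<^sub>R y)) (at t)"
      if "g differentiable (at (t *\<^sub>R y))" for g t
    proof -
      have "((\<lambda>t. g (t *\<^sub>R y)) has_derivative (\<lambda>s. frechet_derivative g (at (t *\<^sub>R y)) (s *\<^sub>R y))) (at t)"
        by (rule has_derivative_compose[OF line that[unfolded frechet_derivative_works]])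
      also have "(\<lambda>s. frechet_derivative g (at (t *\<^sub>R y)) (s *\<^sub>R y)) = (*) (y \<bullet> gradient g (t *\<^sub>R y))"
        by (simp add: frechet_derivative_eq_inner_gradient[OF that] fun_eq_iff)
      finally show ?thesis by (simp add: has_field_derivative_def)
    qed
    have d0: "((\<lambda>t. f (t *\<^sub>R y)) has_real_derivative D1 t) (at t)" for t
      unfolding D1_def by (rule along[OF C_k_Suc_differentiable[OF f]])
    have d1: "(D1 has_real_derivative D2 t) (at t)" for t
    proof -
      have "((\<lambda>t. \<Sum>j\<in>UNIV. y $ j * gradient f (t *\<^sub>R y) $ j) has_real_derivative
          (\<Sum>j\<in>UNIV. y $ j * (y \<bullet> gradient (\<lambda>z. gradient f z $ j) (t *\<^sub>R y)))) (at t)"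
        by (intro DERIV_sum DERIV_cmult along C_k_Suc_differentiable[OF C_k_gradient[OF f]])
      moreover have "(\<lambda>t. \<Sum>j\<in>UNIV. y $ j * gradient f (t *\<^sub>R y) $ j) = D1"
        by (auto simp: D1_def inner_vec_def)
      moreover have "(\<Sum>j\<in>UNIV. y $ j * (y \<bullet> gradient (\<lambda>z. gradient f z $ j) (t *\<^sub>R y))) = D2 t"
        unfolding D2_def by (subst sum.swap)
          (simp add: inner_vec_def gradient_def[of "\<lambda>z. gradient f z $ _"] hessian_def sum_distrib_left mult_ac)
      ultimately show ?thesis by simp
    qed
    \<comment> \<open>The derivative sequence in the form wanted by \<open>Maclaurin\<close>; only
      the orders 0, 1 and 2 are ever queried.\<close>
    define diff where "diff m = (if m = 0 then \<lambda>t. f (t *\<^sub>R y) else if m = 1 then D1 else D2)" for m :: nat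
    have "\<exists>t>0. t < 1 \<and> f (1 *\<^sub>R y) = (\<Sum>m<2. diff m 0 / fact m * 1 ^ m) + diff 2 t / fact 2 * 1 ^ 2"
      by (rule Maclaurin[where f = "\<lambda>t. f (t *\<^sub>R y)"])
         (use d0 d1 in \<open>auto simp: diff_def less_2_cases_iff\<close>)
    then obtain t where t: "0 < t" "t < 1" "f y = f 0 + D1 0 + D2 t / 2"
      by (auto simp: diff_def lessThan_nat_numeral lessThan_Suc numeral_2_eq_2)
    have "\<bar>D2 t - D2 0\<bar> \<le> G (t *\<^sub>R y) * (norm y)\<^sup>2"
    proof -
      have "D2 t - D2 0 = (\<Sum>i\<in>UNIV. \<Sum>j\<in>UNIV. (hessian f (t *\<^sub>R y) $ i $ j - hessian f 0 $ i $ j) * (y $ i * y $ j))"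
        by (simp add: D2_def sum_subtractf left_diff_distrib)
      also have "\<bar>\<dots>\<bar> \<le> (\<Sum>i\<in>UNIV. \<Sum>j\<in>UNIV. \<bar>hessian f (t *\<^sub>R y) $ i $ j - hessian f 0 $ i $ j\<bar> * (norm y)\<^sup>2)"
      proof (intro order_trans[OF sum_abs] sum_mono)
        fix i j
        have "\<bar>y $ i * y $ j\<bar> \<le> norm y * norm y"
          unfolding abs_mult by (intro mult_mono component_le_norm_cart) auto
        then show "\<bar>(hessian f (t *\<^sub>R y) $ i $ j - hessian f 0 $ i $ j) * (y $ i * y $ j)\<bar>
            \<le> \<bar>hessian f (t *\<^sub>R y) $ i $ j - hessian f 0 $ i $ j\<bar> * (norm y)\<^sup>2"
          unfolding abs_mult[of "hessian f (t *\<^sub>R y) $ i $ j - hessian f 0 $ i $ j"] power2_eq_square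
          by (intro mult_left_mono) auto
      qed
      also have "\<dots> = G (t *\<^sub>R y) * (norm y)\<^sup>2" by (simp add: G_def sum_distrib_right)
      finally show ?thesis .
    qed
    also have "\<dots> \<le> e * (norm y)\<^sup>2"
    proof (rule mult_right_mono)
      have "norm (t *\<^sub>R y) < d" using t y by (smt (verit) mult_left_le_one_le norm_ge_zero norm_scaleR)
      then show "G (t *\<^sub>R y) \<le> e" using d(2) by fastforce
    qed simp
    finally have "\<bar>D2 t - D2 0\<bar> \<le> e * (norm y)\<^sup>2" .
    moreover have "f y - f 0 - y \<bullet> gradient f 0 -
       1/2 * (\<Sum>i\<in>UNIV. \<Sum>j\<in>UNIV. hessian f 0 $ i $ j * (y $ i * y $ j)) = (D2 t - D2 0) / 2"
      using t(3) by (simp add: D1_def D2_def)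
    ultimately show "\<bar>f y - f 0 - y \<bullet> gradient f 0 -
       1/2 * (\<Sum>i\<in>UNIV. \<Sum>j\<in>UNIV. hessian f 0 $ i $ j * (y $ i * y $ j))\<bar> \<le> e * (norm y)\<^sup>2"
      by (simp add: abs_le_iff field_simps)
  qed
qed

section \<open>Functionals satisfying the positive maximum principle\<close>

locale pmp_functional =
  fixes L :: "(real^'n \<Rightarrow> real) \<Rightarrow> real"
  assumes linear: "linear_functional_on Cc_infinity L"
    and pmp: "\<And>f. f \<in> Cc_infinity \<Longrightarrow> (\<And>y. f y \<le> f 0) \<Longrightarrow> 0 \<le> f 0 \<Longrightarrow> L f \<le> 0"
begin

lemmas add = linear_functional_onD(1)[OF linear]
lemmas scale = linear_functional_onD(2)[OF linear]
lemmas diff = linear_functional_diff[OF function_space_Cc_infinity linear]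
lemmas sum = linear_functional_sum[OF function_space_Cc_infinity linear]

text \<open>\<open>- f\<close> attains its maximum 0 at the origin, so the maximum principle applies
  to it.\<close>

lemma nonneg_of_zero:
  assumes "f \<in> Cc_infinity" "\<And>y. 0 \<le> f y" "f 0 = 0"
  shows "0 \<le> L f"
proof -
  have "L (\<lambda>y. - f y) \<le> 0"
    by (rule pmp[OF function_spaceD(4)[OF function_space_Cc_infinity assms(1)]]) (use assms in auto)
  then show ?thesis using scale[OF assms(1), of "-1"] by simp
qed

lemma abs_le_of_zero:
  assumes "f \<in> Cc_infinity" "g \<in> Cc_infinity" "\<And>y. \<bar>f y\<bar> \<le> g y" "g 0 = 0"
  shows "\<bar>L f\<bar> \<le> L g"
proof -
  have f0: "f 0 = 0" using assms(3)[of 0] assms(4) by simp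
  have "0 \<le> L (\<lambda>y. g y - f y)"
    by (rule nonneg_of_zero[OF function_space_diff[OF function_space_Cc_infinity assms(2,1)]])
       (use assms(3,4) f0 in \<open>auto simp: abs_le_iff\<close>)
  moreover have "0 \<le> L (\<lambda>y. g y + f y)"
  proof (rule nonneg_of_zero[OF function_spaceD(2)[OF function_space_Cc_infinity assms(2,1)]])
    fix y show "0 \<le> g y + f y" using assms(3)[of y] by linarith
  qed (use assms(4) f0 in simp)
  ultimately show ?thesis using add[OF assms(2,1)] diff[OF assms(2,1)] by simp
qed

text \<open>\<open>L\<close> is positive on the test functions in \<open>quadratic_space\<close>,
  because a quadratic bound forces the value 0 at the origin. Truncations of
  \<open>|C| |y|^2\<close> provide the majorants required for the positive extension.\<close>

lemma levy_measure_exists: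
  obtains N where "sets N = sets (restrict_space borel (- {0}))"
    "\<And>h. h \<in> Cc_infinity \<Longrightarrow> annular {y. h y \<noteq> 0} \<Longrightarrow> integrable N h"
    "\<And>h. h \<in> Cc_infinity \<Longrightarrow> annular {y. h y \<noteq> 0} \<Longrightarrow> integral\<^sup>L N h = L h"
proof -
  define W :: "(real^'n \<Rightarrow> real) set" where "W = Cc_infinity \<inter> quadratic_space"
  have W: "function_space W"
    unfolding function_space_def W_def
    by (intro conjI ballI allI IntI function_spaceD(1)[OF function_space_Cc_infinity]
      function_spaceD(1)[OF function_space_quadratic_space]
      function_spaceD(2)[OF function_space_Cc_infinity] function_spaceD(2)[OF function_space_quadratic_space]
      function_spaceD(3)[OF function_space_Cc_infinity] function_spaceD(3)[OF function_space_quadratic_space])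
      (erule IntE, assumption)+
  have LW: "linear_functional_on W L"
    using linear unfolding linear_functional_on_def W_def by simp
  have pos: "0 \<le> L g" if g: "g \<in> W" "\<And>y. 0 \<le> g y" for g
  proof (rule nonneg_of_zero)
    obtain C where C: "\<And>y. \<bar>g y\<bar> \<le> C * (norm y)\<^sup>2"
      using g(1) unfolding W_def quadratic_space_def by auto
    show "g 0 = 0" using C[of 0] by simp
  qed (use g in \<open>auto simp: W_def\<close>)
  have major: "\<exists>g\<in>W. \<forall>y. h y \<le> g y" if h: "h \<in> quadratic_space" for h
  proof -
    obtain C R where C: "\<And>y. \<bar>h y\<bar> \<le> C * (norm y)\<^sup>2" and R: "\<And>y. norm y > R \<Longrightarrow> h y = 0"
      using h unfolding quadratic_space_def by auto
    \<comment> \<open>Twice the support radius, so that the plateau of \<open>bump r\<close>, of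
      radius \<open>r / 2\<close>, covers the support of \<open>h\<close>.\<close>
    define r where "r = 2 * max 1 R"
    have r: "r > 0" "r / 2 \<ge> R" by (auto simp: r_def)
    define g where "g y = \<bar>C\<bar> * (norm y)\<^sup>2 * bump r y" for y :: "real^'n"
    have g_eq: "g = (\<lambda>y. (\<Sum>i\<in>UNIV. \<bar>C\<bar> * (y $ i * y $ i)) * bump r y)"
      by (auto simp: g_def power2_norm_eq_inner inner_vec_def sum_distrib_left)
    have "g \<in> Cc_infinity"
      unfolding g_eq by (intro Cc_infinity_mult bump_Cc_infinity r C_k_sum C_k_mult C_k_const C_k_nth)
    moreover have "g \<in> quadratic_space"
    proof (rule quadratic_spaceI[of _ "\<bar>C\<bar>" r])
      fix y show "\<bar>g y\<bar> \<le> \<bar>C\<bar> * (norm y)\<^sup>2"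
        using bump_bounds[of r y] by (simp add: g_def abs_mult mult_left_le)
    next
      fix y :: "real^'n" assume "r < norm y"
      then show "g y = 0" using bump_eq_0[OF r(1), of y] by (simp add: g_def)
    qed
    moreover have "h y \<le> g y" for y
    proof (cases "norm y > R")
      case True
      then show ?thesis using R bump_bounds(1)[of r y] by (simp add: g_def)
    next
      case False
      then have "bump r y = 1" using r by (intro bump_eq_1) auto
      moreover have "C * (norm y)\<^sup>2 \<le> \<bar>C\<bar> * (norm y)\<^sup>2" by (intro mult_right_mono) auto
      ultimately show ?thesis using C[of y] by (simp add: g_def)
    qed
    ultimately show ?thesis unfolding W_def by blast
  qed
  obtain \<Lambda> where \<Lambda>: "linear_functional_on quadratic_space \<Lambda>"
    "\<And>h. h \<in> quadratic_space \<Longrightarrow> (\<And>y. 0 \<le> h y) \<Longrightarrow> 0 \<le> \<Lambda> h" "\<And>g. g \<in> W \<Longrightarrow> \<Lambda> g = L g"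
    by (rule positive_extension[OF function_space_quadratic_space W _ LW pos major]) (auto simp: W_def)
  interpret positive_functional \<Lambda>
    by unfold_locales (use \<Lambda>(1,2) in auto)
  obtain N where N: "sets N = sets (restrict_space borel (- {0}))"
    "\<And>h :: real^'n \<Rightarrow> real. continuous_on UNIV h \<Longrightarrow> annular {y. h y \<noteq> 0} \<Longrightarrow> integrable N h"
    "\<And>h. continuous_on UNIV h \<Longrightarrow> annular {y. h y \<noteq> 0} \<Longrightarrow> integral\<^sup>L N h = \<Lambda> h"
    using representing_measure by blast
  have hW: "h \<in> W" if h: "h \<in> Cc_infinity" "annular {y. h y \<noteq> 0}" for h
  proof -
    obtain M where "\<And>y. \<bar>h y\<bar> \<le> M" using Cc_infinity_bounded[OF h(1)] by blast
    then have "h \<in> quadratic_space" by (intro annular_supported_quadratic[OF h(2)]) auto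
    then show ?thesis using h(1) by (simp add: W_def)
  qed
  show ?thesis
  proof (rule that[OF N(1)])
    fix h :: "real^'n \<Rightarrow> real" assume h: "h \<in> Cc_infinity" "annular {y. h y \<noteq> 0}"
    show "integrable N h" by (rule N(2)[OF Cc_infinity_continuous[OF h(1)] h(2)])
    show "integral\<^sup>L N h = L h"
      using N(3)[OF Cc_infinity_continuous[OF h(1)] h(2)] \<Lambda>(3)[OF hW[OF h]] by simp
  qed
qed

end

section \<open>Fixed cutoff functions near the origin and away from it\<close>

definition cutoff :: "real^'n \<Rightarrow> real" where "cutoff = bump 1"

lemma cutoff_Cc_infinity: "cutoff \<in> Cc_infinity"
  unfolding cutoff_def by (rule bump_Cc_infinity) simp

lemma cutoff_bounds: "0 \<le> cutoff y" "cutoff y \<le> 1"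
  unfolding cutoff_def by (rule bump_bounds)+

lemma cutoff_eq: "norm y \<le> 1/2 \<Longrightarrow> cutoff y = 1" "1 \<le> norm y \<Longrightarrow> cutoff y = 0"
  unfolding cutoff_def by (simp_all add: bump_eq_1 bump_eq_0)

lemma coord_cutoff_Cc_infinity:
  "(\<lambda>y. y $ i * cutoff y) \<in> Cc_infinity" "(\<lambda>y. (y $ i * y $ j) * cutoff y) \<in> Cc_infinity"
  by (intro Cc_infinity_mult cutoff_Cc_infinity C_k_mult C_k_nth)+

text \<open>The test function against which everything of order \<open>|y|^2\<close> near 0 is
  compared.\<close>

definition quad_cutoff :: "real^'n \<Rightarrow> real" where "quad_cutoff y = (norm y)\<^sup>2 * cutoff y"

lemma quad_cutoff_nonneg: "0 \<le> quad_cutoff y"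
  using cutoff_bounds[of y] by (simp add: quad_cutoff_def)

lemma quad_cutoff_0: "quad_cutoff 0 = 0"
  by (simp add: quad_cutoff_def)

lemma quad_cutoff_eq: "quad_cutoff = (\<lambda>y. \<Sum>i\<in>UNIV. (y $ i * y $ i) * cutoff y)"
  by (auto simp: quad_cutoff_def power2_norm_eq_inner inner_vec_def sum_distrib_right)

lemma quad_cutoff_Cc_infinity: "quad_cutoff \<in> Cc_infinity"
  unfolding quad_cutoff_eq
  by (rule function_space_sum[OF function_space_Cc_infinity coord_cutoff_Cc_infinity(2)])

text \<open>An approximation of 1 on the punctured space by test functions with annular support, to
  which the representation by \<open>N\<close> applies. At each nonzero point it is eventually equal
  to 1.\<close>

definition annulus_cutoff :: "nat \<Rightarrow> real^'n \<Rightarrow> real" where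
  "annulus_cutoff n y = (1 - bump (1 / real (Suc n)) y) * bump (real (Suc n)) y"

lemma annulus_cutoff_bounds: "0 \<le> annulus_cutoff n y" "annulus_cutoff n y \<le> 1"
  using bump_bounds[of "1 / real (Suc n)" y] bump_bounds[of "real (Suc n)" y]
  by (auto simp: annulus_cutoff_def intro: mult_le_one)

lemma annulus_cutoff_mult_Cc_infinity:
  assumes "\<And>k. C_k k g"
  shows "(\<lambda>y. annulus_cutoff n y * g y) \<in> Cc_infinity"
proof -
  have "(\<lambda>y. (g y * (1 - bump (1 / real (Suc n)) y)) * bump (real (Suc n)) y) \<in> Cc_infinity"
    by (intro Cc_infinity_mult bump_Cc_infinity C_k_mult C_k_diff C_k_const C_k_bump assms) simp
  then show ?thesis by (simp add: annulus_cutoff_def mult_ac)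
qed

lemma annular_annulus_cutoff_mult: "annular {y. annulus_cutoff n y * g y \<noteq> 0}"
proof (rule annularI[of "1 / real (Suc n) / 2" _ "real (Suc n)"])
  fix y :: "real^'a" assume "y \<in> {y. annulus_cutoff n y * g y \<noteq> 0}"
  then have "bump (1 / real (Suc n)) y \<noteq> 1" "bump (real (Suc n)) y \<noteq> 0" by (auto simp: annulus_cutoff_def)
  then show "1 / real (Suc n) / 2 \<le> norm y" "norm y \<le> real (Suc n)"
    using bump_eq_1[of "1 / real (Suc n)" y] bump_eq_0[of "real (Suc n)" y] by fastforce+
qed simp

lemma annulus_cutoff_eventually:
  assumes "y \<noteq> 0"
  shows "\<forall>\<^sub>F n in sequentially. annulus_cutoff n y = 1"
proof -
  obtain m :: nat where m: "real m > 2 * norm y" using reals_Archimedean2 by blast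
  obtain k :: nat where k: "real k > 1 / norm y" using reals_Archimedean2 by blast
  show ?thesis
  proof (rule eventually_sequentiallyI[of "max m k"])
    fix n assume n: "max m k \<le> n"
    have "norm y \<le> real (Suc n) / 2" using n m by simp
    moreover have "1 / real (Suc n) \<le> norm y"
    proof -
      have "1 / norm y \<le> real (Suc n)" using n k by simp
      then show ?thesis using assms by (simp add: field_simps)
    qed
    ultimately show "annulus_cutoff n y = 1"
      by (simp add: annulus_cutoff_def bump_eq_1 bump_eq_0)
  qed
qed

section \<open>Mass bounds for the Levy measure, and remainders represented by it\<close>

locale pmp_levy = pmp_functional L for L :: "(real^'n \<Rightarrow> real) \<Rightarrow> real" +
  fixes N :: "(real^'n) measure"
  assumes sets_N: "sets N = sets (restrict_space borel (- {0}))"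
    and represents: "\<And>h. h \<in> Cc_infinity \<Longrightarrow> annular {y. h y \<noteq> 0} \<Longrightarrow> integrable N h"
      "\<And>h. h \<in> Cc_infinity \<Longrightarrow> annular {y. h y \<noteq> 0} \<Longrightarrow> integral\<^sup>L N h = L h"
begin

lemma space_N: "space N = - {0}"
  using sets_eq_imp_space_eq[OF sets_N] by (simp add: space_restrict_space)

lemma measurable_N: "h \<in> borel_measurable borel \<Longrightarrow> h \<in> borel_measurable N"
  by (simp add: measurable_cong_sets[OF sets_N refl] measurable_restrict_space1)

lemma measurable_N_C_k: "(\<And>k. C_k k h) \<Longrightarrow> h \<in> borel_measurable N"
  using C_k.simps(1)[of h] by (intro measurable_N borel_measurable_continuous_onI) simp

text \<open>Fatou along \<open>annulus_cutoff\<close>. The function \<open>g\<close> may fail to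
  have compact support, so the bound is put on its truncations and not on
  \<open>L g\<close>.\<close>

lemma nn_integral_le:
  assumes g: "\<And>k. C_k k g" and nn: "\<And>y. 0 \<le> g y"
    and le: "\<And>n. L (\<lambda>y. annulus_cutoff n y * g y) \<le> c"
  shows "(\<integral>\<^sup>+ y. ennreal (g y) \<partial>N) \<le> ennreal c"
proof -
  note Cc = annulus_cutoff_mult_Cc_infinity[OF g]
  have "(\<integral>\<^sup>+ y. ennreal (g y) \<partial>N) = (\<integral>\<^sup>+ y. liminf (\<lambda>n. ennreal (annulus_cutoff n y * g y)) \<partial>N)"
  proof (intro nn_integral_cong)
    fix y assume "y \<in> space N"
    then have "\<forall>\<^sub>F n in sequentially. annulus_cutoff n y = 1"
      by (intro annulus_cutoff_eventually) (simp add: space_N)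
    then have "(\<lambda>n. ennreal (annulus_cutoff n y * g y)) \<longlonglongrightarrow> ennreal (g y)"
      by (intro tendsto_eventually) (auto elim!: eventually_mono)
    then show "ennreal (g y) = liminf (\<lambda>n. ennreal (annulus_cutoff n y * g y))"
      by (simp add: lim_imp_Liminf)
  qed
  also have "\<dots> \<le> liminf (\<lambda>n. \<integral>\<^sup>+ y. ennreal (annulus_cutoff n y * g y) \<partial>N)"
    by (intro nn_integral_liminf measurable_compose[OF _ measurable_ennreal] measurable_N_C_k
        Cc_infinityD(1)[OF Cc])
  also have "\<dots> \<le> ennreal c"
  proof (rule Liminf_le)
    have "(\<integral>\<^sup>+ y. ennreal (annulus_cutoff n y * g y) \<partial>N) \<le> ennreal c" for n
    proof -
      have "(\<integral>\<^sup>+ y. ennreal (annulus_cutoff n y * g y) \<partial>N) = ennreal (L (\<lambda>y. annulus_cutoff n y * g y))"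
        unfolding represents(2)[OF Cc annular_annulus_cutoff_mult, symmetric]
        by (rule nn_integral_eq_integral[OF represents(1)[OF Cc annular_annulus_cutoff_mult]])
           (intro AE_I2 mult_nonneg_nonneg nn annulus_cutoff_bounds)
      then show ?thesis using le[of n] by (simp add: ennreal_leI)
    qed
    then show "\<forall>\<^sub>F n in sequentially. (\<integral>\<^sup>+ y. ennreal (annulus_cutoff n y * g y) \<partial>N) \<le> ennreal c" by simp
  qed simp
  finally show ?thesis .
qed

text \<open>What the truncation cuts off is nonnegative and vanishes at 0. Only an inequality can be
  expected: the second-order part of \<open>L\<close> at the origin is not seen by
  \<open>N\<close>.\<close>

lemma nn_integral_le_functional:
  assumes g: "g \<in> Cc_infinity" and nn: "\<And>y. 0 \<le> g y" and g0: "g 0 = 0"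
  shows "(\<integral>\<^sup>+ y. ennreal (g y) \<partial>N) \<le> ennreal (L g)"
proof (rule nn_integral_le[OF Cc_infinityD(1)[OF g] nn])
  fix n
  note Cc = annulus_cutoff_mult_Cc_infinity[OF Cc_infinityD(1)[OF g]]
  have "0 \<le> L (\<lambda>y. g y - annulus_cutoff n y * g y)"
  proof (rule nonneg_of_zero[OF function_space_diff[OF function_space_Cc_infinity g Cc]])
    fix y show "0 \<le> g y - annulus_cutoff n y * g y"
      using annulus_cutoff_bounds[of n y] nn[of y] by (simp add: mult_left_le_one_le)
  qed (use g0 in simp)
  then show "L (\<lambda>y. annulus_cutoff n y * g y) \<le> L g" using diff[OF g Cc] by simp
qed

text \<open>The truncated \<open>1 - cutoff\<close> plus \<open>cutoff\<close> never exceeds 1 and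
  equals 1 at the origin, so the maximum principle, with a positive maximum, bounds its image by 0.
  This controls the mass far away.\<close>

lemma nn_integral_one_minus_cutoff: "(\<integral>\<^sup>+ y. ennreal (1 - cutoff y) \<partial>N) \<le> ennreal (- L cutoff)"
proof -
  have g: "C_k k (\<lambda>y. 1 - cutoff y)" for k
    by (intro C_k_diff C_k_const Cc_infinityD(1)[OF cutoff_Cc_infinity])
  show ?thesis
  proof (rule nn_integral_le[OF g])
    fix n
    note Cc = annulus_cutoff_mult_Cc_infinity[OF g]
    have "L (\<lambda>y. annulus_cutoff n y * (1 - cutoff y) + cutoff y) \<le> 0"
    proof (rule pmp[OF function_spaceD(2)[OF function_space_Cc_infinity Cc cutoff_Cc_infinity]])
      fix y :: "real^'n"
      have "annulus_cutoff n y * (1 - cutoff y) \<le> 1 - cutoff y"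
        using annulus_cutoff_bounds[of n y] cutoff_bounds[of y] by (simp add: mult_left_le_one_le)
      then show "annulus_cutoff n y * (1 - cutoff y) + cutoff y \<le> annulus_cutoff n 0 * (1 - cutoff 0) + cutoff 0"
        by (simp add: cutoff_eq)
    qed (simp add: cutoff_eq)
    then show "L (\<lambda>y. annulus_cutoff n y * (1 - cutoff y)) \<le> - L cutoff"
      using add[OF Cc cutoff_Cc_infinity] by simp
  qed (use cutoff_bounds in simp)
qed

text \<open>The two terms come from splitting \<open>min 1 (|y|^2)\<close> along the partition
  \<open>1 = (1 - cutoff) + cutoff\<close>. Both are values of \<open>L\<close> at fixed test
  functions, hence controlled uniformly over all \<open>L \<le> p\<close>.\<close>

definition mass_bound :: real where "mass_bound = - L cutoff + L quad_cutoff"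

lemma L_cutoff_nonpos: "L cutoff \<le> 0"
  by (rule pmp[OF cutoff_Cc_infinity]) (simp_all add: cutoff_eq(1)[of 0] cutoff_bounds)

lemma L_quad_cutoff_nonneg: "0 \<le> L quad_cutoff"
  by (rule nonneg_of_zero[OF quad_cutoff_Cc_infinity quad_cutoff_nonneg quad_cutoff_0])

lemma min_le_cutoffs: "min 1 ((norm y)\<^sup>2) \<le> (1 - cutoff y) + quad_cutoff y"
proof -
  have "min 1 ((norm y)\<^sup>2) * (1 - cutoff y) \<le> 1 * (1 - cutoff y)"
    using cutoff_bounds[of y] by (intro mult_right_mono) auto
  moreover have "min 1 ((norm y)\<^sup>2) * cutoff y \<le> (norm y)\<^sup>2 * cutoff y"
    using cutoff_bounds[of y] by (intro mult_right_mono) auto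
  ultimately show ?thesis by (simp add: quad_cutoff_def algebra_simps)
qed

lemma nn_integral_min: "(\<integral>\<^sup>+ y. ennreal (min 1 ((norm y)\<^sup>2)) \<partial>N) \<le> ennreal mass_bound"
proof -
  have g: "C_k k (\<lambda>y. 1 - cutoff y)" for k
    by (intro C_k_diff C_k_const Cc_infinityD(1)[OF cutoff_Cc_infinity])
  have "(\<integral>\<^sup>+ y. ennreal (min 1 ((norm y)\<^sup>2)) \<partial>N) \<le> (\<integral>\<^sup>+ y. ennreal (1 - cutoff y) + ennreal (quad_cutoff y) \<partial>N)"
  proof (intro nn_integral_mono)
    fix y :: "real^'n"
    have "ennreal (min 1 ((norm y)\<^sup>2)) \<le> ennreal ((1 - cutoff y) + quad_cutoff y)"
      by (intro ennreal_leI min_le_cutoffs)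
    then show "ennreal (min 1 ((norm y)\<^sup>2)) \<le> ennreal (1 - cutoff y) + ennreal (quad_cutoff y)"
      using cutoff_bounds[of y] by (simp add: ennreal_plus quad_cutoff_def)
  qed
  also have "\<dots> = (\<integral>\<^sup>+ y. ennreal (1 - cutoff y) \<partial>N) + (\<integral>\<^sup>+ y. ennreal (quad_cutoff y) \<partial>N)"
    by (intro nn_integral_add measurable_compose[OF _ measurable_ennreal] measurable_N_C_k g
        Cc_infinityD(1)[OF quad_cutoff_Cc_infinity])
  also have "\<dots> \<le> ennreal (- L cutoff) + ennreal (L quad_cutoff)"
    by (intro add_mono nn_integral_one_minus_cutoff nn_integral_le_functional quad_cutoff_Cc_infinity
        quad_cutoff_nonneg quad_cutoff_0)
  also have "\<dots> = ennreal mass_bound"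
    using L_cutoff_nonpos L_quad_cutoff_nonneg by (simp add: mass_bound_def ennreal_plus[symmetric])
  finally show ?thesis .
qed

lemma integrable_min: "integrable N (\<lambda>y. min 1 ((norm y)\<^sup>2))"
proof (rule integrableI_nonneg)
  show "(\<lambda>y. min 1 ((norm y)\<^sup>2)) \<in> borel_measurable N" by (rule measurable_N) simp
  show "(\<integral>\<^sup>+ y. ennreal (min 1 ((norm y)\<^sup>2)) \<partial>N) < \<infinity>"
    using nn_integral_min by (rule order.strict_trans1) simp
qed simp

lemma integrable_N:
  assumes "h \<in> borel_measurable borel" "\<And>y. \<bar>h y\<bar> \<le> C * min 1 ((norm y)\<^sup>2)"
  shows "integrable N h"
proof (rule Bochner_Integration.integrable_bound[OF integrable_mult_right[OF integrable_min, of C] measurable_N[OF assms(1)]])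
  show "AE y in N. norm (h y) \<le> norm (C * min 1 ((norm y)\<^sup>2))"
    using assms(2) by (intro AE_I2) (metis abs_ge_self order_trans real_norm_def)
qed

lemma mass_bound_nonneg: "0 \<le> mass_bound"
  using L_cutoff_nonpos L_quad_cutoff_nonneg by (simp add: mass_bound_def)

lemma abs_integral_le:
  assumes "h \<in> borel_measurable borel" "\<And>y. \<bar>h y\<bar> \<le> C * min 1 ((norm y)\<^sup>2)" "0 \<le> C"
  shows "\<bar>integral\<^sup>L N h\<bar> \<le> C * mass_bound"
proof -
  have "\<bar>integral\<^sup>L N h\<bar> \<le> integral\<^sup>L N (\<lambda>y. \<bar>h y\<bar>)" by (rule integral_abs_bound)
  also have "\<dots> \<le> integral\<^sup>L N (\<lambda>y. C * min 1 ((norm y)\<^sup>2))"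
    using assms integrable_N[OF assms(1,2)]
    by (intro integral_mono integrable_abs integrable_mult_right integrable_min) auto
  also have "\<dots> = C * integral\<^sup>L N (\<lambda>y. min 1 ((norm y)\<^sup>2))" by simp
  also have "integral\<^sup>L N (\<lambda>y. min 1 ((norm y)\<^sup>2)) \<le> mass_bound"
    using nn_integral_min mass_bound_nonneg
    by (subst integral_eq_nn_integral) (auto intro!: measurable_N enn2real_leI)
  finally show ?thesis using assms(3) by (simp add: mult_left_mono)
qed

lemma integrable_quad_cutoff: "integrable N quad_cutoff"
proof (rule integrable_N[of _ 1])
  show "quad_cutoff \<in> borel_measurable borel"
    by (intro borel_measurable_continuous_onI Cc_infinity_continuous quad_cutoff_Cc_infinity)
  fix y :: "real^'n"
  show "\<bar>quad_cutoff y\<bar> \<le> 1 * min 1 ((norm y)\<^sup>2)"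
  proof (cases "norm y \<le> 1")
    case True
    then have "(norm y)\<^sup>2 \<le> 1" by (simp add: power_le_one)
    then show ?thesis using cutoff_bounds[of y] by (simp add: quad_cutoff_def abs_mult mult_left_le)
  next
    case False
    then show ?thesis by (simp add: quad_cutoff_def cutoff_eq)
  qed
qed

lemma integral_quad_cutoff: "0 \<le> integral\<^sup>L N quad_cutoff" "integral\<^sup>L N quad_cutoff \<le> L quad_cutoff"
proof -
  show "0 \<le> integral\<^sup>L N quad_cutoff" by (intro integral_nonneg_AE) (simp add: quad_cutoff_nonneg)
  show "integral\<^sup>L N quad_cutoff \<le> L quad_cutoff"
    using nn_integral_le_functional[OF quad_cutoff_Cc_infinity quad_cutoff_nonneg quad_cutoff_0]
      integrable_quad_cutoff L_quad_cutoff_nonneg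
    by (subst integral_eq_nn_integral) (auto intro!: enn2real_leI simp: quad_cutoff_nonneg)
qed

text \<open>Split \<open>R\<close> with a narrow bump. The outer piece has annular support, so
  \<open>L\<close> and the integral agree on it; the inner piece \<open>S\<close> satisfies
  \<open>|S| \<le> e quad_cutoff\<close>, so both its image under \<open>L\<close> and its integral
  are at most \<open>e (L quad_cutoff)\<close>. Then \<open>e\<close> tends to 0.\<close>

lemma functional_eq_integral:
  assumes R: "R \<in> Cc_infinity"
    and small: "\<And>e. e > 0 \<Longrightarrow> \<exists>d>0. \<forall>y. norm y < d \<longrightarrow> \<bar>R y\<bar> \<le> e * (norm y)\<^sup>2"
  shows "integrable N R" "integral\<^sup>L N R = L R"
proof -
  have meas: "f \<in> borel_measurable borel" if "f \<in> Cc_infinity" for f :: "real^'n \<Rightarrow> real"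
    by (intro borel_measurable_continuous_onI Cc_infinity_continuous that)
  obtain M where M: "M > 0" "\<And>y. \<bar>R y\<bar> \<le> M" using Cc_infinity_bounded[OF R] by blast
  obtain d0 where d0: "d0 > 0" "\<And>y. norm y < d0 \<Longrightarrow> \<bar>R y\<bar> \<le> 1 * (norm y)\<^sup>2"
    using small[of 1] by auto
  \<comment> \<open>The three entries serve \<open>|y| < d0\<close>, the global bound
    \<open>M\<close>, and the comparison of \<open>M\<close> with \<open>|y|^2\<close> for
    \<open>|y| \<ge> d0\<close>.\<close>
  define C where "C = max (max 1 M) (M / d0\<^sup>2)"
  have C: "1 \<le> C" "M \<le> C" "M / d0\<^sup>2 \<le> C" by (auto simp: C_def)
  have bound: "\<bar>R y\<bar> \<le> C * min 1 ((norm y)\<^sup>2)" for y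
  proof -
    have "\<bar>R y\<bar> \<le> C * (norm y)\<^sup>2"
    proof (cases "norm y < d0")
      case True
      have "1 * (norm y)\<^sup>2 \<le> C * (norm y)\<^sup>2" using C by (intro mult_right_mono) auto
      then show ?thesis using d0(2)[OF True] by linarith
    next
      case False
      then have "d0\<^sup>2 \<le> (norm y)\<^sup>2" using d0(1) by (intro power_mono) auto
      have "\<bar>R y\<bar> \<le> M / d0\<^sup>2 * d0\<^sup>2" using M(2)[of y] d0(1) by simp
      also have "\<dots> \<le> C * (norm y)\<^sup>2"
        using C \<open>d0\<^sup>2 \<le> (norm y)\<^sup>2\<close> by (intro mult_mono) auto
      finally show ?thesis .
    qed
    moreover have "\<bar>R y\<bar> \<le> C * 1" using M(2)[of y] C by simp
    ultimately show ?thesis by (simp add: min_def)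
  qed
  show int: "integrable N R" by (rule integrable_N[OF meas[OF R] bound])
  have le: "\<bar>L R - integral\<^sup>L N R\<bar> \<le> e * (2 * L quad_cutoff)" if e: "e > 0" for e
  proof -
    obtain d where d: "d > 0" "\<And>y. norm y < d \<Longrightarrow> \<bar>R y\<bar> \<le> e * (norm y)\<^sup>2"
      using small[OF e] by auto
    \<comment> \<open>At most \<open>1/2\<close>, so that \<open>quad_cutoff y\<close> equals
      \<open>|y|^2\<close> wherever \<open>S\<close> can be nonzero.\<close>
    define r where "r = min d (1/2)"
    have r: "r > 0" "r \<le> d" "r \<le> 1/2" using d by (auto simp: r_def)
    define S where "S y = R y * bump r y" for y
    have S: "S \<in> Cc_infinity"
      unfolding S_def by (intro Cc_infinity_mult bump_Cc_infinity r Cc_infinityD(1)[OF R])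
    have Sb: "\<bar>S y\<bar> \<le> e * quad_cutoff y" for y
    proof (cases "norm y < r")
      case True
      have "\<bar>S y\<bar> \<le> \<bar>R y\<bar>" using bump_bounds[of r y] by (simp add: S_def abs_mult mult_left_le)
      also have "\<dots> \<le> e * (norm y)\<^sup>2" using True r by (intro d) auto
      finally show ?thesis using True r by (simp add: quad_cutoff_def cutoff_eq)
    next
      case False
      then show ?thesis using r e cutoff_bounds[of y] by (simp add: S_def bump_eq_0 quad_cutoff_def)
    qed
    have Tn: "annular {y. R y - S y \<noteq> 0}"
    proof -
      obtain P where P: "\<forall>y. norm y > P \<longrightarrow> R y = 0" using Cc_infinityD(2)[OF R] by blast
      show ?thesis
      proof (rule annularI[of "r / 2" _ P])
        fix y assume "y \<in> {y. R y - S y \<noteq> 0}"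
        then have "bump r y \<noteq> 1" "R y \<noteq> 0" by (auto simp: S_def)
        then show "r / 2 \<le> norm y" "norm y \<le> P" using bump_eq_1[OF r(1), of y] P by force+
      qed (use r in simp)
    qed
    have T: "(\<lambda>y. R y - S y) \<in> Cc_infinity" by (rule function_space_diff[OF function_space_Cc_infinity R S])
    have intS: "integrable N S"
      by (rule Bochner_Integration.integrable_bound[OF int measurable_N[OF meas[OF S]]])
         (simp add: S_def abs_mult mult_left_le bump_bounds)
    have "L R - L S = integral\<^sup>L N R - integral\<^sup>L N S"
      using represents(2)[OF T Tn] diff[OF R S] Bochner_Integration.integral_diff[OF int intS] by simp
    moreover have "\<bar>L S\<bar> \<le> e * L quad_cutoff"
    proof -
      have "\<bar>L S\<bar> \<le> L (\<lambda>y. e * quad_cutoff y)"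
        by (rule abs_le_of_zero[OF S function_spaceD(3)[OF function_space_Cc_infinity quad_cutoff_Cc_infinity] Sb])
           (simp add: quad_cutoff_def)
      then show ?thesis using scale[OF quad_cutoff_Cc_infinity] by simp
    qed
    moreover have "\<bar>integral\<^sup>L N S\<bar> \<le> e * L quad_cutoff"
    proof -
      have "\<bar>integral\<^sup>L N S\<bar> \<le> integral\<^sup>L N (\<lambda>y. \<bar>S y\<bar>)" by (rule integral_abs_bound)
      also have "\<dots> \<le> integral\<^sup>L N (\<lambda>y. e * quad_cutoff y)"
        using intS integrable_quad_cutoff Sb by (intro integral_mono) auto
      also have "\<dots> \<le> e * L quad_cutoff" using integral_quad_cutoff(2) e by simp
      finally show ?thesis .
    qed
    ultimately show ?thesis by (simp add: abs_le_iff)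
  qed
  have "\<bar>L R - integral\<^sup>L N R\<bar> \<le> 0"
  proof (rule field_le_epsilon)
    fix e :: real assume "e > 0"
    \<comment> \<open>The summand 1 keeps the divisor positive when \<open>L quad_cutoff\<close> is
      0.\<close>
    define q where "q = 2 * L quad_cutoff + 1"
    have q: "q > 0" "2 * L quad_cutoff \<le> q" using L_quad_cutoff_nonneg by (auto simp: q_def)
    have "e / q * (2 * L quad_cutoff) \<le> e / q * q" using \<open>e > 0\<close> q by (intro mult_left_mono) auto
    then show "\<bar>L R - integral\<^sup>L N R\<bar> \<le> 0 + e" using le[of "e / q"] \<open>e > 0\<close> q by simp
  qed
  then show "integral\<^sup>L N R = L R" by simp
qed

end

section \<open>The Courrege representation\<close>

context pmp_levy
begin

text \<open>Formally \<open>- L 1\<close>: the constant is split into \<open>cutoff\<close>, where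
  \<open>L\<close> is defined, and \<open>1 - cutoff\<close>, which vanishes near 0 and is evaluated
  by \<open>N\<close>.\<close>

definition killing :: real where
  "killing = - L cutoff - (\<integral>y. 1 - cutoff y \<partial>N)"

text \<open>The integral converts the smooth compensator \<open>cutoff\<close> into the indicator of
  the open unit ball that the operator uses.\<close>

definition drift :: "real^'n" where
  "drift = (\<chi> i. L (\<lambda>y. y $ i * cutoff y) +
    (\<integral>y. y $ i * (indicator {0<..<1} (norm y) - cutoff y) \<partial>N))"

text \<open>The part of \<open>L\<close> on second-order monomials that is concentrated at the
  origin: what remains after the jumps have been subtracted.\<close>

definition diffusion :: "real^'n^'n" where
  "diffusion = (\<chi> i j. L (\<lambda>y. (y $ i * y $ j) * cutoff y) - (\<integral>y. (y $ i * y $ j) * cutoff y \<partial>N))"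

lemma Cc_infinity_measurable: "f \<in> Cc_infinity \<Longrightarrow> f \<in> borel_measurable borel"
  by (intro borel_measurable_continuous_onI Cc_infinity_continuous)

text \<open>Source of the constant 4 below: \<open>1 - cutoff\<close> vanishes for
  \<open>|y| \<le> 1/2\<close>, and outside that ball \<open>min 1 (|y|^2)\<close> is at least
  \<open>1/4\<close>.\<close>

lemma min_ge_quarter: "1/2 \<le> norm y \<Longrightarrow> 1 \<le> 4 * min 1 ((norm y)\<^sup>2)"
  using power_mono[of "1/2" "norm y" 2] by (simp add: min_def power2_eq_square)

lemma one_minus_cutoff_bound: "\<bar>1 - cutoff y\<bar> \<le> 4 * min 1 ((norm y)\<^sup>2)"
proof (cases "norm y \<le> 1/2")
  case False
  then show ?thesis using min_ge_quarter[of y] cutoff_bounds[of y] by simp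
qed (simp add: cutoff_eq)

text \<open>Indicator and cutoff differ only on \<open>1/2 < |y| < 1\<close> and at the origin,
  where the coordinate factor is 0.\<close>

lemma coord_indicator_minus_cutoff_bound:
  "\<bar>y $ i * (indicator {0<..<1} (norm y) - cutoff y)\<bar> \<le> 4 * min 1 ((norm y)\<^sup>2)"
proof -
  consider "y = 0" | "y \<noteq> 0" "norm y \<le> 1/2" | "1/2 < norm y" "norm y < 1" | "1 \<le> norm y" by linarith
  then show ?thesis
  proof cases
    case 3
    then have "indicat_real {0<..<1} (norm y) = 1" by (auto simp: indicator_def)
    then have "\<bar>indicat_real {0<..<1} (norm y) - cutoff y\<bar> \<le> 1" using cutoff_bounds[of y] by simp
    moreover have "\<bar>y $ i\<bar> \<le> 1" using component_le_norm_cart[of y i] 3 by linarith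
    ultimately have "\<bar>y $ i * (indicator {0<..<1} (norm y) - cutoff y)\<bar> \<le> 1"
      unfolding abs_mult by (intro mult_le_one) auto
    then show ?thesis using min_ge_quarter[of y] 3 by linarith
  qed (auto simp: cutoff_eq)
qed

lemma coord_coord_cutoff_bound: "\<bar>(y $ i * y $ j) * cutoff y\<bar> \<le> 1 * min 1 ((norm y)\<^sup>2)"
proof (cases "norm y \<le> 1")
  case True
  have "\<bar>y $ i * y $ j\<bar> \<le> norm y * norm y"
    unfolding abs_mult by (intro mult_mono component_le_norm_cart) auto
  moreover have "\<bar>(y $ i * y $ j) * cutoff y\<bar> \<le> \<bar>y $ i * y $ j\<bar>"
    using cutoff_bounds[of y] by (simp add: abs_mult[of _ "cutoff y"] mult_left_le)
  moreover have "(norm y)\<^sup>2 \<le> 1" using True by (simp add: power_le_one)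
  ultimately show ?thesis by (simp add: power2_eq_square)
qed (simp add: cutoff_eq)

lemma measurable_parts:
  "(\<lambda>y::real^'n. 1 - cutoff y) \<in> borel_measurable borel"
  "(\<lambda>y::real^'n. y $ i * (indicator {0<..<1} (norm y) - cutoff y)) \<in> borel_measurable borel"
proof -
  have c: "cutoff \<in> borel_measurable borel" by (rule Cc_infinity_measurable[OF cutoff_Cc_infinity])
  show "(\<lambda>y::real^'n. 1 - cutoff y) \<in> borel_measurable borel"
    by (intro borel_measurable_diff borel_measurable_const c)
  have n: "(\<lambda>y::real^'n. y $ i) \<in> borel_measurable borel"
    by (intro borel_measurable_continuous_onI linear_continuous_on bounded_linear_vec_nth)
  have "(\<lambda>y::real^'n. indicat_real {0<..<1} (norm y)) \<in> borel_measurable borel"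
    by (rule measurable_compose[of norm borel borel]) simp_all
  then show "(\<lambda>y::real^'n. y $ i * (indicator {0<..<1} (norm y) - cutoff y)) \<in> borel_measurable borel"
    by (intro borel_measurable_times borel_measurable_diff c n)
qed

lemmas integrable_parts =
  integrable_N[OF measurable_parts(1) one_minus_cutoff_bound]
  integrable_N[OF measurable_parts(2) coord_indicator_minus_cutoff_bound]
  integrable_N[OF Cc_infinity_measurable[OF coord_cutoff_Cc_infinity(2)] coord_coord_cutoff_bound]

lemma killing_bounds: "0 \<le> killing" "killing \<le> \<bar>L cutoff\<bar>"
proof -
  have nn: "0 \<le> 1 - cutoff y" for y :: "real^'n" using cutoff_bounds[of y] by simp
  have "(\<integral>y. 1 - cutoff y \<partial>N) \<le> - L cutoff"
    using nn_integral_one_minus_cutoff L_cutoff_nonpos nn integrable_parts(1)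
    by (subst integral_eq_nn_integral) (auto intro!: enn2real_leI)
  then show "0 \<le> killing" by (simp add: killing_def)
  have "0 \<le> (\<integral>y. 1 - cutoff y \<partial>N)" by (intro integral_nonneg_AE AE_I2 nn)
  then show "killing \<le> \<bar>L cutoff\<bar>" by (simp add: killing_def)
qed

lemma L_double_sum:
  "L (\<lambda>y. \<Sum>i\<in>UNIV. \<Sum>j\<in>UNIV. a i j * ((y $ i * y $ j) * cutoff y)) =
    (\<Sum>i\<in>UNIV. \<Sum>j\<in>UNIV. a i j * L (\<lambda>y. (y $ i * y $ j) * cutoff y))"
    "(\<lambda>y. \<Sum>i\<in>UNIV. \<Sum>j\<in>UNIV. a i j * ((y $ i * y $ j) * cutoff y)) \<in> Cc_infinity"
proof -
  have 1: "(\<lambda>y. a i j * ((y $ i * y $ j) * cutoff y)) \<in> Cc_infinity" for i j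
    by (rule function_spaceD(3)[OF function_space_Cc_infinity coord_cutoff_Cc_infinity(2)])
  have 2: "(\<lambda>y. \<Sum>j\<in>UNIV. a i j * ((y $ i * y $ j) * cutoff y)) \<in> Cc_infinity" for i
    by (rule function_space_sum[OF function_space_Cc_infinity 1])
  show "(\<lambda>y. \<Sum>i\<in>UNIV. \<Sum>j\<in>UNIV. a i j * ((y $ i * y $ j) * cutoff y)) \<in> Cc_infinity"
    by (rule function_space_sum[OF function_space_Cc_infinity 2])
  have "L (\<lambda>y. \<Sum>i\<in>UNIV. \<Sum>j\<in>UNIV. a i j * ((y $ i * y $ j) * cutoff y)) =
      (\<Sum>i\<in>UNIV. L (\<lambda>y. \<Sum>j\<in>UNIV. a i j * ((y $ i * y $ j) * cutoff y)))"
    by (rule sum[OF 2])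
  also have "\<dots> = (\<Sum>i\<in>UNIV. \<Sum>j\<in>UNIV. L (\<lambda>y. a i j * ((y $ i * y $ j) * cutoff y)))"
    by (intro sum.cong refl sum[OF 1])
  also have "\<dots> = (\<Sum>i\<in>UNIV. \<Sum>j\<in>UNIV. a i j * L (\<lambda>y. (y $ i * y $ j) * cutoff y))"
    by (intro sum.cong refl scale[OF coord_cutoff_Cc_infinity(2)])
  finally show "L (\<lambda>y. \<Sum>i\<in>UNIV. \<Sum>j\<in>UNIV. a i j * ((y $ i * y $ j) * cutoff y)) =
    (\<Sum>i\<in>UNIV. \<Sum>j\<in>UNIV. a i j * L (\<lambda>y. (y $ i * y $ j) * cutoff y))" .
qed

lemma integral_double_sum:
  "integrable N (\<lambda>y. \<Sum>i\<in>UNIV. \<Sum>j\<in>UNIV. a i j * ((y $ i * y $ j) * cutoff y))"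
  "(\<integral>y. (\<Sum>i\<in>UNIV. \<Sum>j\<in>UNIV. a i j * ((y $ i * y $ j) * cutoff y)) \<partial>N) =
    (\<Sum>i\<in>UNIV. \<Sum>j\<in>UNIV. a i j * (\<integral>y. (y $ i * y $ j) * cutoff y \<partial>N))"
  using integrable_parts(3) by (simp_all add: Bochner_Integration.integral_sum)

text \<open>The quadratic form at \<open>v\<close> is \<open>L g\<close> minus the integral of
  \<open>g\<close> for \<open>g y = (v \<bullet> y)^2 cutoff y\<close>, which is nonnegative and
  vanishes at 0.\<close>

lemma diffusion_psd: "positive_semidefinite diffusion"
proof -
  have "0 \<le> v \<bullet> (diffusion *v v)" for v
  proof -
    define g where "g y = (\<Sum>i\<in>UNIV. \<Sum>j\<in>UNIV. (v $ i * v $ j) * ((y $ i * y $ j) * cutoff y))" for y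
    have g_sq: "g y = (v \<bullet> y)\<^sup>2 * cutoff y" for y
    proof -
      have "(v \<bullet> y)\<^sup>2 = (\<Sum>i\<in>UNIV. \<Sum>j\<in>UNIV. (v $ i * y $ i) * (v $ j * y $ j))"
        by (simp add: inner_vec_def power2_eq_square sum_product)
      then show ?thesis by (simp add: g_def sum_distrib_right sum_distrib_left mult_ac)
    qed
    have gCc: "g \<in> Cc_infinity" unfolding g_def by (rule L_double_sum(2))
    have nn: "0 \<le> g y" for y unfolding g_sq using cutoff_bounds[of y] by simp
    have g0: "g 0 = 0" by (simp add: g_sq)
    have int: "integrable N g" unfolding g_def by (rule integral_double_sum(1))
    have "integral\<^sup>L N g \<le> L g"
      using nn_integral_le_functional[OF gCc nn g0] int nn nonneg_of_zero[OF gCc nn g0]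
      by (subst integral_eq_nn_integral) (auto intro!: enn2real_leI)
    also have "L g = (\<Sum>i\<in>UNIV. \<Sum>j\<in>UNIV. (v $ i * v $ j) * L (\<lambda>y. (y $ i * y $ j) * cutoff y))"
      unfolding g_def by (rule L_double_sum(1))
    also have "integral\<^sup>L N g = (\<Sum>i\<in>UNIV. \<Sum>j\<in>UNIV. (v $ i * v $ j) * (\<integral>y. (y $ i * y $ j) * cutoff y \<partial>N))"
      unfolding g_def by (rule integral_double_sum(2))
    finally have "0 \<le> (\<Sum>i\<in>UNIV. \<Sum>j\<in>UNIV. (v $ i * v $ j) * diffusion $ i $ j)"
      by (simp add: diffusion_def right_diff_distrib sum_subtractf)
    also have "\<dots> = v \<bullet> (diffusion *v v)"
      by (simp add: inner_vec_def matrix_vector_mult_def sum_distrib_left mult_ac)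
    finally show ?thesis .
  qed
  moreover have "transpose diffusion = diffusion"
    by (simp add: transpose_def diffusion_def vec_eq_iff mult.commute)
  ultimately show ?thesis by (simp add: positive_semidefinite_def)
qed

lemma characteristics_N: "characteristics killing drift diffusion N"
proof -
  have "(\<integral>\<^sup>+ y. ennreal (min 1 ((norm y)\<^sup>2)) \<partial>N) < \<infinity>"
    using nn_integral_min by (rule order.strict_trans1) simp
  then show ?thesis
    by (simp add: characteristics_def killing_bounds diffusion_psd sets_N)
qed

text \<open>\<open>P\<close> and \<open>T\<close> are the cut-off Taylor terms of order at most one
  and of order two. The functional equals the integral on the remainder \<open>R\<close>; the defect
  on \<open>T\<close> is half the trace term, and the defect on \<open>P\<close>, once
  \<open>cutoff\<close> is exchanged for the constant and for the indicator, gives killing and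
  drift.\<close>

lemma levy_representation:
  assumes f: "f \<in> Cc_infinity"
  shows "L f = levy_type_operator killing drift diffusion N f 0"
proof -
  define g where "g = gradient f 0"
  define H where "H = hessian f 0"
  define P where "P y = f 0 * cutoff y + (\<Sum>i\<in>UNIV. g $ i * (y $ i * cutoff y))" for y
  define T where "T y = (\<Sum>i\<in>UNIV. \<Sum>j\<in>UNIV. (H $ i $ j / 2) * ((y $ i * y $ j) * cutoff y))" for y
  define R where "R y = f y - P y - T y" for y
  have P1: "(\<lambda>y. f 0 * cutoff y) \<in> Cc_infinity"
    by (rule function_spaceD(3)[OF function_space_Cc_infinity cutoff_Cc_infinity])
  have P2: "(\<lambda>y. g $ i * (y $ i * cutoff y)) \<in> Cc_infinity" for i
    by (rule function_spaceD(3)[OF function_space_Cc_infinity coord_cutoff_Cc_infinity(1)])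
  have P3: "(\<lambda>y. \<Sum>i\<in>UNIV. g $ i * (y $ i * cutoff y)) \<in> Cc_infinity"
    by (rule function_space_sum[OF function_space_Cc_infinity P2])
  have P: "P \<in> Cc_infinity" unfolding P_def by (rule function_spaceD(2)[OF function_space_Cc_infinity P1 P3])
  have T: "T \<in> Cc_infinity" unfolding T_def by (rule L_double_sum(2))
  have fP: "(\<lambda>y. f y - P y) \<in> Cc_infinity" by (rule function_space_diff[OF function_space_Cc_infinity f P])
  have R: "R \<in> Cc_infinity" unfolding R_def by (rule function_space_diff[OF function_space_Cc_infinity fP T])
  have LP: "L P = f 0 * L cutoff + (\<Sum>i\<in>UNIV. g $ i * L (\<lambda>y. y $ i * cutoff y))"
    unfolding P_def add[OF P1 P3] scale[OF cutoff_Cc_infinity] sum[OF P2] scale[OF coord_cutoff_Cc_infinity(1)] ..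
  have LT: "L T = (\<Sum>i\<in>UNIV. \<Sum>j\<in>UNIV. (H $ i $ j / 2) * L (\<lambda>y. (y $ i * y $ j) * cutoff y))"
    unfolding T_def by (rule L_double_sum(1))
  have LR: "L R = L f - L P - L T"
    unfolding R_def diff[OF fP T] diff[OF f P] ..
  have small: "\<exists>d>0. \<forall>y. norm y < d \<longrightarrow> \<bar>R y\<bar> \<le> e * (norm y)\<^sup>2" if e: "e > 0" for e
  proof -
    obtain d where d: "d > 0"
      "\<And>y. norm y < d \<Longrightarrow> \<bar>f y - f 0 - y \<bullet> gradient f 0 -
         1/2 * (\<Sum>i\<in>UNIV. \<Sum>j\<in>UNIV. hessian f 0 $ i $ j * (y $ i * y $ j))\<bar> \<le> e * (norm y)\<^sup>2"
      using taylor_second_order[OF Cc_infinityD(1)[OF f] e] by blast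
    have "\<bar>R y\<bar> \<le> e * (norm y)\<^sup>2" if y: "norm y < min d (1/2)" for y
    proof -
      have "cutoff y = 1" using y by (intro cutoff_eq) simp
      then have "R y = f y - f 0 - y \<bullet> gradient f 0 -
         1/2 * (\<Sum>i\<in>UNIV. \<Sum>j\<in>UNIV. hessian f 0 $ i $ j * (y $ i * y $ j))"
        by (simp add: R_def P_def T_def g_def H_def inner_vec_def mult.commute sum_divide_distrib)
      then show ?thesis using d(2)[of y] y by simp
    qed
    then show ?thesis using d(1) by (intro exI[of _ "min d (1/2)"]) auto
  qed
  have intR: "integrable N R" by (rule functional_eq_integral(1)[OF R small])
  have IR: "integral\<^sup>L N R = L R" by (rule functional_eq_integral(2)[OF R small])
  have intT: "integrable N T" unfolding T_def by (rule integral_double_sum(1))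
  have IT: "integral\<^sup>L N T = (\<Sum>i\<in>UNIV. \<Sum>j\<in>UNIV. (H $ i $ j / 2) * (\<integral>y. (y $ i * y $ j) * cutoff y \<partial>N))"
    unfolding T_def by (rule integral_double_sum(2))
  \<comment> \<open>\<open>f\<close> and \<open>P\<close> need not be integrable separately near 0,
    but \<open>R\<close> and \<open>T\<close> are, so their difference is handled as
    \<open>R + T\<close>.\<close>
  have fP_eq: "(\<lambda>y. f y - P y) = (\<lambda>y. R y + T y)" by (simp add: R_def)
  have IfP: "(\<integral>y. f y - P y \<partial>N) = integral\<^sup>L N R + integral\<^sup>L N T"
    unfolding fP_eq by (rule Bochner_Integration.integral_add[OF intR intT])
  have Ilev: "(\<integral>y. f y - f 0 - (y \<bullet> g) * indicator {0<..<1} (norm y) \<partial>N) =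
      (\<integral>y. f y - P y \<partial>N) - f 0 * (\<integral>y. 1 - cutoff y \<partial>N) -
      (\<Sum>i\<in>UNIV. g $ i * (\<integral>y. y $ i * (indicator {0<..<1} (norm y) - cutoff y) \<partial>N))"
  proof -
    have intfP: "integrable N (\<lambda>y. f y - P y)"
      unfolding fP_eq by (rule Bochner_Integration.integrable_add[OF intR intT])
    have i1: "integrable N (\<lambda>y. f 0 * (1 - cutoff y))"
      by (rule integrable_mult_right[OF integrable_parts(1)])
    have i2: "integrable N (\<lambda>y. g $ i * (y $ i * (indicator {0<..<1} (norm y) - cutoff y)))" for i
      by (rule integrable_mult_right[OF integrable_parts(2)])
    \<comment> \<open>The Levy integrand is \<open>f - P\<close> corrected by terms that vanish near
      0, and each of the three groups is integrable.\<close>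
    have e0: "(\<lambda>y. f y - f 0 - (y \<bullet> g) * indicator {0<..<1} (norm y)) =
        (\<lambda>y. (f y - P y) - f 0 * (1 - cutoff y) -
          (\<Sum>i\<in>UNIV. g $ i * (y $ i * (indicator {0<..<1} (norm y) - cutoff y))))"
      by (simp add: P_def fun_eq_iff inner_vec_def algebra_simps sum_subtractf sum_distrib_left)
    have e1: "(\<integral>y. (f y - P y) - f 0 * (1 - cutoff y) -
          (\<Sum>i\<in>UNIV. g $ i * (y $ i * (indicator {0<..<1} (norm y) - cutoff y))) \<partial>N) =
        (\<integral>y. (f y - P y) - f 0 * (1 - cutoff y) \<partial>N) -
        (\<integral>y. (\<Sum>i\<in>UNIV. g $ i * (y $ i * (indicator {0<..<1} (norm y) - cutoff y))) \<partial>N)"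
      by (rule Bochner_Integration.integral_diff[OF Bochner_Integration.integrable_diff[OF intfP i1]
          Bochner_Integration.integrable_sum[OF i2]])
    have e2: "(\<integral>y. (f y - P y) - f 0 * (1 - cutoff y) \<partial>N) = (\<integral>y. f y - P y \<partial>N) - (\<integral>y. f 0 * (1 - cutoff y) \<partial>N)"
      by (rule Bochner_Integration.integral_diff[OF intfP i1])
    have e3: "(\<integral>y. (\<Sum>i\<in>UNIV. g $ i * (y $ i * (indicator {0<..<1} (norm y) - cutoff y))) \<partial>N) =
        (\<Sum>i\<in>UNIV. (\<integral>y. g $ i * (y $ i * (indicator {0<..<1} (norm y) - cutoff y)) \<partial>N))"
      by (rule Bochner_Integration.integral_sum[OF i2])
    show ?thesis unfolding e0 e1 e2 e3 by simp
  qed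
  have "drift \<bullet> g = (\<Sum>i\<in>UNIV. g $ i * L (\<lambda>y. y $ i * cutoff y)) +
      (\<Sum>i\<in>UNIV. g $ i * (\<integral>y. y $ i * (indicator {0<..<1} (norm y) - cutoff y) \<partial>N))"
    unfolding sum.distrib[symmetric] inner_vec_def
    by (intro sum.cong refl) (simp add: drift_def distrib_left mult.commute)
  moreover have "1/2 * trace (diffusion ** H) =
      (\<Sum>i\<in>UNIV. \<Sum>j\<in>UNIV. (H $ i $ j / 2) * L (\<lambda>y. (y $ i * y $ j) * cutoff y)) -
      (\<Sum>i\<in>UNIV. \<Sum>j\<in>UNIV. (H $ i $ j / 2) * (\<integral>y. (y $ i * y $ j) * cutoff y \<partial>N))"
  proof -
    \<comment> \<open>The trace pairs transposed entries of the two matrices; symmetry of the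
      diffusion aligns them with the sum in \<open>T\<close>.\<close>
    have sym: "diffusion $ j $ i = diffusion $ i $ j" for i j by (simp add: diffusion_def mult.commute)
    have "1/2 * trace (diffusion ** H) = (\<Sum>j\<in>UNIV. \<Sum>i\<in>UNIV. H $ i $ j / 2 * diffusion $ i $ j)"
      unfolding trace_def matrix_matrix_mult_def sum_distrib_left
      by (simp add: sum_distrib_left sym[of _ "_ :: 'n"] mult_ac)
    also have "\<dots> = (\<Sum>i\<in>UNIV. \<Sum>j\<in>UNIV. H $ i $ j / 2 * diffusion $ i $ j)" by (rule sum.swap)
    finally show ?thesis
      by (simp add: diffusion_def right_diff_distrib sum_subtractf)
  qed
  moreover have "- killing * f 0 = f 0 * L cutoff + f 0 * (\<integral>y. 1 - cutoff y \<partial>N)"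
    by (simp add: killing_def algebra_simps)
  ultimately show ?thesis
    unfolding levy_type_operator_def g_def[symmetric] H_def[symmetric] add_0_left
    using LP LT LR IR IT IfP Ilev by linarith
qed

text \<open>\<open>quad_cutoff\<close> is a sum of \<open>n\<close> diagonal monomials, so the mass
  is at most \<open>(1 + n) B\<close>. Each entry of drift and diffusion is then at most
  \<open>M = B + 4 (1 + n) B\<close>, the 4 being the compensator constant. The factor
  \<open>n + n * n + 1\<close> counts drift entries, diffusion entries and the mass; the leading
  \<open>B\<close> bounds the killing.\<close>

lemma characteristics_bound:
  assumes "\<bar>L cutoff\<bar> \<le> B" "\<And>i. \<bar>L (\<lambda>y. y $ i * cutoff y)\<bar> \<le> B"
    "\<And>i j. \<bar>L (\<lambda>y. (y $ i * y $ j) * cutoff y)\<bar> \<le> B"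
  defines "n \<equiv> real CARD('n)"
  shows "ennreal (\<bar>killing\<bar> + norm drift + norm diffusion) +
      (\<integral>\<^sup>+ y. ennreal (min 1 ((norm y)\<^sup>2)) \<partial>N) \<le> ennreal (B + (n + n * n + 1) * (B + 4 * ((1 + n) * B)))"
proof -
  have B: "0 \<le> B" using assms(1) by linarith
  define M where "M = B + 4 * ((1 + n) * B)"
  have mass_bound: "mass_bound \<le> (1 + n) * B"
  proof -
    have "L quad_cutoff = (\<Sum>i\<in>UNIV. L (\<lambda>y. (y $ i * y $ i) * cutoff y))"
      unfolding quad_cutoff_eq by (rule sum[OF coord_cutoff_Cc_infinity(2)])
    also have "\<dots> \<le> (\<Sum>i\<in>(UNIV :: 'n set). B)"
      by (intro sum_mono order_trans[OF abs_ge_self assms(3)])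
    also have "\<dots> = n * B" by (simp add: n_def)
    finally show ?thesis using assms(1) by (simp add: mass_bound_def algebra_simps)
  qed
  have KM: "B + 4 * mass_bound \<le> M" "mass_bound \<le> M" using mass_bound mass_bound_nonneg B by (auto simp: M_def)
  have "\<bar>drift $ i\<bar> \<le> M" for i
  proof -
    have "\<bar>\<integral>y. y $ i * (indicator {0<..<1} (norm y) - cutoff y) \<partial>N\<bar> \<le> 4 * mass_bound"
      by (rule abs_integral_le[OF measurable_parts(2) coord_indicator_minus_cutoff_bound]) simp
    then show ?thesis using assms(2)[of i] KM by (simp add: drift_def)
  qed
  then have "norm drift \<le> n * M"
    using order_trans[OF norm_le_l1_cart sum_mono, of drift "\<lambda>_. M"] by (simp add: n_def)
  moreover have D: "\<bar>diffusion $ i $ j\<bar> \<le> M" for i j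
  proof -
    have "\<bar>\<integral>y. (y $ i * y $ j) * cutoff y \<partial>N\<bar> \<le> 1 * mass_bound"
      by (rule abs_integral_le[OF Cc_infinity_measurable[OF coord_cutoff_Cc_infinity(2)] coord_coord_cutoff_bound]) simp
    then show ?thesis using assms(3)[of i j] KM mass_bound_nonneg by (simp add: diffusion_def)
  qed
  have "norm (diffusion $ i) \<le> n * M" for i
    using order_trans[OF norm_le_l1_cart sum_mono, of "diffusion $ i" "\<lambda>_. M"] D by (simp add: n_def)
  then have "(\<Sum>i\<in>UNIV. norm (diffusion $ i)) \<le> (\<Sum>i\<in>(UNIV :: 'n set). n * M)" by (intro sum_mono)
  then have "norm diffusion \<le> n * (n * M)"
    using L2_set_le_sum[of UNIV "\<lambda>i. norm (diffusion $ i)"] by (simp add: norm_vec_def n_def)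
  moreover have "\<bar>killing\<bar> \<le> B" using killing_bounds assms(1) by simp
  ultimately have "\<bar>killing\<bar> + norm drift + norm diffusion + mass_bound \<le> B + (n + n * n + 1) * M"
    using KM by (simp add: algebra_simps)
  then have "ennreal (\<bar>killing\<bar> + norm drift + norm diffusion) + ennreal mass_bound \<le> ennreal (B + (n + n * n + 1) * M)"
    using mass_bound_nonneg by (simp add: ennreal_plus[symmetric] ennreal_leI del: ennreal_plus)
  then show ?thesis
    unfolding M_def by (rule order_trans[OF add_left_mono[OF nn_integral_min]])
qed

end

text \<open>The last clause holds for every \<open>B\<close> and its right side mentions
  \<open>L\<close> only through \<open>B\<close>; one \<open>B\<close> valid for all functionals
  below \<open>p\<close> therefore bounds all their characteristics.\<close>

theorem courrege:
  fixes L :: "(real^'n \<Rightarrow> real) \<Rightarrow> real"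
  assumes "pmp_functional L"
  obtains c b Q N where "characteristics c b Q N"
    "\<And>f. f \<in> Cc_infinity \<Longrightarrow> L f = levy_type_operator c b Q N f 0"
    "\<And>B. \<bar>L cutoff\<bar> \<le> B \<Longrightarrow> (\<And>i. \<bar>L (\<lambda>y. y $ i * cutoff y)\<bar> \<le> B) \<Longrightarrow>
      (\<And>i j. \<bar>L (\<lambda>y. (y $ i * y $ j) * cutoff y)\<bar> \<le> B) \<Longrightarrow>
      ennreal (\<bar>c\<bar> + norm b + norm Q) + (\<integral>\<^sup>+ y. ennreal (min 1 ((norm y)\<^sup>2)) \<partial>N)
      \<le> ennreal (B + (real CARD('n) + real CARD('n) * real CARD('n) + 1) * (B + 4 * ((1 + real CARD('n)) * B)))"
proof -
  interpret pmp_functional L by fact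
  show ?thesis
  proof (rule levy_measure_exists)
    fix N assume N: "sets N = sets (restrict_space borel (- {0}))"
      "\<And>h. h \<in> Cc_infinity \<Longrightarrow> annular {y. h y \<noteq> 0} \<Longrightarrow> integrable N h"
      "\<And>h. h \<in> Cc_infinity \<Longrightarrow> annular {y. h y \<noteq> 0} \<Longrightarrow> integral\<^sup>L N h = L h"
    interpret pmp_levy L N by unfold_locales (fact N)+
    show ?thesis
      by (rule that[OF characteristics_N levy_representation characteristics_bound])
  qed
qed

section \<open>Supremum representation of the sublinear operator\<close>

lemma gradient_shift:
  assumes "\<And>z. f differentiable (at z)"
  shows "gradient (\<lambda>y. f (x + y)) z = gradient f (x + z)"
  using frechet_derivative_shift(2)[OF assms] by (simp add: gradient_def)

lemma levy_type_operator_shift: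
  assumes "f \<in> Cc_infinity"
  shows "levy_type_operator c b Q \<nu> (\<lambda>y. f (x + y)) 0 = levy_type_operator c b Q \<nu> f x"
proof -
  have g: "gradient (\<lambda>y. f (x + y)) z = gradient f (x + z)" for z
    by (rule gradient_shift[OF C_k_Suc_differentiable[OF Cc_infinityD(1)[OF assms]]])
  have "frechet_derivative (\<lambda>y. gradient f (x + y) $ j) (at 0) =
      frechet_derivative (\<lambda>y. gradient f y $ j) (at (x + 0))" for j
    by (rule frechet_derivative_shift(2)[OF C_k_Suc_differentiable[OF C_k_gradient[OF Cc_infinityD(1)[OF assms]]]])
  then have "hessian (\<lambda>y. f (x + y)) 0 = hessian f x"
    by (simp add: hessian_def g)
  then show ?thesis by (simp add: levy_type_operator_def g)
qed

text \<open>The bound \<open>B\<close> is chosen before \<open>\<theta>\<close>, which is the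
  uniformity needed for the last claim of the theorem. Equality at \<open>\<theta>\<close> together
  with the inequality at all \<open>f\<close> will yield an attained supremum.\<close>

lemma characteristics_at_point:
  fixes A :: "(real^'n \<Rightarrow> real) \<Rightarrow> (real^'n \<Rightarrow> real)" and x :: "real^'n"
  assumes D: "D \<subseteq> bounded_borel" and A: "sublinear_on D A" "positive_maximum_principle D A"
    and Cc: "Cc_infinity \<subseteq> D"
  shows "\<exists>B::real. \<forall>\<theta>\<in>Cc_infinity. \<exists>c b Q \<nu>. characteristics c b Q \<nu> \<and>
    (\<forall>f\<in>Cc_infinity. levy_type_operator c b Q \<nu> f x \<le> A f x) \<and>
    levy_type_operator c b Q \<nu> \<theta> x = A \<theta> x \<and>
    ennreal (\<bar>c\<bar> + norm b + norm Q) + (\<integral>\<^sup>+ y. ennreal (min 1 ((norm y)\<^sup>2)) \<partial>\<nu>) \<le> ennreal B"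
proof -
  \<comment> \<open>\<open>A\<close> at \<open>x\<close> in coordinates centred at \<open>x\<close>:
    evaluating \<open>p\<close> at \<open>\<lambda>y. f (x + y)\<close> returns
    \<open>A f x\<close>.\<close>
  define p where "p F = A (\<lambda>z. F (- x + z)) x" for F
  have CcD: "(\<lambda>z. F (a + z)) \<in> Cc_infinity" "(\<lambda>z. F (a + z)) \<in> D"
    if "F \<in> Cc_infinity" for F :: "real^'n \<Rightarrow> real" and a
    using Cc_infinity_shift[OF that] Cc by auto
  have p: "sublinear_functional_on Cc_infinity p"
    unfolding sublinear_functional_on_def
  proof (intro conjI ballI allI impI)
    fix f g :: "real^'n \<Rightarrow> real" assume f: "f \<in> Cc_infinity" and g: "g \<in> Cc_infinity"
    have fg: "(\<lambda>z. f (- x + z) + g (- x + z)) \<in> D"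
      using CcD(2)[OF function_spaceD(2)[OF function_space_Cc_infinity f g]] .
    show "p (\<lambda>y. f y + g y) \<le> p f + p g"
      unfolding p_def using conjunct1[OF A(1)[unfolded sublinear_on_def], rule_format, OF CcD(2)[OF f] CcD(2)[OF g] fg] .
  next
    fix f :: "real^'n \<Rightarrow> real" and r :: real assume f: "f \<in> Cc_infinity" and r: "0 \<le> r"
    have rf: "(\<lambda>z. r * f (- x + z)) \<in> D"
      using CcD(2)[OF function_spaceD(3)[OF function_space_Cc_infinity f]] .
    show "p (\<lambda>y. r * f y) = r * p f"
      unfolding p_def using conjunct2[OF A(1)[unfolded sublinear_on_def], rule_format, OF CcD(2)[OF f] r rf] .
  qed
  have p_max: "p F \<le> 0" if F: "F \<in> Cc_infinity" "\<And>y. F y \<le> F 0" "0 \<le> F 0" for F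
  proof -
    \<comment> \<open>The translate attains its maximum at \<open>z = x\<close>, which turns the
      pointwise hypothesis into the supremum form used by the maximum principle.\<close>
    have "(SUP z. F (- x + z)) = F 0"
    proof (rule cSup_eq_maximum)
      show "F 0 \<in> range (\<lambda>z. F (- x + z))" by (rule image_eqI[of _ _ x]) simp_all
    qed (use F in auto)
    then have "F (- x + x) = (SUP z. F (- x + z)) \<and> (SUP z. F (- x + z)) \<ge> 0"
      using F(3) by simp
    then show ?thesis unfolding p_def
      by (rule A(2)[unfolded positive_maximum_principle_def, THEN bspec[OF _ CcD(2)[OF F(1)]], THEN spec, THEN mp])
  qed
  \<comment> \<open>Any linear \<open>L \<le> p\<close> satisfies
    \<open>- p (- F) \<le> L F \<le> p F\<close>, so \<open>bd F\<close> bounds \<open>|L F|\<close>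
    independently of \<open>L\<close>. Summing over the cutoff monomials gives one bound for all of
    them.\<close>
  define bd where "bd F = \<bar>p F\<bar> + \<bar>p (\<lambda>y. - F y)\<bar>" for F
  define B0 where "B0 = bd cutoff + (\<Sum>i\<in>UNIV. bd (\<lambda>y. y $ i * cutoff y)) +
    (\<Sum>i\<in>UNIV. \<Sum>j\<in>UNIV. bd (\<lambda>y. (y $ i * y $ j) * cutoff y))"
  have bd0: "0 \<le> bd F" for F by (simp add: bd_def)
  have B0: "bd cutoff \<le> B0" "bd (\<lambda>y. y $ i * cutoff y) \<le> B0"
    "bd (\<lambda>y. (y $ i * y $ j) * cutoff y) \<le> B0" for i j
  proof -
    have 1: "bd (\<lambda>y. y $ i * cutoff y) \<le> (\<Sum>i\<in>UNIV. bd (\<lambda>y. y $ i * cutoff y))"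
      by (rule member_le_sum) (auto simp: bd0)
    have "bd (\<lambda>y. (y $ i * y $ j) * cutoff y) \<le> (\<Sum>j\<in>UNIV. bd (\<lambda>y. (y $ i * y $ j) * cutoff y))"
      by (rule member_le_sum) (auto simp: bd0)
    also have "\<dots> \<le> (\<Sum>i\<in>UNIV. \<Sum>j\<in>UNIV. bd (\<lambda>y. (y $ i * y $ j) * cutoff y))"
      by (rule member_le_sum[of i UNIV "\<lambda>i. \<Sum>j\<in>UNIV. bd (\<lambda>y. (y $ i * y $ j) * cutoff y)"])
         (auto simp: bd0 intro: sum_nonneg)
    finally have 2: "bd (\<lambda>y. (y $ i * y $ j) * cutoff y) \<le> (\<Sum>i\<in>UNIV. \<Sum>j\<in>UNIV. bd (\<lambda>y. (y $ i * y $ j) * cutoff y))" .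
    have 3: "0 \<le> (\<Sum>i\<in>UNIV. bd (\<lambda>y. y $ i * cutoff y))"
      "0 \<le> (\<Sum>i\<in>UNIV. \<Sum>j\<in>UNIV. bd (\<lambda>y. (y $ i * y $ j) * cutoff y))"
      by (auto intro!: sum_nonneg bd0)
    show "bd cutoff \<le> B0" "bd (\<lambda>y. y $ i * cutoff y) \<le> B0" "bd (\<lambda>y. (y $ i * y $ j) * cutoff y) \<le> B0"
      using 1 2 3 bd0[of cutoff] unfolding B0_def by linarith+
  qed
  define n where "n = real CARD('n)"
  show ?thesis
  proof (rule exI[of _ "B0 + (n + n * n + 1) * (B0 + 4 * ((1 + n) * B0))"], rule ballI)
    fix \<theta> :: "real^'n \<Rightarrow> real" assume \<theta>: "\<theta> \<in> Cc_infinity"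
    obtain L where L: "linear_functional_on Cc_infinity L"
      and Lp: "\<And>f. f \<in> Cc_infinity \<Longrightarrow> L f \<le> p f" and L\<theta>: "L (\<lambda>y. \<theta> (x + y)) = p (\<lambda>y. \<theta> (x + y))"
      using sublinear_support_functional[OF function_space_Cc_infinity p CcD(1)[OF \<theta>]] by blast
    have pmp: "pmp_functional L"
    proof
      fix f :: "real^'n \<Rightarrow> real" assume "f \<in> Cc_infinity" "\<And>y. f y \<le> f 0" "0 \<le> f 0"
      then show "L f \<le> 0" using order_trans[OF Lp p_max] by blast
    qed (fact L)
    have Lb: "\<bar>L F\<bar> \<le> bd F" if F: "F \<in> Cc_infinity" for F
    proof -
      have "L (\<lambda>y. - F y) = - L F" using linear_functional_onD(2)[OF L F, of "-1"] by simp
      then show ?thesis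
        using Lp[OF F] Lp[OF function_spaceD(4)[OF function_space_Cc_infinity F]] by (simp add: bd_def)
    qed
    show "\<exists>c b Q \<nu>. characteristics c b Q \<nu> \<and>
      (\<forall>f\<in>Cc_infinity. levy_type_operator c b Q \<nu> f x \<le> A f x) \<and>
      levy_type_operator c b Q \<nu> \<theta> x = A \<theta> x \<and>
      ennreal (\<bar>c\<bar> + norm b + norm Q) + (\<integral>\<^sup>+ y. ennreal (min 1 ((norm y)\<^sup>2)) \<partial>\<nu>)
        \<le> ennreal (B0 + (n + n * n + 1) * (B0 + 4 * ((1 + n) * B0)))"
    proof (rule courrege[OF pmp])
      fix c b Q \<nu> assume \<nu>: "characteristics c b Q \<nu>"
        "\<And>f. f \<in> Cc_infinity \<Longrightarrow> L f = levy_type_operator c b Q \<nu> f 0"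
        "\<And>B. \<bar>L cutoff\<bar> \<le> B \<Longrightarrow> (\<And>i. \<bar>L (\<lambda>y. y $ i * cutoff y)\<bar> \<le> B) \<Longrightarrow>
          (\<And>i j. \<bar>L (\<lambda>y. (y $ i * y $ j) * cutoff y)\<bar> \<le> B) \<Longrightarrow>
          ennreal (\<bar>c\<bar> + norm b + norm Q) + (\<integral>\<^sup>+ y. ennreal (min 1 ((norm y)\<^sup>2)) \<partial>\<nu>)
          \<le> ennreal (B + (real CARD('n) + real CARD('n) * real CARD('n) + 1) * (B + 4 * ((1 + real CARD('n)) * B)))"
      have shifted: "L (\<lambda>y. f (x + y)) = levy_type_operator c b Q \<nu> f x" if "f \<in> Cc_infinity" for f
        using \<nu>(2)[OF CcD(1)[OF that]] levy_type_operator_shift[OF that] by simp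
      have p_shifted: "p (\<lambda>y. f (x + y)) = A f x" for f by (simp add: p_def)
      have "levy_type_operator c b Q \<nu> f x \<le> A f x" if "f \<in> Cc_infinity" for f
        using Lp[OF CcD(1)[OF that, of x]] unfolding shifted[OF that] p_shifted .
      moreover have "levy_type_operator c b Q \<nu> \<theta> x = A \<theta> x"
        using L\<theta> unfolding shifted[OF \<theta>] p_shifted .
      moreover have "ennreal (\<bar>c\<bar> + norm b + norm Q) + (\<integral>\<^sup>+ y. ennreal (min 1 ((norm y)\<^sup>2)) \<partial>\<nu>)
          \<le> ennreal (B0 + (n + n * n + 1) * (B0 + 4 * ((1 + n) * B0)))"
        unfolding n_def
        by (intro \<nu>(3) order_trans[OF Lb B0(1)] order_trans[OF Lb B0(2)] order_trans[OF Lb B0(3)]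
            cutoff_Cc_infinity coord_cutoff_Cc_infinity)
      ultimately show "\<exists>c b Q \<nu>. characteristics c b Q \<nu> \<and>
        (\<forall>f\<in>Cc_infinity. levy_type_operator c b Q \<nu> f x \<le> A f x) \<and>
        levy_type_operator c b Q \<nu> \<theta> x = A \<theta> x \<and>
        ennreal (\<bar>c\<bar> + norm b + norm Q) + (\<integral>\<^sup>+ y. ennreal (min 1 ((norm y)\<^sup>2)) \<partial>\<nu>)
          \<le> ennreal (B0 + (n + n * n + 1) * (B0 + 4 * ((1 + n) * B0)))"
        using \<nu>(1) by (intro exI[of _ c] exI[of _ b] exI[of _ Q] exI[of _ \<nu>]) simp
    qed
  qed
qed

theorem theorem4p1:
  fixes D :: "(real^'n \<Rightarrow> real) set"
    and A :: "(real^'n \<Rightarrow> real) \<Rightarrow> (real^'n \<Rightarrow> real)"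
  assumes "D \<subseteq> bounded_borel"
    and "\<And>f. f \<in> D \<Longrightarrow> A f \<in> bounded_borel"
    and "sublinear_on D A"
    and "positive_maximum_principle D A"
    and "Cc_infinity \<subseteq> D"
  shows "\<exists>(I :: (real^'n \<Rightarrow> real) set)
      (c :: (real^'n \<Rightarrow> real) \<Rightarrow> real^'n \<Rightarrow> real)
      (b :: (real^'n \<Rightarrow> real) \<Rightarrow> real^'n \<Rightarrow> real^'n)
      (Q :: (real^'n \<Rightarrow> real) \<Rightarrow> real^'n \<Rightarrow> real^'n^'n)
      (\<nu> :: (real^'n \<Rightarrow> real) \<Rightarrow> real^'n \<Rightarrow> (real^'n) measure).
    (\<forall>\<theta>\<in>I. \<forall>x. characteristics (c \<theta> x) (b \<theta> x) (Q \<theta> x) (\<nu> \<theta> x)) \<and>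
    (\<forall>f\<in>Cc_infinity. \<forall>x.
      ereal (A f x) =
        (SUP \<theta>\<in>I. ereal (levy_type_operator (c \<theta> x) (b \<theta> x) (Q \<theta> x) (\<nu> \<theta> x) f x))) \<and>
    (\<forall>f\<in>Cc_infinity. \<forall>x. \<exists>\<theta>\<in>I.
      A f x = levy_type_operator (c \<theta> x) (b \<theta> x) (Q \<theta> x) (\<nu> \<theta> x) f x) \<and>
    (\<forall>x. (SUP \<theta>\<in>I. ennreal (\<bar>c \<theta> x\<bar> + norm (b \<theta> x) + norm (Q \<theta> x)) +
        (\<integral>\<^sup>+ y. ennreal (min 1 ((norm y)\<^sup>2)) \<partial>\<nu> \<theta> x)) < \<infinity>)"
proof -
  \<comment> \<open>Bundling the four characteristics into one tuple allows a single choice for each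
    pair of index and point.\<close>
  define good where "good x B \<theta> t \<longleftrightarrow> (case t of (c, b, Q, \<nu>) \<Rightarrow> characteristics c b Q \<nu> \<and>
      (\<forall>f\<in>Cc_infinity. levy_type_operator c b Q \<nu> f x \<le> A f x) \<and>
      levy_type_operator c b Q \<nu> \<theta> x = A \<theta> x \<and>
      ennreal (\<bar>c\<bar> + norm b + norm Q) + (\<integral>\<^sup>+ y. ennreal (min 1 ((norm y)\<^sup>2)) \<partial>\<nu>) \<le> ennreal B)"
    for x B \<theta> t
  have "\<exists>B. \<forall>\<theta>\<in>Cc_infinity. \<exists>t. good x B \<theta> t" for x
    using characteristics_at_point[OF assms(1,3,4,5), of x] unfolding good_def by simp
  then obtain B where B: "\<And>x \<theta>. \<theta> \<in> Cc_infinity \<Longrightarrow> \<exists>t. good x (B x) \<theta> t"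
    by metis
  define T where "T \<theta> x = (SOME t. good x (B x) \<theta> t)" for \<theta> x
  have T: "good x (B x) \<theta> (T \<theta> x)" if "\<theta> \<in> Cc_infinity" for \<theta> x
    unfolding T_def by (rule someI_ex[OF B[OF that]])
  define c where "c \<theta> x = fst (T \<theta> x)" for \<theta> x
  define b where "b \<theta> x = fst (snd (T \<theta> x))" for \<theta> x
  define Q where "Q \<theta> x = fst (snd (snd (T \<theta> x)))" for \<theta> x
  define \<nu> where "\<nu> \<theta> x = snd (snd (snd (T \<theta> x)))" for \<theta> x
  have T_eq: "T \<theta> x = (c \<theta> x, b \<theta> x, Q \<theta> x, \<nu> \<theta> x)" for \<theta> x
    by (simp add: c_def b_def Q_def \<nu>_def)
  have char: "characteristics (c \<theta> x) (b \<theta> x) (Q \<theta> x) (\<nu> \<theta> x)"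
    and le: "f \<in> Cc_infinity \<Longrightarrow> levy_type_operator (c \<theta> x) (b \<theta> x) (Q \<theta> x) (\<nu> \<theta> x) f x \<le> A f x"
    and eq: "levy_type_operator (c \<theta> x) (b \<theta> x) (Q \<theta> x) (\<nu> \<theta> x) \<theta> x = A \<theta> x"
    and bound: "ennreal (\<bar>c \<theta> x\<bar> + norm (b \<theta> x) + norm (Q \<theta> x)) +
        (\<integral>\<^sup>+ y. ennreal (min 1 ((norm y)\<^sup>2)) \<partial>\<nu> \<theta> x) \<le> ennreal (B x)"
    if "\<theta> \<in> Cc_infinity" for \<theta> x f
    using T[OF that, of x] unfolding T_eq good_def by auto
  have "ereal (A f x) = (SUP \<theta>\<in>Cc_infinity. ereal (levy_type_operator (c \<theta> x) (b \<theta> x) (Q \<theta> x) (\<nu> \<theta> x) f x))"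
    if f: "f \<in> Cc_infinity" for f x
  proof (rule antisym)
    show "ereal (A f x) \<le> (SUP \<theta>\<in>Cc_infinity. ereal (levy_type_operator (c \<theta> x) (b \<theta> x) (Q \<theta> x) (\<nu> \<theta> x) f x))"
      \<comment> \<open>The index \<open>f\<close> itself attains the value; every other index stays
        below it.\<close>
      by (rule SUP_upper2[OF f]) (simp add: eq[OF f])
    show "(SUP \<theta>\<in>Cc_infinity. ereal (levy_type_operator (c \<theta> x) (b \<theta> x) (Q \<theta> x) (\<nu> \<theta> x) f x)) \<le> ereal (A f x)"
      by (rule SUP_least) (simp add: le f)
  qed
  moreover have "\<exists>\<theta>\<in>Cc_infinity. A f x = levy_type_operator (c \<theta> x) (b \<theta> x) (Q \<theta> x) (\<nu> \<theta> x) f x"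
    if f: "f \<in> Cc_infinity" for f x
    by (rule bexI[OF _ f]) (simp add: eq[OF f])
  moreover have "(SUP \<theta>\<in>Cc_infinity. ennreal (\<bar>c \<theta> x\<bar> + norm (b \<theta> x) + norm (Q \<theta> x)) +
        (\<integral>\<^sup>+ y. ennreal (min 1 ((norm y)\<^sup>2)) \<partial>\<nu> \<theta> x)) < \<infinity>" for x
  proof (rule order.strict_trans1)
    show "(SUP \<theta>\<in>Cc_infinity. ennreal (\<bar>c \<theta> x\<bar> + norm (b \<theta> x) + norm (Q \<theta> x)) +
        (\<integral>\<^sup>+ y. ennreal (min 1 ((norm y)\<^sup>2)) \<partial>\<nu> \<theta> x)) \<le> ennreal (B x)"
      by (rule SUP_least) (rule bound)
  qed simp
  ultimately show ?thesis
    using char by (intro exI[of _ Cc_infinity] exI[of _ c] exI[of _ b] exI[of _ Q] exI[of _ \<nu>] conjI ballI allI)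
qed

end
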